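(* Let $V(x,\epsilon)=\sum_{k=0}^{\infty}V_k(x)\epsilon^k$, where the functions $V_k$ are analytic in the strip $\mathcal{S}=\{x\in\mathbb{C}:-1<\Re(x)<1\}$, real valued on the real line (that is, on $(-1,1)$), and satisfy, for some $B,K,\delta>0$, $$\sup_{k\in\mathbb{N},\,x\in\mathcal{S}}(1+|x|^{1+\delta})B^{-k}|V_k(x)|=K<\infty .$$ Consider, with $\lambda=\epsilon^{-1}>0$, the equation $$(E)\qquad \psi''+(\epsilon^{-2}-V(x,\epsilon))\psi=0,\qquad x\in(-1,1).$$ Then there is $\lambda_0>0$ such that for every $\lambda>\lambda_0$ the general solution of $(E)$ in $(-1,1)$ can be written in the form $$\psi=C_1e^{i\lambda x}\phi_+(x;\lambda)+C_2e^{-i\lambda x}\phi_-(x;\lambda)$$ with $C_1,C_2$ independent of $x$, where $\phi_+$ and $\phi_-$ are complex conjugates of each other (for real $x\in(-1,1)$ and $\lambda>\lambda_0$), where for each $x\in(-1,1)$ the functions $\phi_+(x;\cdot)$ and $\phi_-(x;\cdot)$ are the Borel sums of their asymptotic power series $\sum_k a_{k,+}(x)\lambda^{-k}$ and $\sum_k a_{k,-}(x)\lambda^{-k}$ respectively, and where each of $\psi_\pm=e^{\pm i\lambda x}\phi_\pm$ satisfies the initial condition $$(IC)\qquad \psi(0)=1/\lambda .$$ Furthermore, $\phi_+$ is uniquely determined in the following sense: if for some neighbourhood $\mathcal{V}$ of $0$ and some $\nu>0$ one has $\phi(x;\lambda)=\mathcal{L}(\chi(x,\cdot))(\lambda)$,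 where $\chi(\cdot,t)\in C^2(\mathcal{V})$ for $t\in(0,\infty)$ and $\chi(x,\cdot)\in L^1_\nu:=L^1(\mathbb{R}^+,e^{-\nu t}dt)$ for $x\in(-1,1)$, and if $e^{i\lambda x}\phi$ solves $(E)$ and $(IC)$ on some neighbourhood of $0$ (for large $\lambda$), then $\phi=\phi_+$ (on that neighbourhood). Likewise, $\phi_-$ is uniquely determined in the same sense, with $e^{i\lambda x}\phi$ replaced by $e^{-i\lambda x}\phi$ and $\phi_+$ replaced by $\phi_-$.
   Context: $\mathcal{L}$ is the usual Laplace transform, $(\mathcal{L}Y)(\lambda)=\int_0^\infty e^{-\lambda t}Y(t)\,dt$. Borel summation: a formal series $\tilde y=\sum_{k=K_0}^{\infty}y_k\lambda^{-k}$ with $K_0\in\mathbb{Z}$ and complex coefficients is Borel summable if (1) its truncated Borel transform $Y=\mathcal{B}\tilde y:=\sum_{k>0}\frac{y_k}{(k-1)!}t^{k-1}$ has a nonzero radius of convergence; (2) $Y$ can be analytically continued along $[0,+\infty)$ (to a complex neighbourhood of $[0,\infty)$); (3) the analytic continuation grows at most exponentially along $[0,+\infty)$, hence is Laplace transformable there. The Borel sum of $\tilde y$ is then $y=\mathcal{L}\mathcal{B}\tilde y:=\sum_{k=K_0}^{0}y_k\lambda^{-k}+\mathcal{L}Y$, where the finite sum is understood to be zero if $K_0>0$.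
   Formalization: In the uniqueness claims the neighbourhood of 0 on which the equation holds is taken to be an open interval inside (-1,1); for a disconnected neighbourhood the claim fails, since (IC) at 0 does not control φ on other components. *)

theory Defs
  imports
    "HOL-Complex_Analysis.Complex_Analysis"
    "HOL-Computational_Algebra.Formal_Laurent_Series"
    "HOL-Library.Landau_Symbols"
begin

section \<open>Laplace transform on the half-line\<close>

definition L1_weighted :: "real \<Rightarrow> (real \<Rightarrow> complex) \<Rightarrow> bool" where
  "L1_weighted \<nu> Y \<longleftrightarrow> set_integrable lebesgue {0..} (\<lambda>t. exp (- \<nu> * t) *\<^sub>R Y t)"

definition laplace :: "(real \<Rightarrow> complex) \<Rightarrow> real \<Rightarrow> complex" where
  "laplace Y lam = set_lebesgue_integral lebesgue {0..} (\<lambda>t. exp (- lam * t) *\<^sub>R Y t)"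


section \<open>Borel summation\<close>

text \<open>
  A formal series \<open>\<Sum>k\<ge>K\<^sub>0. y\<^sub>k lam powi (-k)\<close> is a formal Laurent series in the
  indeterminate \<open>1/lam\<close>, so that \<open>y\<^sub>k = fls_nth y k\<close> and \<open>K\<^sub>0 = fls_subdegree y\<close>.
  In its truncated Borel transform the coefficient of \<open>t\<^sup>n\<close> is \<open>y\<^sub>k / (k-1)!\<close> with \<open>k = n + 1\<close>.
\<close>

definition borel_transform :: "complex fls \<Rightarrow> complex fps" where
  "borel_transform y = Abs_fps (\<lambda>n. fls_nth y (int n + 1) / fact n)"

definition exp_growth :: "(real \<Rightarrow> complex) \<Rightarrow> bool" where
  "exp_growth f \<longleftrightarrow> (\<exists>C \<nu>. \<forall>t\<ge>0. norm (f t) \<le> C * exp (\<nu> * t))"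

text \<open>
  Borel summability of \<open>y\<close>, with \<open>Y\<close> a witness for the analytic continuation.
  \<open>analytic_on\<close> the closed half-line means holomorphic in a complex neighbourhood of it;
  the values of \<open>Y\<close> on the half-line are determined by \<open>y\<close>, see below.
\<close>

definition borel_summable_via :: "complex fls \<Rightarrow> (complex \<Rightarrow> complex) \<Rightarrow> bool" where
  "borel_summable_via y Y \<longleftrightarrow>
     fps_conv_radius (borel_transform y) > 0 \<and>
     Y analytic_on (complex_of_real ` {0..}) \<and>
     (\<forall>\<^sub>F t in nhds 0. Y t = eval_fps (borel_transform y) t) \<and>
     exp_growth (\<lambda>t. Y (complex_of_real t))"

lemma borel_summable_via_unique:
  assumes "borel_summable_via y Y1" "borel_summable_via y Y2" "t \<ge> 0"
  shows "Y1 (complex_of_real t) = Y2 (complex_of_real t)"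
proof -
  let ?R = "complex_of_real ` {0..}"
  obtain U1 where U1: "open U1" "?R \<subseteq> U1" "Y1 holomorphic_on U1"
    using assms(1) unfolding borel_summable_via_def analytic_on_holomorphic by blast
  obtain U2 where U2: "open U2" "?R \<subseteq> U2" "Y2 holomorphic_on U2"
    using assms(2) unfolding borel_summable_via_def analytic_on_holomorphic by blast
  define U where "U = connected_component_set (U1 \<inter> U2) 0"
  have "connected ?R"
    by (intro connected_continuous_image continuous_on_of_real continuous_on_id connected_Ici)
  then have RU: "?R \<subseteq> U"
    unfolding U_def using U1 U2 by (intro connected_component_maximal) auto
  have U: "open U" "connected U" "U \<subseteq> U1" "U \<subseteq> U2"
    using U1 U2 connected_component_subset[of "U1 \<inter> U2" 0]
    by (auto simp: U_def intro!: open_connected_component)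
  have "\<forall>\<^sub>F z in nhds 0. Y1 z = Y2 z"
    using assms(1,2) unfolding borel_summable_via_def
    by (auto elim: eventually_elim2)
  then obtain N where N: "open N" "0 \<in> N" "\<forall>z\<in>N. Y1 z = Y2 z"
    unfolding eventually_nhds by blast
  have "0 \<in> U"
    using RU subsetD[OF RU imageI[of 0]] by simp
  show ?thesis
  proof (rule analytic_continuation_open[of "N \<inter> U" U Y1 Y2])
    show "complex_of_real t \<in> U"
      using RU assms(3) by auto
    show "N \<inter> U \<noteq> {}"
      using N \<open>0 \<in> U\<close> by blast
    show "Y1 holomorphic_on U" "Y2 holomorphic_on U"
      using U U1 U2 holomorphic_on_subset by blast+
  qed (use N U in auto)
qed

text \<open>
  \<open>f\<close> is the Borel sum of \<open>y\<close> for all \<open>lam > lam0\<close>; this includes convergence of the Laplace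
  integral there. The finite sum is empty if \<open>fls_subdegree y > 0\<close>.
\<close>

definition is_borel_sum :: "complex fls \<Rightarrow> real \<Rightarrow> (real \<Rightarrow> complex) \<Rightarrow> bool" where
  "is_borel_sum y lam0 f \<longleftrightarrow>
     (\<exists>Y. borel_summable_via y Y \<and>
        (\<forall>lam>lam0. L1_weighted lam (\<lambda>t. Y (complex_of_real t)) \<and>
           f lam = (\<Sum>k = fls_subdegree y..0. fls_nth y k * complex_of_real lam powi (- k))
                 + laplace (\<lambda>t. Y (complex_of_real t)) lam))"

definition has_asymptotic_series :: "(real \<Rightarrow> complex) \<Rightarrow> complex fps \<Rightarrow> bool" where
  "has_asymptotic_series f a \<longleftrightarrow>
     (\<forall>N. (\<lambda>lam. f lam - (\<Sum>k\<le>N. fps_nth a k / complex_of_real lam ^ k))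
            \<in> O[at_top](\<lambda>lam. 1 / complex_of_real lam ^ Suc N))"


section \<open>The differential equation\<close>

definition strip :: "complex set" where
  "strip = {x. -1 < Re x \<and> Re x < 1}"

text \<open>
  \<open>\<psi>\<close> is a solution on the open set \<open>U\<close> of \<open>\<psi>'' + (\<epsilon>\<^sup>-\<^sup>2 - V(x,\<epsilon>)) \<psi> = 0\<close>
  with \<open>\<epsilon> = 1/lam\<close>, where \<open>v\<close> is the value of the convergent series \<open>V(x,\<epsilon>)\<close>.
\<close>

definition solves_E :: "(nat \<Rightarrow> complex \<Rightarrow> complex) \<Rightarrow> real \<Rightarrow> real set \<Rightarrow> (real \<Rightarrow> complex) \<Rightarrow> bool" where
  "solves_E V lam U \<psi> \<longleftrightarrow>
     (\<exists>v \<psi>' \<psi>''. \<forall>x\<in>U.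
        (\<lambda>k. V k (complex_of_real x) * complex_of_real (1 / lam) ^ k) sums v x \<and>
        (\<psi> has_vector_derivative \<psi>' x) (at x) \<and>
        (\<psi>' has_vector_derivative \<psi>'' x) (at x) \<and>
        \<psi>'' x + (1 / complex_of_real (1 / lam) ^ 2 - v x) * \<psi> x = 0)"

definition initial_cond :: "real \<Rightarrow> (real \<Rightarrow> complex) \<Rightarrow> bool" where
  "initial_cond lam \<psi> \<longleftrightarrow> \<psi> 0 = complex_of_real (1 / lam)"

definition wave :: "real \<Rightarrow> (real \<Rightarrow> real \<Rightarrow> complex) \<Rightarrow> real \<Rightarrow> real \<Rightarrow> complex" where
  "wave \<sigma> \<phi> lam x = exp (\<i> * complex_of_real (\<sigma> * lam * x)) * \<phi> x lam"

definition C2_differentiable_on :: "(real \<Rightarrow> complex) \<Rightarrow> real set \<Rightarrow> bool" where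
  "C2_differentiable_on f S \<longleftrightarrow>
     (\<exists>D. (\<forall>x\<in>S. (f has_vector_derivative D x) (at x)) \<and> D C1_differentiable_on S)"

text \<open>
  Uniqueness of the factor \<open>\<phi>\<^sub>0\<close>, considered for \<open>lam > lam0\<close>, among Laplace transforms \<open>\<phi>\<close>.
  The neighbourhood \<open>U\<close> on which \<open>\<phi>\<close> gives a solution has to be connected, since the initial
  condition at \<open>0\<close> says nothing about other components. The lower bound on \<open>lam\<close> in the
  conclusion is where both \<open>\<phi>\<close> and \<open>\<phi>\<^sub>0\<close> are defined.
\<close>

definition uniquely_determined ::
    "(nat \<Rightarrow> complex \<Rightarrow> complex) \<Rightarrow> real \<Rightarrow> real \<Rightarrow> (real \<Rightarrow> real \<Rightarrow> complex) \<Rightarrow> bool" where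
  "uniquely_determined V \<sigma> lam0 \<phi>\<^sub>0 \<longleftrightarrow>
     (\<forall>W U \<nu> chi \<phi>.
        open W \<and> 0 \<in> W \<and> \<nu> > 0 \<and>
        (\<forall>t>0. C2_differentiable_on (\<lambda>x. chi x t) W) \<and>
        (\<forall>x\<in>{-1<..<1}. L1_weighted \<nu> (chi x)) \<and>
        (\<forall>x\<in>{-1<..<1}. \<forall>lam>\<nu>. \<phi> x lam = laplace (chi x) lam) \<and>
        open U \<and> connected U \<and> 0 \<in> U \<and> U \<subseteq> {-1<..<1} \<and>
        (\<forall>\<^sub>F lam in at_top. solves_E V lam U (wave \<sigma> \<phi> lam) \<and> initial_cond lam (wave \<sigma> \<phi> lam))
        \<longrightarrow> (\<forall>x\<in>U. \<forall>lam>max lam0 \<nu>. \<phi> x lam = \<phi>\<^sub>0 x lam))"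

end

theory Submission
  imports Defs
begin

text \<open>
  Write \<open>\<psi> = exp (\<i> lam x) \<phi>\<close>, so that \<open>\<phi>'' + 2 \<i> lam \<phi>' = V \<phi>\<close> with \<open>\<phi> 0 = 1/lam\<close>, and look for \<open>\<phi>\<close> as
  the Laplace transform of \<open>chi x t\<close> in \<open>t\<close>. The transformed problem is
  \<open>(\<partial>\<^sub>x + 2 \<i> \<partial>\<^sub>t) \<partial>\<^sub>x chi = V \<star> chi\<close> with \<open>chi 0 t = chi x 0 = 1\<close>, where \<open>\<star>\<close> is the product with \<open>V 0 x\<close>
  plus the convolution in \<open>t\<close> with the entire function \<open>W x t = (\<Sum>k. V (k+1) x t\<^sup>k / k!)\<close>. The characteristics of
  the first factor are the complex lines \<open>x + \<i> t / 2 = const\<close>; for real \<open>t\<close> they run parallel to the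
  imaginary axis and stay in the strip. Integrating along them and then in \<open>x\<close> gives a fixed point
  equation \<open>chi = 1 + T chi\<close> for functions holomorphic in the tube \<open>\<bar>Re x\<bar> + \<bar>Im t\<bar> / 2 < 1\<close>, and \<open>T\<close> is a
  contraction in the norm with weight \<open>(1 + \<bar>x\<bar>) exp (\<nu> \<bar>t\<bar>)\<close> for large \<open>\<nu>\<close>
  (\<open>T_op_bound\<close>, \<open>chi_fixed_point\<close>). For fixed real \<open>x\<close> the solution is holomorphic in a strip about the
  real \<open>t\<close>-axis and grows at most exponentially, which is Borel summability; Watson's lemma gives the
  asymptotic series (\<open>claplace_asymptotic_series\<close>).

  The differential equation is recovered on the Laplace side, since the convolution theorem
  (\<open>claplace_convolution\<close>) turns both the product with \<open>V\<close> and the integration along the characteristics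
  into iterated Laplace integrals (\<open>G_eq\<close>, \<open>w_eq\<close>, \<open>w_has_field_derivative\<close>). The complex conjugate
  gives the second solution, and a Wronskian argument the general one (\<open>general_solution\<close>).

  For uniqueness, let \<open>D x\<close> be the difference of two candidates for \<open>\<phi>\<^sub>+ x\<close>. By the general solution and the
  initial condition it equals \<open>C (exp (-2 \<i> lam x) \<phi>\<^sub>- x - \<phi>\<^sub>+ x)\<close> with \<open>C\<close> independent of \<open>x\<close>. This
  proportionality continues analytically to a half-plane in \<open>lam\<close>, in which all \<open>D x\<close> are bounded,
  while the bracket is exponentially large in one of the two imaginary directions, depending on
  the sign of \<open>x\<close>. Comparison of several \<open>x\<close> shows that \<open>D x\<close> decays exponentially in both imaginary
  directions, and a bounded holomorphic function on a half-plane with this property vanishes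
  (\<open>carlson_half_plane\<close>).
\<close>

section \<open>Differentiation under the integral sign\<close>

lemma norm_deriv_le_of_bound:
  assumes "f holomorphic_on S" "cball z r \<subseteq> S" "0 < r" "\<And>w. w \<in> cball z r \<Longrightarrow> norm (f w) \<le> B"
  shows "norm (deriv f z) \<le> B / r"
proof -
  have "norm ((deriv ^^ 1) f z) \<le> fact 1 * B / r ^ 1"
    using assms by (intro Cauchy_inequality)
      (auto intro: holomorphic_on_subset[OF _ order_trans[OF ball_subset_cball]]
         holomorphic_on_subset holomorphic_on_imp_continuous_on simp: dist_norm)
  then show ?thesis by simp
qed

lemma norm_diff_le_of_bound:
  assumes hol: "f holomorphic_on S" and sub: "cball z0 r \<subseteq> S" and r: "0 < r"
    and B: "\<And>w. w \<in> cball z0 r \<Longrightarrow> norm (f w) \<le> B"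
    and z: "z \<in> cball z0 (r/2)"
  shows "norm (f z - f z0) \<le> 2 * B / r * norm (z - z0)"
proof (rule field_differentiable_bound[of "cball z0 (r/2)" f "deriv f"])
  fix w assume w: "w \<in> cball z0 (r/2)"
  have bw: "cball w (r/2) \<subseteq> cball z0 r"
  proof
    fix x assume "x \<in> cball w (r/2)"
    then have "dist z0 w + dist w x \<le> r" using w by simp
    then show "x \<in> cball z0 r" using dist_triangle[of z0 x w] by simp
  qed
  have "w \<in> ball z0 r" using w r by auto
  moreover have "f holomorphic_on ball z0 r"
    using hol sub by (meson ball_subset_cball holomorphic_on_subset)
  ultimately show "(f has_field_derivative deriv f w) (at w within cball z0 (r/2))"
    by (meson holomorphic_derivI open_ball has_field_derivative_at_within)
  have "norm (deriv f w) \<le> B / (r/2)"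
    by (rule norm_deriv_le_of_bound[OF hol]) (use bw sub r B in auto)
  then show "norm (deriv f w) \<le> 2 * B / r" by (simp add: field_simps)
qed (use z r in auto)

text \<open>
  A family of holomorphic functions that is locally dominated by an integrable function may be
  differentiated under the integral sign. No hypothesis on the derivatives is needed, because
  Cauchy's inequality bounds the difference quotients.
\<close>

lemma has_field_derivative_lebesgue_integral:
  fixes f :: "complex \<Rightarrow> 'a \<Rightarrow> complex"
  assumes hol: "\<And>a. a \<in> space M \<Longrightarrow> (\<lambda>z. f z a) holomorphic_on S"
    and meas: "\<And>z. z \<in> S \<Longrightarrow> f z \<in> borel_measurable M"
    and r: "0 < r" "cball z0 r \<subseteq> S"
    and g: "integrable M g" "\<And>z a. z \<in> cball z0 r \<Longrightarrow> a \<in> space M \<Longrightarrow> norm (f z a) \<le> g a"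
  shows "((\<lambda>z. \<integral>a. f z a \<partial>M) has_field_derivative (\<integral>a. deriv (\<lambda>z. f z a) z0 \<partial>M)) (at z0)"
proof -
  have "((\<lambda>z. ((\<integral>a. f z a \<partial>M) - (\<integral>a. f z0 a \<partial>M)) / (z - z0)) \<longlongrightarrow> (\<integral>a. deriv (\<lambda>z. f z a) z0 \<partial>M)) (at z0)"
    unfolding tendsto_at_iff_sequentially
  proof (intro allI impI)
    fix X assume X: "\<forall>i. X i \<in> UNIV - {z0}" "X \<longlonglongrightarrow> z0"
    have "eventually (\<lambda>i. dist (X i) z0 < r/2) sequentially"
      using tendstoD[OF X(2), of "r/2"] r(1) by simp
    then obtain N where N: "\<And>i. i \<ge> N \<Longrightarrow> dist (X i) z0 < r/2"
      unfolding eventually_sequentially by blast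
    define Y where "Y i = X (i + N)" for i
    have Y: "Y i \<in> cball z0 (r/2)" "Y i \<noteq> z0" for i
      using N[of "i+N"] X(1) by (auto simp: Y_def dist_commute intro: less_imp_le)
    have YS: "Y i \<in> S" "Y i \<in> cball z0 r" for i
      using Y[of i] r by auto
    have z0: "z0 \<in> S" "z0 \<in> cball z0 r" using r by auto
    have Ylim: "Y \<longlonglongrightarrow> z0" unfolding Y_def by (intro LIMSEQ_ignore_initial_segment X(2))
    have int: "integrable M (f z)" if "z \<in> cball z0 r" for z
      by (rule Bochner_Integration.integrable_bound[OF g(1) meas])
        (use that r g(2) in \<open>force intro!: AE_I2\<close>)+
    have quot_lim: "(\<lambda>i. (f (Y i) a - f z0 a) / (Y i - z0)) \<longlonglongrightarrow> deriv (\<lambda>z. f z a) z0"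
      if a: "a \<in> space M" for a
    proof -
      have "(\<lambda>z. f z a) holomorphic_on ball z0 r"
        using hol[OF a] r by (meson ball_subset_cball holomorphic_on_subset)
      then have "((\<lambda>z. f z a) has_field_derivative deriv (\<lambda>z. f z a) z0) (at z0)"
        using r(1) by (intro holomorphic_derivI[of _ "ball z0 r"]) auto
      then have "((\<lambda>z. (f z a - f z0 a) / (z - z0)) \<longlongrightarrow> deriv (\<lambda>z. f z a) z0) (at z0)"
        by (simp add: has_field_derivative_iff)
      then show ?thesis
        using Y(2) Ylim by (auto simp: tendsto_at_iff_sequentially o_def)
    qed
    have "(\<lambda>i. \<integral>a. (f (Y i) a - f z0 a) / (Y i - z0) \<partial>M) \<longlonglongrightarrow> (\<integral>a. deriv (\<lambda>z. f z a) z0 \<partial>M)"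
    proof (rule integral_dominated_convergence)
      show m: "(\<lambda>a. (f (Y i) a - f z0 a) / (Y i - z0)) \<in> borel_measurable M" for i
        using meas[OF YS(1)[of i]] meas[OF z0(1)] by (intro borel_measurable_divide borel_measurable_diff) auto
      show "(\<lambda>a. deriv (\<lambda>z. f z a) z0) \<in> borel_measurable M"
        by (rule borel_measurable_LIMSEQ_metric[OF m quot_lim])
      show "integrable M (\<lambda>a. 2 * g a / r)" using g(1) by auto
      show "AE a in M. (\<lambda>i. (f (Y i) a - f z0 a) / (Y i - z0)) \<longlonglongrightarrow> deriv (\<lambda>z. f z a) z0"
        using quot_lim by auto
      fix i
      show "AE a in M. norm ((f (Y i) a - f z0 a) / (Y i - z0)) \<le> 2 * g a / r"
      proof (rule AE_I2)
        fix a assume a: "a \<in> space M"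
        have "norm (f (Y i) a - f z0 a) \<le> 2 * g a / r * norm (Y i - z0)"
          by (rule norm_diff_le_of_bound[OF hol[OF a] r(2,1)]) (use g(2) a Y in auto)
        then show "norm ((f (Y i) a - f z0 a) / (Y i - z0)) \<le> 2 * g a / r"
          using Y(2)[of i] by (simp add: norm_divide divide_le_eq)
      qed
    qed
    also have "(\<lambda>i. \<integral>a. (f (Y i) a - f z0 a) / (Y i - z0) \<partial>M)
        = (\<lambda>i. ((\<integral>a. f (Y i) a \<partial>M) - (\<integral>a. f z0 a \<partial>M)) / (Y i - z0))"
      using int[OF YS(2)] int[OF z0(2)] by (simp add: Bochner_Integration.integral_diff)
    finally have "(\<lambda>i. ((\<integral>a. f (X (i+N)) a \<partial>M) - (\<integral>a. f z0 a \<partial>M)) / (X (i+N) - z0))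
        \<longlonglongrightarrow> (\<integral>a. deriv (\<lambda>z. f z a) z0 \<partial>M)" unfolding Y_def .
    then show "((\<lambda>z. ((\<integral>a. f z a \<partial>M) - (\<integral>a. f z0 a \<partial>M)) / (z - z0)) \<circ> X)
        \<longlonglongrightarrow> (\<integral>a. deriv (\<lambda>z. f z a) z0 \<partial>M)"
      unfolding o_def by (rule LIMSEQ_offset)
  qed
  then show ?thesis by (simp add: has_field_derivative_iff)
qed

section \<open>A theorem of Carlson type in a half-plane\<close>

lemma mult_exp_le_iff: "x * exp a \<le> M \<longleftrightarrow> x \<le> M * exp (- a)" for x a M :: real
  by (simp add: exp_minus field_simps)

text \<open>
  A Phragmen-Lindelof principle: \<open>min (Re z) (Im z)\<close> is at most \<open>Im (z\<^sup>2) / norm z\<close>,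
  so the factor \<open>exp (\<i> \<epsilon> z\<^sup>2)\<close> absorbs the growth away from the edges of the quadrant.
\<close>

lemma quadrant_bound:
  fixes H :: "complex \<Rightarrow> complex"
  assumes cont: "continuous_on {z. 0 \<le> Re z \<and> 0 \<le> Im z} H"
    and hol: "H holomorphic_on {z. 0 < Re z \<and> 0 < Im z}"
    and bd: "\<And>z. 0 \<le> Re z \<Longrightarrow> 0 \<le> Im z \<Longrightarrow> norm (H z) \<le> M * exp (c * min (Re z) (Im z))"
    and c: "0 \<le> c" and z: "0 \<le> Re z" "0 \<le> Im z"
  shows "norm (H z) \<le> M"
proof (cases "Re z = 0 \<or> Im z = 0")
  case True
  then show ?thesis using bd[OF z] z by (auto simp: min_def split: if_splits)
next
  case False
  have M: "0 \<le> M" using order_trans[OF norm_ge_zero bd[of 0]] by simp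
  have eps: "norm (H z) \<le> M * exp (2 * \<epsilon> * Re z * Im z)" if e: "0 < \<epsilon>" for \<epsilon>
  proof -
    define R where "R = max (c / \<epsilon>) (norm z) + 1"
    have R: "c / \<epsilon> \<le> R" "norm z < R" unfolding R_def by linarith+
    then have R0: "0 < R" using norm_ge_zero[of z] by linarith
    define S where "S = {z. 0 < Re z \<and> 0 < Im z} \<inter> ball 0 R"
    define f where "f w = H w * exp (\<i> * of_real \<epsilon> * (w * w))" for w
    have nexp: "norm (exp (\<i> * of_real \<epsilon> * (w * w))) = exp (- (2 * \<epsilon> * Re w * Im w))" for w
      by (simp add: norm_exp_eq_Re algebra_simps)
    have clQ: "closed {z. 0 \<le> Re z \<and> 0 \<le> Im z}"
      by (intro closed_Collect_conj closed_Collect_le continuous_intros)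
    have opQ: "open {z. 0 < Re z \<and> 0 < Im z}"
      by (intro open_Collect_conj open_Collect_less continuous_intros)
    have opS: "open S" unfolding S_def using opQ by auto
    have clS: "closure S \<subseteq> {z. 0 \<le> Re z \<and> 0 \<le> Im z} \<inter> cball 0 R"
      by (rule closure_minimal) (auto simp: S_def intro: clQ)
    have "norm (f z) \<le> M"
    proof (rule maximum_modulus_frontier[of f S])
      have "f holomorphic_on S" unfolding f_def
        by (intro holomorphic_intros holomorphic_on_subset[OF hol]) (auto simp: S_def)
      then show "f holomorphic_on interior S" using opS by (simp add: interior_open)
      show "continuous_on (closure S) f" unfolding f_def
        by (intro continuous_intros continuous_on_subset[OF cont]) (use clS in auto)
      show "bounded S" unfolding S_def by (meson bounded_Int bounded_ball)
      show "z \<in> S" using False z R by (auto simp: S_def)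
      fix w assume w: "w \<in> frontier S"
      then have wc: "w \<in> closure S" "w \<notin> S" using opS by (auto simp: frontier_def interior_open)
      then have w0: "0 \<le> Re w" "0 \<le> Im w" using clS by auto
      have nf: "norm (f w) \<le> M * exp (c * min (Re w) (Im w) - 2 * \<epsilon> * Re w * Im w)"
        using mult_right_mono[OF bd[OF w0], of "exp (- (2 * \<epsilon> * Re w * Im w))"]
        unfolding f_def norm_mult[of "H w"] nexp by (simp add: mult_exp_exp mult.assoc)
      have "c * min (Re w) (Im w) \<le> 2 * \<epsilon> * Re w * Im w"
      proof (cases "Re w = 0 \<or> Im w = 0")
        case True then show ?thesis using w0 by (auto simp: min_def)
      next
        case False
        then have "norm w = R" using wc w0 clS by (auto simp: S_def)
        moreover have "norm w \<le> Re w + Im w" using cmod_le[of w] w0 by auto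
        ultimately have "R \<le> 2 * max (Re w) (Im w)" by (auto simp: max_def)
        moreover have "c \<le> \<epsilon> * R" using R(1) e by (simp add: field_simps)
        ultimately have "c \<le> \<epsilon> * (2 * max (Re w) (Im w))"
          using e by (meson less_eq_real_def mult_left_mono order_trans)
        then have "c * min (Re w) (Im w) \<le> \<epsilon> * (2 * max (Re w) (Im w)) * min (Re w) (Im w)"
          using w0 by (intro mult_right_mono) auto
        also have "\<dots> = 2 * \<epsilon> * Re w * Im w" by (auto simp: max_def min_def)
        finally show ?thesis .
      qed
      then have "M * exp (c * min (Re w) (Im w) - 2 * \<epsilon> * Re w * Im w) \<le> M * 1"
        using M by (intro mult_left_mono) auto
      then show "norm (f w) \<le> M" using nf by simp
    qed
    then show ?thesis by (simp add: f_def norm_mult nexp mult_exp_le_iff mult_ac)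
  qed
  have "((\<lambda>\<epsilon>. M * exp (2 * \<epsilon> * Re z * Im z)) \<longlongrightarrow> M * exp (2 * 0 * Re z * Im z)) (at_right 0)"
    by (intro tendsto_intros)
  then have "norm (H z) \<le> M * exp (2 * 0 * Re z * Im z)"
    by (rule tendsto_lowerbound) (auto simp: eventually_at_right_less eps intro!: eventually_at_rightI[of 0 1])
  then show ?thesis by simp
qed

text \<open>
  Decay along the imaginary direction is turned into decay along the real direction,
  first in the sector of half-opening \<open>\<pi>/4\<close> and then in the two quadrants.
\<close>

lemma half_plane_decay_step:
  fixes F :: "complex \<Rightarrow> complex"
  assumes S: "open S" "{z. 0 \<le> Re z} \<subseteq> S" and hol: "F holomorphic_on S" and c: "0 \<le> c"
    and bd: "\<And>z. 0 \<le> Re z \<Longrightarrow> norm (F z) \<le> M * exp (- c * \<bar>Im z\<bar>)"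
    and z: "0 \<le> Re z"
  shows "norm (F z) \<le> M * exp (- c * (Re z + \<bar>Im z\<bar>))"
proof -
  have M: "0 \<le> M" using order_trans[OF norm_ge_zero bd[of 0]] by simp
  \<comment> \<open>multiplication by \<open>1 - \<i>\<close> maps the quadrant onto the sector \<open>\<bar>Im z\<bar> \<le> Re z\<close>\<close>
  have sector: "norm (F z) \<le> M * exp (- c * Re z)" if z: "\<bar>Im z\<bar> \<le> Re z" for z
  proof -
    define H where "H w = F ((1 - \<i>) * w) * exp (of_real c * ((1 - \<i>) * w))" for w
    have im: "(\<lambda>w. (1 - \<i>) * w) ` {z. 0 \<le> Re z \<and> 0 \<le> Im z} \<subseteq> S"
      using S(2) by auto
    have holH: "H holomorphic_on T" if "T \<subseteq> {z. 0 \<le> Re z \<and> 0 \<le> Im z}" for T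
      unfolding H_def using im that
      by (intro holomorphic_intros holomorphic_on_compose_gen[OF _ hol, unfolded o_def]) auto
    have "norm (H ((1 + \<i>) / 2 * z)) \<le> M"
    proof (rule quadrant_bound[of H M "2 * c"])
      show "continuous_on {z. 0 \<le> Re z \<and> 0 \<le> Im z} H"
        by (intro holomorphic_on_imp_continuous_on holH) auto
      show "H holomorphic_on {z. 0 < Re z \<and> 0 < Im z}" by (intro holH) auto
      fix w assume w: "0 \<le> Re w" "0 \<le> Im w"
      have "norm (H w) = norm (F ((1 - \<i>) * w)) * exp (c * (Re w + Im w))"
        by (simp add: H_def norm_mult norm_exp_eq_Re)
      also have "\<dots> \<le> M * exp (- c * \<bar>Im w - Re w\<bar>) * exp (c * (Re w + Im w))"
        using bd[of "(1 - \<i>) * w"] w by (intro mult_right_mono) auto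
      also have "\<dots> = M * exp (c * (Re w + Im w) - c * \<bar>Im w - Re w\<bar>)"
        by (simp add: mult_exp_exp mult.assoc)
      also have "c * (Re w + Im w) - c * \<bar>Im w - Re w\<bar> = 2 * c * min (Re w) (Im w)"
        by (auto simp: min_def algebra_simps abs_if)
      finally show "norm (H w) \<le> M * exp (2 * c * min (Re w) (Im w))" .
    qed (use c z in \<open>auto simp: abs_le_iff\<close>)
    moreover have "(1 - \<i>) * ((1 + \<i>) / 2 * z) = z" by (simp add: algebra_simps)
    ultimately have "norm (F z) * exp (c * Re z) \<le> M"
      unfolding H_def by (simp only: norm_mult norm_exp_eq_Re) simp
    then show ?thesis by (simp add: mult_exp_le_iff)
  qed
  have max_bd: "norm (F z) \<le> M * exp (- c * max (Re z) \<bar>Im z\<bar>)" if "0 \<le> Re z" for z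
    using sector[of z] bd[of z] that by (auto simp: max_def)
  \<comment> \<open>to be used with \<open>u = 1\<close> and \<open>u = -\<i>\<close>, for the upper and the lower quadrant\<close>
  have quad: "norm (F (u * w)) \<le> M * exp (- c * (Re w + Im w))"
    if w: "0 \<le> Re w" "0 \<le> Im w"
      and u: "\<And>w. 0 \<le> Re w \<Longrightarrow> 0 \<le> Im w \<Longrightarrow> 0 \<le> Re (u * w) \<and>
           max (Re (u * w)) \<bar>Im (u * w)\<bar> = max (Re w) (Im w)" for u w
  proof -
    define H where "H w = F (u * w) * exp (of_real c * ((1 - \<i>) * w))" for w
    have im: "(\<lambda>w. u * w) ` {z. 0 \<le> Re z \<and> 0 \<le> Im z} \<subseteq> S" using S(2) u by auto
    have holH: "H holomorphic_on T" if "T \<subseteq> {z. 0 \<le> Re z \<and> 0 \<le> Im z}" for T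
      unfolding H_def using im that
      by (intro holomorphic_intros holomorphic_on_compose_gen[OF _ hol, unfolded o_def]) auto
    have "norm (H w) \<le> M"
    proof (rule quadrant_bound[of H M c])
      show "continuous_on {z. 0 \<le> Re z \<and> 0 \<le> Im z} H"
        by (intro holomorphic_on_imp_continuous_on holH) auto
      show "H holomorphic_on {z. 0 < Re z \<and> 0 < Im z}" by (intro holH) auto
      fix w assume w: "0 \<le> Re w" "0 \<le> Im w"
      have "norm (H w) = norm (F (u * w)) * exp (c * (Re w + Im w))"
        by (simp add: H_def norm_mult norm_exp_eq_Re)
      also have "\<dots> \<le> M * exp (- c * max (Re w) (Im w)) * exp (c * (Re w + Im w))"
        using max_bd[of "u * w"] u[OF w] by (intro mult_right_mono) auto
      also have "\<dots> = M * exp (c * (Re w + Im w) - c * max (Re w) (Im w))"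
        by (simp add: mult_exp_exp mult.assoc)
      also have "c * (Re w + Im w) - c * max (Re w) (Im w) = c * min (Re w) (Im w)"
        by (auto simp: min_def max_def algebra_simps)
      finally show "norm (H w) \<le> M * exp (c * min (Re w) (Im w))" .
    qed (use c w in auto)
    then have "norm (F (u * w)) * exp (c * (Re w + Im w)) \<le> M"
      unfolding H_def by (simp add: norm_mult norm_exp_eq_Re)
    then show ?thesis by (simp add: mult_exp_le_iff)
  qed
  show ?thesis
  proof (cases "0 \<le> Im z")
    case True
    then show ?thesis using quad[of z 1] z by (auto simp: abs_if)
  next
    case False
    then show ?thesis using quad[of "\<i> * z" "- \<i>"] z
      by (auto simp: max.commute abs_if algebra_simps)
  qed
qed

text \<open>
  A function with this decay remains in the same class when it is multiplied by \<open>exp (c z)\<close>.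
  Iteration shows that it decays faster than every exponential, so it is zero.
\<close>

lemma carlson_half_plane:
  fixes F :: "complex \<Rightarrow> complex"
  assumes hol: "F holomorphic_on {z. a < Re z}" and c: "0 < c"
    and bd: "\<And>z. a < Re z \<Longrightarrow> norm (F z) \<le> M * exp (- c * \<bar>Im z\<bar>)"
    and z: "a < Re z"
  shows "F z = 0"
proof -
  define b where "b = (a + Re z) / 2"
  have b: "a < b" "b < Re z" using z by (auto simp: b_def)
  define S where "S = {w. a - b < Re w}"
  have S: "open S" "{w. 0 \<le> Re w} \<subseteq> S"
    using b by (auto simp: S_def intro!: open_Collect_less continuous_intros)
  define G where "G n w = F (w + of_real b) * exp (of_real (real n * c) * w)" for n w
  have holG: "G n holomorphic_on S" for n
    unfolding G_def S_def
    by (intro holomorphic_intros holomorphic_on_compose_gen[OF _ hol, unfolded o_def]) auto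
  have G: "norm (G n w) \<le> M * exp (- c * \<bar>Im w\<bar>)" if "0 \<le> Re w" for n w
    using that
  proof (induction n arbitrary: w)
    case 0
    then show ?case using bd[of "w + of_real b"] b by (simp add: G_def)
  next
    case (Suc n)
    have "norm (G n w) \<le> M * exp (- c * (Re w + \<bar>Im w\<bar>))"
      by (rule half_plane_decay_step[OF S holG]) (use c Suc in auto)
    then have "norm (G n w) * exp (c * Re w) \<le> M * exp (- c * (Re w + \<bar>Im w\<bar>)) * exp (c * Re w)"
      by (intro mult_right_mono) auto
    also have "\<dots> = M * exp (- c * \<bar>Im w\<bar>)" 
      by (simp add: mult_exp_exp mult.assoc algebra_simps)
    also have "norm (G n w) * exp (c * Re w) = norm (G (Suc n) w)"
      by (simp add: G_def norm_mult norm_exp_eq_Re algebra_simps exp_add)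
    finally show ?case .
  qed
  define w where "w = z - of_real b"
  have w: "0 < Re w" "z = w + of_real b" using b by (auto simp: w_def)
  define q where "q = exp (- c * Re w)"
  have le: "norm (F z) \<le> M * exp (- c * \<bar>Im w\<bar>) * q ^ n" for n
  proof -
    have "norm (F z) * exp (real n * c * Re w) \<le> M * exp (- c * \<bar>Im w\<bar>)"
      using G[of w n] w by (simp add: G_def norm_mult norm_exp_eq_Re)
    then show ?thesis by (simp add: q_def exp_minus field_simps flip: exp_of_nat_mult)
  qed
  have "(\<lambda>n. M * exp (- c * \<bar>Im w\<bar>) * q ^ n) \<longlonglongrightarrow> M * exp (- c * \<bar>Im w\<bar>) * 0"
    by (intro tendsto_intros LIMSEQ_power_zero) (use c w in \<open>auto simp: q_def\<close>)
  then have "norm (F z) \<le> 0"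
    by (intro LIMSEQ_le_const[where X = "\<lambda>n. M * exp (- c * \<bar>Im w\<bar>) * q ^ n"]) (use le in auto)
  then show ?thesis by simp
qed

section \<open>Functions holomorphic on complex lines in a tube\<close>

text \<open>
  The domain of the Borel transform: \<open>x\<close> in the strip and \<open>t\<close> in a strip about the real axis whose
  width depends on \<open>x\<close>. It is convex and is mapped into itself by the characteristic flow
  \<open>(x, t) \<mapsto> (x + \<i> (t - s) / 2, s)\<close> for \<open>s\<close> on the segment from \<open>0\<close> to \<open>t\<close>.
\<close>

definition tube :: "(complex \<times> complex) set" where
  "tube = {(x, t). \<bar>Re x\<bar> + \<bar>Im t\<bar> / 2 < 1}"

text \<open>
  Holomorphy in two variables, encoded as holomorphy along every complex line together with
  boundedness on bounded sets. This notion is stable under linear substitutions, products,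
  parameter integrals and locally uniform limits by one-variable theorems alone, and it implies
  joint continuity.
\<close>

definition line_holomorphic :: "(complex \<Rightarrow> complex \<Rightarrow> complex) \<Rightarrow> bool" where
  "line_holomorphic f \<longleftrightarrow>
     (\<forall>a b c d. (\<lambda>z. f (a + z * b) (c + z * d)) holomorphic_on {z. (a + z * b, c + z * d) \<in> tube})"

definition bounded_on_tube :: "real \<Rightarrow> real \<Rightarrow> (complex \<Rightarrow> complex \<Rightarrow> complex) \<Rightarrow> bool" where
  "bounded_on_tube R M f \<longleftrightarrow>
     (\<forall>x t. (x, t) \<in> tube \<longrightarrow> norm x \<le> R \<longrightarrow> norm t \<le> R \<longrightarrow> norm (f x t) \<le> M)"

definition tube_holomorphic :: "(complex \<Rightarrow> complex \<Rightarrow> complex) \<Rightarrow> bool" where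
  "tube_holomorphic f \<longleftrightarrow> line_holomorphic f \<and> (\<forall>R. \<exists>M. bounded_on_tube R M f)"

text \<open>A family of such functions over \<open>[0, 1]\<close> that can be integrated over the parameter.\<close>

definition tube_family :: "(real \<Rightarrow> complex \<Rightarrow> complex \<Rightarrow> complex) \<Rightarrow> bool" where
  "tube_family f \<longleftrightarrow>
     (\<forall>r\<in>{0..1}. line_holomorphic (f r)) \<and>
     (\<forall>R. \<exists>M. \<forall>r\<in>{0..1}. bounded_on_tube R M (f r)) \<and>
     (\<forall>x t. (x, t) \<in> tube \<longrightarrow> continuous_on {0..1} (\<lambda>r. f r x t))"

lemma tube_real_iff [simp]: "(x, of_real t) \<in> tube \<longleftrightarrow> x \<in> strip"
  by (auto simp: tube_def strip_def)

lemma tube_strip: "(x, t) \<in> tube \<Longrightarrow> x \<in> strip"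
  by (auto simp: tube_def strip_def abs_less_iff)

lemma tube_convex_comb:
  assumes "(x, t) \<in> tube" "s \<in> {0..1}" "r \<in> {0..1}"
  shows "(of_real s * x, t) \<in> tube" "(x, of_real s * t) \<in> tube"
    "(x + \<i> / 2 * of_real (1 - s) * t, of_real s * t) \<in> tube"
proof -
  have 1: "\<bar>s * y\<bar> \<le> \<bar>y\<bar>" for y using assms(2) by (simp add: abs_mult mult_left_le_one_le)
  show "(of_real s * x, t) \<in> tube" "(x, of_real s * t) \<in> tube"
    using assms(1) 1[of "Re x"] 1[of "Im t"] by (auto simp: tube_def)
  have "\<bar>Re x - (1 - s) * Im t / 2\<bar> + \<bar>s * Im t\<bar> / 2 
      \<le> \<bar>Re x\<bar> + \<bar>(1 - s) * Im t\<bar> / 2 + \<bar>s * Im t\<bar> / 2" by linarith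
  also have "\<dots> = \<bar>Re x\<bar> + \<bar>Im t\<bar> / 2"
  proof -
    have "\<bar>(1 - s) * Im t\<bar> = (1 - s) * \<bar>Im t\<bar>" "\<bar>s * Im t\<bar> = s * \<bar>Im t\<bar>"
      using assms(2) by (auto simp: abs_mult)
    then show ?thesis by (simp only:) (simp add: field_simps)
  qed
  finally show "(x + \<i> / 2 * of_real (1 - s) * t, of_real s * t) \<in> tube"
    using assms(1) by (auto simp: tube_def algebra_simps diff_divide_distrib add_divide_distrib)
qed

lemma open_tube: "open tube"
proof -
  have "tube = {p. \<bar>Re (fst p)\<bar> + \<bar>Im (snd p)\<bar> / 2 < 1}" by (auto simp: tube_def)
  also have "open \<dots>" by (intro open_Collect_less continuous_intros) auto
  finally show ?thesis .
qed

lemma open_tube_line: "open {z::complex. (a + z * b, c + z * d) \<in> tube}"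
  using open_vimage[OF open_tube, of "\<lambda>z. (a + z * b, c + z * d)"]
  by (simp add: vimage_def continuous_intros)

lemma open_strip: "open strip"
  unfolding strip_def by (intro open_Collect_conj open_Collect_less continuous_intros)

lemma convex_strip: "convex strip"
proof -
  have "strip = {x. Re x > -1} \<inter> {x. Re x < 1}" by (auto simp: strip_def)
  also have "convex \<dots>"
    by (intro convex_Int convex_halfspace_Re_gt convex_halfspace_Re_lt)
  finally show ?thesis .
qed

lemma line_holomorphicD:
  "line_holomorphic f \<Longrightarrow> (\<lambda>z. f (a + z * b) (c + z * d)) holomorphic_on {z. (a + z * b, c + z * d) \<in> tube}"
  by (simp add: line_holomorphic_def)

lemma tube_holomorphicD:
  assumes "tube_holomorphic f"
  shows "x \<in> strip \<Longrightarrow> f x holomorphic_on {t. \<bar>Im t\<bar> < 2 * (1 - \<bar>Re x\<bar>)}"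
    and "(\<lambda>x. f x (of_real t)) holomorphic_on strip"
  using line_holomorphicD[of f x 0 0 1] line_holomorphicD[of f 0 1 "of_real t" 0] assms
  by (auto simp: tube_holomorphic_def tube_def strip_def abs_less_iff field_simps elim!: holomorphic_on_subset)

lemma tube_holomorphic_strip:
  assumes "g holomorphic_on strip" "\<And>R. \<exists>M. \<forall>x\<in>strip. norm x \<le> R \<longrightarrow> norm (g x) \<le> M"
  shows "tube_holomorphic (\<lambda>x t. g x)"
  unfolding tube_holomorphic_def line_holomorphic_def
proof (intro conjI allI)
  fix a b c d
  show "(\<lambda>z. g (a + z * b)) holomorphic_on {z. (a + z * b, c + z * d) \<in> tube}"
    by (rule holomorphic_on_compose_gen[OF _ assms(1), unfolded o_def])
      (auto intro!: holomorphic_intros dest: tube_strip)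
next
  fix R
  show "\<exists>M. bounded_on_tube R M (\<lambda>x t. g x)"
    using assms(2)[of R] unfolding bounded_on_tube_def by (meson tube_strip)
qed

lemma tube_holomorphic_const: "tube_holomorphic (\<lambda>x t. c)"
  by (rule tube_holomorphic_strip) auto

lemma tube_holomorphic_fst: "tube_holomorphic (\<lambda>x t. x)"
  by (rule tube_holomorphic_strip) (auto intro: holomorphic_intros)

lemma tube_holomorphic_snd: "tube_holomorphic (\<lambda>x t. t)"
  unfolding tube_holomorphic_def line_holomorphic_def bounded_on_tube_def
  by (auto intro!: holomorphic_intros)

lemma tube_holomorphic_add:
  assumes "tube_holomorphic f" "tube_holomorphic g"
  shows "tube_holomorphic (\<lambda>x t. f x t + g x t)"
  unfolding tube_holomorphic_def line_holomorphic_def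
proof (intro conjI allI)
  fix R
  obtain M N where "bounded_on_tube R M f" "bounded_on_tube R N g"
    using assms unfolding tube_holomorphic_def by meson
  then have "bounded_on_tube R (M + N) (\<lambda>x t. f x t + g x t)"
    unfolding bounded_on_tube_def by (meson norm_triangle_le add_mono)
  then show "\<exists>M. bounded_on_tube R M (\<lambda>x t. f x t + g x t)" ..
qed (use assms in \<open>auto simp: tube_holomorphic_def line_holomorphic_def intro!: holomorphic_intros\<close>)

lemma bounded_on_tube_mult:
  assumes "bounded_on_tube R M f" "bounded_on_tube R N g"
  shows "bounded_on_tube R (\<bar>M\<bar> * \<bar>N\<bar>) (\<lambda>x t. f x t * g x t)"
  using assms unfolding bounded_on_tube_def norm_mult
  by (meson mult_mono norm_ge_zero abs_ge_self abs_ge_zero order_trans)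

lemma line_holomorphic_mult:
  "line_holomorphic f \<Longrightarrow> line_holomorphic g \<Longrightarrow> line_holomorphic (\<lambda>x t. f x t * g x t)"
  by (auto simp: line_holomorphic_def intro!: holomorphic_intros)

lemma tube_holomorphic_mult:
  assumes "tube_holomorphic f" "tube_holomorphic g"
  shows "tube_holomorphic (\<lambda>x t. f x t * g x t)"
  unfolding tube_holomorphic_def
proof (intro conjI allI)
  fix R
  obtain M N where "bounded_on_tube R M f" "bounded_on_tube R N g"
    using assms unfolding tube_holomorphic_def by meson
  from bounded_on_tube_mult[OF this] show "\<exists>M. bounded_on_tube R M (\<lambda>x t. f x t * g x t)" ..
qed (use assms in \<open>simp add: tube_holomorphic_def line_holomorphic_mult\<close>)

lemma tube_holomorphic_diff:
  assumes "tube_holomorphic f" "tube_holomorphic g"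
  shows "tube_holomorphic (\<lambda>x t. f x t - g x t)"
  using tube_holomorphic_add[OF assms(1) tube_holomorphic_mult[OF tube_holomorphic_const[of "-1"] assms(2)]]
  by simp

lemma tube_holomorphic_sum:
  assumes "\<And>i. i \<in> I \<Longrightarrow> tube_holomorphic (f i)"
  shows "tube_holomorphic (\<lambda>x t. \<Sum>i\<in>I. f i x t)"
  using assms
  by (induction I rule: infinite_finite_induct)
    (auto intro: tube_holomorphic_const tube_holomorphic_add)

lemma tube_holomorphic_power:
  assumes "tube_holomorphic f"
  shows "tube_holomorphic (\<lambda>x t. f x t ^ n)"
  by (induction n) (auto intro: tube_holomorphic_const tube_holomorphic_mult assms)

text \<open>
  Joint continuity: on the complex line through \<open>p\<close> and a nearby point \<open>q\<close>, a disc of radius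
  \<open>e / norm (q - p)\<close> lies in the tube, and Cauchy's inequality on it gives a Lipschitz bound.
\<close>

lemma tube_holomorphic_continuous_on:
  assumes f: "tube_holomorphic f"
  shows "continuous_on tube (\<lambda>p. f (fst p) (snd p))"
proof (rule continuous_at_imp_continuous_on, rule ballI)
  fix p assume p: "p \<in> tube"
  obtain e where e: "0 < e" "cball p e \<subseteq> tube"
    using open_tube p open_contains_cball by blast
  obtain M where M: "bounded_on_tube (norm p + e) M f"
    using f unfolding tube_holomorphic_def by meson
  have M': "norm (f (fst q) (snd q)) \<le> M" if "q \<in> cball p e" for q
  proof -
    have "norm q \<le> norm p + e" using that norm_triangle_sub[of q p] by (auto simp: dist_norm norm_minus_commute)
    moreover have "norm (fst q) \<le> norm q" "norm (snd q) \<le> norm q"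
      using norm_fst_le[of "fst q" "snd q"] norm_snd_le[of "snd q" "fst q"] by auto
    ultimately show ?thesis
      using M that e unfolding bounded_on_tube_def
      by (metis order_trans prod.collapse subset_eq)
  qed
  have M0: "0 \<le> M" using M'[of p] e norm_ge_zero order_trans by (meson centre_in_cball less_imp_le)
  have lip: "norm (f (fst q) (snd q) - f (fst p) (snd p)) \<le> 2 * M / e * norm (q - p)"
    if q: "norm (q - p) \<le> e / 2" for q
  proof (cases "q = p")
    case False
    define b d where "b = fst q - fst p" and "d = snd q - snd p"
    define r where "r = e / norm (q - p)"
    have qp: "0 < norm (q - p)" using False by simp
    have "0 < r" unfolding r_def using e(1) qp by (rule divide_pos_pos)
    moreover have "2 \<le> r" using q qp by (simp add: r_def field_simps)
    ultimately have r: "0 < r" "2 \<le> r" .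
    have sub: "(fst p + z * b, snd p + z * d) \<in> cball p e" if "z \<in> cball 0 r" for z
    proof -
      have "norm (z * b, z * d) = norm z * norm (q - p)"
        by (simp add: norm_Pair norm_mult power_mult_distrib b_def d_def norm_prod_def real_sqrt_mult
              flip: distrib_left)
      also have "\<dots> \<le> r * norm (q - p)" using that e by (intro mult_right_mono) auto
      finally have "norm (z * b, z * d) \<le> e" using qp by (simp add: r_def)
      moreover have "dist p (fst p + z * b, snd p + z * d) = norm (z * b, z * d)"
        by (simp add: dist_norm norm_prod_def norm_minus_commute)
      ultimately show ?thesis by simp
    qed
    have "norm (f (fst p + 1 * b) (snd p + 1 * d) - f (fst p + 0 * b) (snd p + 0 * d))
        \<le> 2 * M / r * norm (1 - 0 :: complex)"
      by (rule norm_diff_le_of_bound[where S = "{z. (fst p + z * b, snd p + z * d) \<in> tube}"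
            and f = "\<lambda>z. f (fst p + z * b) (snd p + z * d)"])
        (use f sub e r M' in \<open>fastforce simp: tube_holomorphic_def line_holomorphic_def\<close>)+
    then show ?thesis by (simp add: b_def d_def r_def)
  qed auto
  show "isCont (\<lambda>p. f (fst p) (snd p)) p"
    unfolding continuous_at_eps_delta
  proof (intro allI impI)
    fix \<epsilon> :: real assume \<epsilon>: "0 < \<epsilon>"
    define K where "K = 2 * M / e + 1"
    have K: "0 < K" using M0 e by (auto simp: K_def intro: add_nonneg_pos)
    have "dist (f (fst q) (snd q)) (f (fst p) (snd p)) < \<epsilon>"
      if "dist q p < min (e/2) (\<epsilon> / K)" for q
    proof -
      have "norm (f (fst q) (snd q) - f (fst p) (snd p)) \<le> 2 * M / e * norm (q - p)"
        using that by (intro lip) (auto simp: dist_norm)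
      also have "\<dots> \<le> K * norm (q - p)" by (intro mult_right_mono) (auto simp: K_def)
      also have "\<dots> < \<epsilon>" using that K by (simp add: dist_norm field_simps)
      finally show ?thesis by (simp add: dist_norm)
    qed
    then show "\<exists>d>0. \<forall>q. dist q p < d \<longrightarrow> dist (f (fst q) (snd q)) (f (fst p) (snd p)) < \<epsilon>"
      using e \<epsilon> K by (intro exI[of _ "min (e/2) (\<epsilon> / K)"]) auto
  qed
qed

lemma tube_holomorphic_continuous_on_compose:
  assumes "tube_holomorphic f" "continuous_on A u" "continuous_on A v"
    "\<And>a. a \<in> A \<Longrightarrow> (u a, v a) \<in> tube"
  shows "continuous_on A (\<lambda>a. f (u a) (v a))"
proof -
  have "continuous_on A (\<lambda>a. (\<lambda>p. f (fst p) (snd p)) (u a, v a))"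
    using assms
    by (intro continuous_on_compose2[OF tube_holomorphic_continuous_on] continuous_intros) auto
  then show ?thesis by simp
qed

lemma tube_family_compose:
  fixes \<alpha> \<beta> \<gamma> :: "real \<Rightarrow> complex"
  assumes f: "tube_holomorphic f"
    and cont: "continuous_on {0..1} \<alpha>" "continuous_on {0..1} \<beta>" "continuous_on {0..1} \<gamma>"
    and le: "\<And>r. r \<in> {0..1} \<Longrightarrow> norm (\<alpha> r) \<le> 1" "\<And>r. r \<in> {0..1} \<Longrightarrow> norm (\<beta> r) \<le> 1" "\<And>r. r \<in> {0..1} \<Longrightarrow> norm (\<gamma> r) \<le> 1"
    and tube: "\<And>r x t. r \<in> {0..1} \<Longrightarrow> (x, t) \<in> tube \<Longrightarrow> (\<alpha> r * x + \<beta> r * t, \<gamma> r * t) \<in> tube"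
  shows "tube_family (\<lambda>r x t. f (\<alpha> r * x + \<beta> r * t) (\<gamma> r * t))"
  unfolding tube_family_def
proof (intro conjI ballI allI impI)
  fix r :: real assume r: "r \<in> {0..1}"
  show "line_holomorphic (\<lambda>x t. f (\<alpha> r * x + \<beta> r * t) (\<gamma> r * t))"
    unfolding line_holomorphic_def
  proof (intro allI)
    fix a b c d
    have eq: "(\<alpha> r * (a + z * b) + \<beta> r * (c + z * d), \<gamma> r * (c + z * d))
       = ((\<alpha> r * a + \<beta> r * c) + z * (\<alpha> r * b + \<beta> r * d), \<gamma> r * c + z * (\<gamma> r * d))" for z
      by (simp add: algebra_simps)
    have "(\<lambda>z. f ((\<alpha> r * a + \<beta> r * c) + z * (\<alpha> r * b + \<beta> r * d)) (\<gamma> r * c + z * (\<gamma> r * d)))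
       holomorphic_on {z. (a + z * b, c + z * d) \<in> tube}"
      by (rule holomorphic_on_subset[OF line_holomorphicD])
        (use f in \<open>auto simp: tube_holomorphic_def simp flip: eq intro: tube[OF r]\<close>)
    then show "(\<lambda>z. f (\<alpha> r * (a + z * b) + \<beta> r * (c + z * d)) (\<gamma> r * (c + z * d)))
       holomorphic_on {z. (a + z * b, c + z * d) \<in> tube}"
      using eq by simp
  qed
next
  fix R :: real
  obtain M where M: "bounded_on_tube (2 * R) M f"
    using f unfolding tube_holomorphic_def by meson
  have "bounded_on_tube R M (\<lambda>x t. f (\<alpha> r * x + \<beta> r * t) (\<gamma> r * t))" if r: "r \<in> {0..1}" for r
    unfolding bounded_on_tube_def
  proof (intro allI impI)
    fix x t assume xt: "(x, t) \<in> tube" "norm x \<le> R" "norm t \<le> R"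
    have 1: "norm (\<alpha> r * x) \<le> 1 * R" "norm (\<beta> r * t) \<le> 1 * R" "norm (\<gamma> r * t) \<le> 1 * R"
      unfolding norm_mult using le[OF r] xt by (intro mult_mono; simp)+
    have "0 \<le> R" using xt(2) norm_ge_zero order_trans by blast
    then have "norm (\<alpha> r * x + \<beta> r * t) \<le> 2 * R" "norm (\<gamma> r * t) \<le> 2 * R"
      using 1 norm_triangle_ineq[of "\<alpha> r * x" "\<beta> r * t"] by linarith+
    then show "norm (f (\<alpha> r * x + \<beta> r * t) (\<gamma> r * t)) \<le> M"
      using M tube[OF r xt(1)] unfolding bounded_on_tube_def by blast
  qed
  then show "\<exists>M. \<forall>r\<in>{0..1}. bounded_on_tube R M (\<lambda>x t. f (\<alpha> r * x + \<beta> r * t) (\<gamma> r * t))" by blast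
next
  fix x t assume xt: "(x, t) \<in> tube"
  show "continuous_on {0..1} (\<lambda>r. f (\<alpha> r * x + \<beta> r * t) (\<gamma> r * t))"
    using tube[OF _ xt]
    by (intro tube_holomorphic_continuous_on_compose[OF f] continuous_intros cont)
qed

lemma tube_family_mult:
  assumes "tube_family f" "tube_family g"
  shows "tube_family (\<lambda>r x t. f r x t * g r x t)"
  unfolding tube_family_def
proof (intro conjI ballI allI impI)
  fix R :: real
  obtain M N where "\<And>r. r \<in> {0..1} \<Longrightarrow> bounded_on_tube R M (f r)"
    "\<And>r. r \<in> {0..1} \<Longrightarrow> bounded_on_tube R N (g r)"
    using assms unfolding tube_family_def by meson
  then have "\<forall>r\<in>{0..1}. bounded_on_tube R (\<bar>M\<bar> * \<bar>N\<bar>) (\<lambda>x t. f r x t * g r x t)"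
    by (intro ballI bounded_on_tube_mult)
  then show "\<exists>M. \<forall>r\<in>{0..1}. bounded_on_tube R M (\<lambda>x t. f r x t * g r x t)" ..
qed (use assms in \<open>auto simp: tube_family_def intro!: line_holomorphic_mult continuous_intros\<close>)

lemma lebesgue_integral_Icc_continuous:
  fixes h :: "real \<Rightarrow> complex"
  assumes "continuous_on {a..b} h"
  shows "integrable (lebesgue_on {a..b}) h" "integral\<^sup>L (lebesgue_on {a..b}) h = integral {a..b} h"
proof -
  show 1: "integrable (lebesgue_on {a..b}) h"
    using assms by (rule continuous_imp_integrable_real)
  show "integral\<^sup>L (lebesgue_on {a..b}) h = integral {a..b} h"
    by (rule lebesgue_integral_eq_integral[OF 1]) simp
qed

lemma tube_holomorphic_integral:
  assumes f: "tube_family f"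
  shows "tube_holomorphic (\<lambda>x t. integral {0..1} (\<lambda>r. f r x t))"
  unfolding tube_holomorphic_def
proof (intro conjI allI)
  have cont: "continuous_on {0..1} (\<lambda>r. f r x t)" if "(x, t) \<in> tube" for x t
    using f that by (simp add: tube_family_def)
  show "line_holomorphic (\<lambda>x t. integral {0..1} (\<lambda>r. f r x t))"
    unfolding line_holomorphic_def
  proof (intro allI)
    fix a b c d
    define S where "S = {z. (a + z * b, c + z * d) \<in> tube}"
    have opS: "open S" unfolding S_def by (rule open_tube_line)
    define F where "F z r = f r (a + z * b) (c + z * d)" for z r
    have contF: "continuous_on {0..1} (F z)" if "z \<in> S" for z
      unfolding F_def using that by (intro cont) (simp add: S_def)
    have "(\<lambda>z. \<integral>r. F z r \<partial>lebesgue_on {0..1}) holomorphic_on S"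
      unfolding holomorphic_on_open[OF opS]
    proof (intro ballI exI)
      fix z0 assume z0: "z0 \<in> S"
      obtain e where e: "0 < e" "cball z0 e \<subseteq> S"
        using opS z0 open_contains_cball by blast
      define R where "R = norm a + norm c + (norm z0 + e) * (norm b + norm d)"
      obtain M where M: "\<And>r. r \<in> {0..1} \<Longrightarrow> bounded_on_tube R M (f r)"
        using f unfolding tube_family_def by meson
      show "((\<lambda>z. \<integral>r. F z r \<partial>lebesgue_on {0..1}) has_field_derivative
          (\<integral>r. deriv (\<lambda>z. F z r) z0 \<partial>lebesgue_on {0..1})) (at z0)"
      proof (rule has_field_derivative_lebesgue_integral[OF _ _ e])
        fix r assume "r \<in> space (lebesgue_on {0..1::real})"
        then show "(\<lambda>z. F z r) holomorphic_on S"
          using f unfolding F_def S_def tube_family_def line_holomorphic_def by auto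
      next
        fix z assume "z \<in> S"
        then show "F z \<in> borel_measurable (lebesgue_on {0..1})"
          by (intro continuous_imp_measurable_on_sets_lebesgue contF) auto
      next
        show "integrable (lebesgue_on {0..1::real}) (\<lambda>_. M)"
          by (rule continuous_imp_integrable_real) auto
      next
        fix z and r :: real assume z: "z \<in> cball z0 e" and r: "r \<in> space (lebesgue_on {0..1})"
        have nz: "norm z \<le> norm z0 + e"
          using z norm_triangle_sub[of z z0] by (auto simp: dist_norm norm_minus_commute)
        have le: "norm (p + z * q) \<le> norm p + (norm z0 + e) * norm q" for p q
          by (rule order_trans[OF norm_triangle_ineq]) (auto simp: norm_mult intro!: mult_right_mono nz)
        have nn: "0 \<le> (norm z0 + e) * norm q" for q :: complex using e by simp
        have "norm (a + z * b) \<le> R" "norm (c + z * d) \<le> R"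
          using le[of a b] le[of c d] nn[of b] nn[of d] norm_ge_zero[of a] norm_ge_zero[of c]
          unfolding R_def distrib_left by linarith+
        moreover have "(a + z * b, c + z * d) \<in> tube" using z e by (auto simp: S_def)
        ultimately show "norm (F z r) \<le> M"
          unfolding F_def using M[of r] r unfolding bounded_on_tube_def by auto
      qed
    qed
    moreover have "(\<integral>r. F z r \<partial>lebesgue_on {0..1}) = integral {0..1} (\<lambda>r. f r (a + z * b) (c + z * d))"
      if "z \<in> S" for z
      using lebesgue_integral_Icc_continuous(2)[OF contF[OF that]] by (simp add: F_def[abs_def])
    ultimately show "(\<lambda>z. integral {0..1} (\<lambda>r. f r (a + z * b) (c + z * d))) holomorphic_on
        {z. (a + z * b, c + z * d) \<in> tube}"
      unfolding S_def by (rule holomorphic_transform) auto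
  qed
  fix R
  obtain M where M: "\<And>r. r \<in> {0..1} \<Longrightarrow> bounded_on_tube R M (f r)"
    using f unfolding tube_family_def by meson
  have "bounded_on_tube R M (\<lambda>x t. integral {0..1} (\<lambda>r. f r x t))"
    unfolding bounded_on_tube_def
  proof (intro allI impI)
    fix x t assume xt: "(x, t) \<in> tube" "norm x \<le> R" "norm t \<le> R"
    then have le: "norm (f r x t) \<le> M" if "r \<in> {0..1}" for r
      using M[OF that] unfolding bounded_on_tube_def by auto
    have "norm (integral {0..1} (\<lambda>r. f r x t)) \<le> M * (1 - 0)"
      by (rule integral_bound) (use cont[OF xt(1)] le in auto)
    then show "norm (integral {0..1} (\<lambda>r. f r x t)) \<le> M" by simp
  qed
  then show "\<exists>M. bounded_on_tube R M (\<lambda>x t. integral {0..1} (\<lambda>r. f r x t))" ..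
qed

lemma tube_holomorphic_suminf:
  assumes g: "\<And>n. tube_holomorphic (g n)"
    and bd: "\<And>R. \<exists>h. summable h \<and> (\<forall>n. bounded_on_tube R (h n) (g n))"
  shows "tube_holomorphic (\<lambda>x t. \<Sum>n. g n x t)"
  unfolding tube_holomorphic_def
proof (intro conjI allI)
  show "line_holomorphic (\<lambda>x t. \<Sum>n. g n x t)"
    unfolding line_holomorphic_def
  proof (intro allI)
    fix a b c d
    define S where "S = {z. (a + z * b, c + z * d) \<in> tube}"
    have opS: "open S" unfolding S_def by (rule open_tube_line)
    have "(\<lambda>z. \<Sum>n. g n (a + z * b) (c + z * d)) holomorphic_on S"
    proof (rule holomorphic_uniform_sequence[OF opS])
      fix n show "(\<lambda>z. \<Sum>i<n. g i (a + z * b) (c + z * d)) holomorphic_on S"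
        using g unfolding S_def tube_holomorphic_def
        by (intro holomorphic_on_sum line_holomorphicD) auto
    next
      fix z0 assume z0: "z0 \<in> S"
      obtain e where e: "0 < e" "cball z0 e \<subseteq> S"
        using opS z0 open_contains_cball by blast
      define R where "R = norm a + norm c + (norm z0 + e) * (norm b + norm d)"
      obtain h where h: "summable h" "\<And>n. bounded_on_tube R (h n) (g n)"
        using bd by blast
      have "uniform_limit (cball z0 e) (\<lambda>n z. \<Sum>i<n. g i (a + z * b) (c + z * d))
          (\<lambda>z. \<Sum>n. g n (a + z * b) (c + z * d)) sequentially"
      proof (rule Weierstrass_m_test[OF _ h(1)])
        fix n z assume z: "z \<in> cball z0 e"
        have nz: "norm z \<le> norm z0 + e"
          using z norm_triangle_sub[of z z0] by (auto simp: dist_norm norm_minus_commute)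
        have le: "norm (p + z * q) \<le> norm p + (norm z0 + e) * norm q" for p q
          by (rule order_trans[OF norm_triangle_ineq]) (auto simp: norm_mult intro!: mult_right_mono nz)
        have nn: "0 \<le> (norm z0 + e) * norm q" for q :: complex using e by simp
        have "norm (a + z * b) \<le> R" "norm (c + z * d) \<le> R"
          using le[of a b] le[of c d] nn[of b] nn[of d] norm_ge_zero[of a] norm_ge_zero[of c]
          unfolding R_def distrib_left by linarith+
        moreover have "(a + z * b, c + z * d) \<in> tube" using z e by (auto simp: S_def)
        ultimately show "norm (g n (a + z * b) (c + z * d)) \<le> h n"
          using h(2) unfolding bounded_on_tube_def by auto
      qed
      then show "\<exists>d'>0. cball z0 d' \<subseteq> S \<and> uniform_limit (cball z0 d')
          (\<lambda>n z. \<Sum>i<n. g i (a + z * b) (c + z * d)) (\<lambda>z. \<Sum>n. g n (a + z * b) (c + z * d)) sequentially"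
        using e by blast
    qed
    then show "(\<lambda>z. \<Sum>n. g n (a + z * b) (c + z * d)) holomorphic_on {z. (a + z * b, c + z * d) \<in> tube}"
      unfolding S_def .
  qed
  fix R
  obtain h where h: "summable h" "\<And>n. bounded_on_tube R (h n) (g n)"
    using bd by blast
  have "bounded_on_tube R (suminf h) (\<lambda>x t. \<Sum>n. g n x t)"
    unfolding bounded_on_tube_def
  proof (intro allI impI)
    fix x t assume "(x, t) \<in> tube" "norm x \<le> R" "norm t \<le> R"
    then have "norm (g n x t) \<le> h n" for n using h(2)[of n] unfolding bounded_on_tube_def by auto
    then show "norm (\<Sum>n. g n x t) \<le> suminf h" using h(1) by (intro norm_suminf_le) auto
  qed
  then show "\<exists>M. bounded_on_tube R M (\<lambda>x t. \<Sum>n. g n x t)" ..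
qed

section \<open>The Laplace transform\<close>

text \<open>The Laplace transform at a complex argument; it is \<open>0\<close> where the integral does not converge.\<close>

definition claplace :: "(real \<Rightarrow> complex) \<Rightarrow> complex \<Rightarrow> complex" where
  "claplace Y z = (\<integral>t. exp (- z * of_real t) * Y t \<partial>lebesgue_on {0..})"

lemma laplace_eq_claplace: "laplace Y lam = claplace Y (of_real lam)"
  unfolding laplace_def claplace_def set_lebesgue_integral_def
  by (subst integral_restrict_space) (simp_all add: scaleR_conv_of_real flip: exp_of_real)

lemma L1_weighted_iff:
  "L1_weighted \<nu> Y \<longleftrightarrow> integrable (lebesgue_on {0..}) (\<lambda>t. exp (- \<nu> * t) *\<^sub>R Y t)"
  unfolding L1_weighted_def set_integrable_def by (subst integrable_restrict_space) auto

lemma integrable_exp_minus: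
  assumes "0 < a"
  shows "integrable (lebesgue_on {0..}) (\<lambda>t::real. exp (- a * t))"
    and "(\<integral>t. exp (- a * t) \<partial>lebesgue_on {0..}) = 1 / a"
proof -
  have hi: "((\<lambda>t. exp (- a * t)) has_integral 1 / a) {0..}"
    using has_integral_exp_minus_to_infinity[OF assms, of 0] by simp
  then have "(\<lambda>t. exp (- a * t)) absolutely_integrable_on {0..}"
    by (intro nonnegative_absolutely_integrable_1) auto
  then show 1: "integrable (lebesgue_on {0..}) (\<lambda>t::real. exp (- a * t))"
    unfolding set_integrable_def by (subst integrable_restrict_space) auto
  show "(\<integral>t. exp (- a * t) \<partial>lebesgue_on {0..}) = 1 / a"
    using lebesgue_integral_eq_integral[OF 1] hi by (simp add: integral_unique)
qed

lemma L1_weighted_measurable: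
  assumes "L1_weighted \<nu> Y"
  shows "Y \<in> borel_measurable (lebesgue_on {0..})"
proof -
  have "(\<lambda>t. exp (\<nu> * t) *\<^sub>R (exp (- \<nu> * t) *\<^sub>R Y t)) \<in> borel_measurable (lebesgue_on {0..})"
    using assms unfolding L1_weighted_iff
    by (intro borel_measurable_scaleR borel_measurable_integrable
        continuous_imp_measurable_on_sets_lebesgue[where f = "\<lambda>t. exp (\<nu> * t)"] continuous_intros) auto
  then show ?thesis by (simp add: mult_exp_exp)
qed

lemma measurable_exp_times:
  fixes Y :: "real \<Rightarrow> complex"
  assumes "Y \<in> borel_measurable (lebesgue_on {0..})"
  shows "(\<lambda>t. exp (- z * of_real t) * Y t) \<in> borel_measurable (lebesgue_on {0..})"
proof -
  have "(\<lambda>t. exp (- z * of_real t)) \<in> borel_measurable (lebesgue_on {0::real..})"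
    by (intro continuous_imp_measurable_on_sets_lebesgue continuous_intros) auto
  from borel_measurable_times[OF this assms] show ?thesis .
qed

lemma claplace_integrable:
  assumes "L1_weighted \<nu> Y" "\<nu> \<le> Re z"
  shows "integrable (lebesgue_on {0..}) (\<lambda>t. exp (- z * of_real t) * Y t)"
proof (rule Bochner_Integration.integrable_bound)
  show "integrable (lebesgue_on {0..}) (\<lambda>t. exp (- \<nu> * t) *\<^sub>R Y t)"
    using assms(1) by (simp only: L1_weighted_iff)
  show "(\<lambda>t. exp (- z * of_real t) * Y t) \<in> borel_measurable (lebesgue_on {0..})"
    by (intro measurable_exp_times L1_weighted_measurable[OF assms(1)])
  show "AE t in lebesgue_on {0..}. norm (exp (- z * of_real t) * Y t) \<le> norm (exp (- \<nu> * t) *\<^sub>R Y t)"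
    using assms(2) by (intro AE_I2) (auto simp: norm_mult norm_exp_eq_Re intro!: mult_right_mono)
qed

lemma L1_weighted_mono:
  assumes "L1_weighted \<nu> Y" "\<nu> \<le> \<mu>"
  shows "L1_weighted \<mu> Y"
  using claplace_integrable[of \<nu> Y "of_real \<mu>"] assms
  unfolding L1_weighted_iff by (simp add: scaleR_conv_of_real flip: exp_of_real)

lemma claplace_diff:
  assumes "L1_weighted \<nu> X" "L1_weighted \<nu> Y" "\<nu> \<le> Re z"
  shows "claplace (\<lambda>t. X t - Y t) z = claplace X z - claplace Y z"
  using Bochner_Integration.integral_diff[OF claplace_integrable claplace_integrable, OF assms(1,3,2,3)]
  unfolding claplace_def by (simp add: right_diff_distrib)

lemma claplace_add:
  assumes "L1_weighted \<nu> X" "L1_weighted \<nu> Y" "\<nu> \<le> Re z"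
  shows "claplace (\<lambda>t. X t + Y t) z = claplace X z + claplace Y z"
  using Bochner_Integration.integral_add[OF claplace_integrable claplace_integrable, OF assms(1,3,2,3)]
  unfolding claplace_def by (simp add: distrib_left)

lemma claplace_cmult: "claplace (\<lambda>t. c * Y t) z = c * claplace Y z"
  unfolding claplace_def by (simp add: mult.left_commute)

lemma cnj_claplace: "cnj (claplace Y z) = claplace (\<lambda>t. cnj (Y t)) (cnj z)"
  unfolding claplace_def by (simp add: exp_cnj flip: Bochner_Integration.integral_cnj)

lemma L1_weighted_cnj:
  assumes "L1_weighted \<nu> Y"
  shows "L1_weighted \<nu> (\<lambda>t. cnj (Y t))"
  using complex_integrable_cnj[THEN iffD2, OF assms[unfolded L1_weighted_iff]]
  unfolding L1_weighted_iff by (simp add: scaleR_conv_of_real)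

lemma norm_claplace_le:
  assumes "L1_weighted \<nu> Y" "\<nu> \<le> Re z"
  shows "norm (claplace Y z) \<le> (\<integral>t. norm (exp (- \<nu> * t) *\<^sub>R Y t) \<partial>lebesgue_on {0..})"
  unfolding claplace_def
proof (rule Bochner_Integration.integral_norm_bound_integral[OF claplace_integrable[OF assms]])
  show "integrable (lebesgue_on {0..}) (\<lambda>t. norm (exp (- \<nu> * t) *\<^sub>R Y t))"
    using assms(1) unfolding L1_weighted_iff by (rule integrable_norm)
qed (use assms(2) in \<open>auto simp: norm_mult norm_exp_eq_Re intro!: mult_right_mono\<close>)

lemma claplace_holomorphic:
  assumes Y: "L1_weighted \<nu> Y"
  shows "claplace Y holomorphic_on {z. \<nu> < Re z}"
proof -
  have op: "open {z. \<nu> < Re z}" by (intro open_Collect_less continuous_intros)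
  show ?thesis
    unfolding holomorphic_on_open[OF op]
  proof (intro ballI exI)
    fix z0 assume z0: "z0 \<in> {z. \<nu> < Re z}"
    obtain r where r: "0 < r" "cball z0 r \<subseteq> {z. \<nu> < Re z}"
      using op z0 open_contains_cball by blast
    show "(claplace Y has_field_derivative
        (\<integral>t. deriv (\<lambda>z. exp (- z * of_real t) * Y t) z0 \<partial>lebesgue_on {0..})) (at z0)"
      unfolding claplace_def[abs_def]
    proof (rule has_field_derivative_lebesgue_integral[OF _ _ r])
      show "integrable (lebesgue_on {0..}) (\<lambda>t. norm (exp (- \<nu> * t) *\<^sub>R Y t))"
        using Y unfolding L1_weighted_iff by (rule integrable_norm)
      fix z assume "z \<in> {z. \<nu> < Re z}"
      show "(\<lambda>t. exp (- z * of_real t) * Y t) \<in> borel_measurable (lebesgue_on {0..})"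
        by (intro measurable_exp_times L1_weighted_measurable[OF Y])
    next
      fix z t assume z: "z \<in> cball z0 r" and t: "t \<in> space (lebesgue_on {0::real..})"
      have "\<nu> < Re z" using z r(2) by blast
      then show "norm (exp (- z * of_real t) * Y t) \<le> norm (exp (- \<nu> * t) *\<^sub>R Y t)"
        using t by (auto simp: norm_mult norm_exp_eq_Re intro!: mult_right_mono)
    qed (auto intro!: holomorphic_intros)
  qed
qed

lemma exp_bound_L1_weighted:
  assumes "continuous_on {0..} Y" "\<And>t. 0 \<le> t \<Longrightarrow> norm (Y t) \<le> C * exp (\<nu> * t)" "\<nu> < \<mu>"
  shows "L1_weighted \<mu> Y"
  unfolding L1_weighted_iff
proof (rule Bochner_Integration.integrable_bound)
  show "integrable (lebesgue_on {0..}) (\<lambda>t. C * exp (- (\<mu> - \<nu>) * t))"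
    using assms(3) by (intro integrable_mult_right integrable_exp_minus) auto
  show "(\<lambda>t. exp (- \<mu> * t) *\<^sub>R Y t) \<in> borel_measurable (lebesgue_on {0..})"
    by (intro continuous_imp_measurable_on_sets_lebesgue continuous_intros assms) auto
  show "AE t in lebesgue_on {0..}. norm (exp (- \<mu> * t) *\<^sub>R Y t) \<le> norm (C * exp (- (\<mu> - \<nu>) * t))"
  proof (rule AE_I2)
    fix t assume "t \<in> space (lebesgue_on {0::real..})"
    then have "exp (- \<mu> * t) * norm (Y t) \<le> exp (- \<mu> * t) * (C * exp (\<nu> * t))"
      using assms(2)[of t] by (intro mult_left_mono) auto
    also have "\<dots> = C * exp (- (\<mu> - \<nu>) * t)"
      by (simp add: mult_exp_exp mult.left_commute algebra_simps)
    finally show "norm (exp (- \<mu> * t) *\<^sub>R Y t) \<le> norm (C * exp (- (\<mu> - \<nu>) * t))"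
      by simp
  qed
qed

lemma exp_bound_norm_claplace_le:
  assumes "continuous_on {0..} Y" "\<And>t. 0 \<le> t \<Longrightarrow> norm (Y t) \<le> C * exp (\<nu> * t)" "\<nu> < Re z"
  shows "norm (claplace Y z) \<le> C / (Re z - \<nu>)"
proof -
  have "norm (claplace Y z) \<le> (\<integral>t. C * exp (- (Re z - \<nu>) * t) \<partial>lebesgue_on {0..})"
    unfolding claplace_def
  proof (rule Bochner_Integration.integral_norm_bound_integral)
    show "integrable (lebesgue_on {0..}) (\<lambda>t. exp (- z * of_real t) * Y t)"
      by (rule claplace_integrable[OF exp_bound_L1_weighted[OF assms]]) auto
    show "integrable (lebesgue_on {0..}) (\<lambda>t. C * exp (- (Re z - \<nu>) * t))"
      using assms(3) by (intro integrable_mult_right integrable_exp_minus) auto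
    fix t assume "t \<in> space (lebesgue_on {0::real..})"
    then have "exp (- Re z * t) * norm (Y t) \<le> exp (- Re z * t) * (C * exp (\<nu> * t))"
      using assms(2)[of t] by (intro mult_left_mono) auto
    also have "\<dots> = C * exp (- (Re z - \<nu>) * t)"
      by (simp add: mult_exp_exp mult.left_commute algebra_simps)
    finally show "norm (exp (- z * of_real t) * Y t) \<le> C * exp (- (Re z - \<nu>) * t)"
      by (simp add: norm_mult norm_exp_eq_Re)
  qed
  also have "\<dots> = C / (Re z - \<nu>)"
    using integrable_exp_minus(2)[of "Re z - \<nu>"] assms(3) by simp
  finally show ?thesis .
qed

lemma half_plane_identity:
  assumes "F holomorphic_on {z. a < Re z}" "G holomorphic_on {z. a < Re z}"
    and eq: "\<And>lam. lam > b \<Longrightarrow> F (of_real lam) = G (of_real lam)" and z: "a < Re z"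
  shows "F z = G z"
proof -
  define c where "c = max a b"
  have "F z - G z = 0"
  proof (rule analytic_continuation[of "\<lambda>z. F z - G z" "{z. a < Re z}" "of_real ` {c<..}" "of_real (c + 1)"])
    show "(\<lambda>z. F z - G z) holomorphic_on {z. a < Re z}" by (intro holomorphic_intros assms)
    show "open {z. a < Re z}" by (intro open_Collect_less continuous_intros)
    show "connected {z. a < Re z}" by (intro convex_connected convex_halfspace_Re_gt)
    show "complex_of_real (c + 1) islimpt of_real ` {c<..}"
    proof (rule islimpt_isCont_image)
      show "c + 1 islimpt {c<..}"
        by (rule open_imp_islimpt) auto
      show "isCont complex_of_real (c + 1)" by (intro continuous_intros)
      show "\<forall>\<^sub>F y in at (c + 1). complex_of_real y \<noteq> complex_of_real (c + 1)"
        unfolding of_real_eq_iff by (simp add: eventually_at_filter)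
    qed
  qed (use z eq in \<open>auto simp: c_def\<close>)
  then show ?thesis by simp
qed

lemma claplace_const:
  assumes "0 < Re z"
  shows "claplace (\<lambda>t. c) z = c / z"
proof -
  define a where "a = Re z / 2"
  have a: "0 < a" "a < Re z" using assms by (auto simp: a_def)
  have "L1_weighted a (\<lambda>t. c)"
    by (rule exp_bound_L1_weighted[where \<nu> = 0 and C = "norm c"]) (use a in auto)
  from claplace_holomorphic[OF this] have "claplace (\<lambda>t. c) holomorphic_on {z. a < Re z}" .
  moreover have "(\<lambda>z. c / z) holomorphic_on {z. a < Re z}"
    using a by (auto intro!: holomorphic_intros)
  moreover have "claplace (\<lambda>t. c) (of_real lam) = c / of_real lam" if "lam > a" for lam
  proof -
    have "claplace (\<lambda>t. c) (of_real lam) = (\<integral>t. of_real (exp (- lam * t)) * c \<partial>lebesgue_on {0..})"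
      unfolding claplace_def by (simp flip: exp_of_real)
    also have "\<dots> = of_real (\<integral>t. exp (- lam * t) \<partial>lebesgue_on {0..}) * c"
      by (simp only: integral_mult_left_zero integral_complex_of_real)
    finally show ?thesis using integrable_exp_minus(2)[of lam] that a by simp
  qed
  ultimately show ?thesis using half_plane_identity[of _ a _ a z] a by blast
qed

lemma lebesgue_on_integral_eq_lborel:
  fixes f g :: "real \<Rightarrow> complex"
  assumes "g \<in> borel_measurable borel" "\<And>t. g t = indicator {0..} t *\<^sub>R f t"
  shows "integral\<^sup>L (lebesgue_on {0..}) f = (\<integral>t. g t \<partial>lborel)"
proof -
  have "integral\<^sup>L (lebesgue_on {0..}) f = (\<integral>t. g t \<partial>lebesgue)"
    by (subst integral_restrict_space) (simp_all add: assms(2)[symmetric])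
  also have "\<dots> = (\<integral>t. g t \<partial>lborel)"
    using assms(1) by (intro integral_completion) auto
  finally show ?thesis .
qed

text \<open>
  The convolution theorem for a function of two variables: integrating over the lines
  \<open>\<tau> + s = t\<close> first gives the double Laplace integral. It is used both for the multiplication by
  the potential and for the shift along the characteristics.
\<close>

lemma claplace_convolution:
  fixes H :: "real \<Rightarrow> real \<Rightarrow> complex"
  assumes cont: "continuous_on ({0..} \<times> {0..}) (\<lambda>p. H (fst p) (snd p))"
    and bd: "\<And>\<tau> s. 0 \<le> \<tau> \<Longrightarrow> 0 \<le> s \<Longrightarrow> norm (H \<tau> s) \<le> C * exp (\<nu> * (\<tau> + s))"
    and \<nu>: "\<nu> < Re z"
  shows "claplace (\<lambda>t. of_real t * integral {0..1} (\<lambda>r. H ((1 - r) * t) (r * t))) z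
       = claplace (\<lambda>\<tau>. claplace (H \<tau>) z) z"
proof -
  define Q where "Q = {0::real..} \<times> {0::real..}"
  define K where "K p = indicator Q p *\<^sub>R (exp (- z * of_real (fst p + snd p)) * H (fst p) (snd p))" for p
  define k where "k t = indicator {0..} t * exp (- (Re z - \<nu>) * t)" for t :: real
  have measK: "K \<in> borel_measurable borel"
    unfolding K_def[abs_def]
    by (intro borel_measurable_continuous_on_indicator)
      (auto simp: Q_def intro!: closed_Times borel_closed continuous_intros cont)
  have intk: "integrable lborel k"
  proof -
    have m: "k \<in> borel_measurable borel" unfolding k_def[abs_def] by measurable
    have "integrable lebesgue k"
    proof -
      have "integrable (lebesgue_on {0..}) (\<lambda>t::real. exp (- (Re z - \<nu>) * t))"
        using \<nu> by (intro integrable_exp_minus) auto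
      then show ?thesis by (subst (asm) integrable_restrict_space) (auto simp: k_def[abs_def])
    qed
    then show ?thesis using m by (subst (asm) integrable_completion) auto
  qed
  have k0: "0 \<le> k t" for t by (simp add: k_def)
  have Kk: "norm (K (\<tau>, s)) \<le> norm (C * (k \<tau> * k s))" for \<tau> s
  proof (cases "0 \<le> \<tau> \<and> 0 \<le> s")
    case True
    then have "norm (K (\<tau>, s)) \<le> exp (- Re z * (\<tau> + s)) * (C * exp (\<nu> * (\<tau> + s)))"
      using bd[of \<tau> s] by (auto simp: K_def Q_def norm_mult norm_exp_eq_Re intro!: mult_left_mono)
    also have "\<dots> = C * (k \<tau> * k s)"
      using True by (simp add: k_def mult_exp_exp mult.left_commute algebra_simps)
    also have "\<dots> \<le> norm (C * (k \<tau> * k s))" by simp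
    finally show ?thesis .
  qed (auto simp: K_def Q_def)
  have mK[measurable]: "K \<in> borel_measurable (lborel \<Otimes>\<^sub>M lborel)"
    using measK by (simp add: lborel_prod)
  have mk[measurable]: "k \<in> borel_measurable borel" using intk by simp
  have int1: "integrable (lborel \<Otimes>\<^sub>M lborel) (\<lambda>(\<tau>, s). K (\<tau>, s))"
  proof (rule Bochner_Integration.integrable_bound)
    show "integrable (lborel \<Otimes>\<^sub>M lborel) (\<lambda>(\<tau>, s). C * (k \<tau> * k s))"
      by (rule lborel_pair.Fubini_integrable)
        (auto simp: abs_mult k0 intro!: integrable_mult_right integrable_mult_left intk)
  qed (use Kk in auto)
  have int2: "integrable (lborel \<Otimes>\<^sub>M lborel) (\<lambda>(s, t). K (t - s, s))"
  proof (rule Bochner_Integration.integrable_bound)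
    have shift: "integrable lborel (\<lambda>t. k (t - s))" "(\<integral>t. k (t - s) \<partial>lborel) = integral\<^sup>L lborel k" for s
      using lborel_integrable_real_affine[OF intk, of 1 "- s"] lborel_integral_real_affine[of 1 k "- s"]
      by simp_all
    show "integrable (lborel \<Otimes>\<^sub>M lborel) (\<lambda>(s, t). C * (k (t - s) * k s))"
      by (rule lborel_pair.Fubini_integrable)
        (auto simp: abs_mult k0 shift intro!: integrable_mult_right integrable_mult_left intk)
  qed (use Kk in auto)
  have "claplace (\<lambda>\<tau>. claplace (H \<tau>) z) z = (\<integral>\<tau>. (\<integral>s. K (\<tau>, s) \<partial>lborel) \<partial>lborel)"
    unfolding claplace_def[of "\<lambda>\<tau>. claplace (H \<tau>) z"]
  proof (rule lebesgue_on_integral_eq_lborel)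
    fix \<tau> :: real
    show "(\<integral>s. K (\<tau>, s) \<partial>lborel) = indicator {0..} \<tau> *\<^sub>R (exp (- z * of_real \<tau>) * claplace (H \<tau>) z)"
    proof (cases "0 \<le> \<tau>")
      case True
      have "exp (- z * of_real \<tau>) * claplace (H \<tau>) z = (\<integral>s. exp (- z * of_real \<tau>) * (exp (- z * of_real s) * H \<tau> s) \<partial>lebesgue_on {0..})"
        unfolding claplace_def by simp
      also have "\<dots> = (\<integral>s. K (\<tau>, s) \<partial>lborel)"
      proof (rule lebesgue_on_integral_eq_lborel)
        show "(\<lambda>s. K (\<tau>, s)) \<in> borel_measurable borel" by measurable
        fix s :: real
        show "K (\<tau>, s) = indicator {0..} s *\<^sub>R (exp (- z * of_real \<tau>) * (exp (- z * of_real s) * H \<tau> s))"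
          using True by (simp add: K_def Q_def indicator_def mult_exp_exp distrib_left flip: mult.assoc)
      qed
      finally show ?thesis using True by simp
    qed (simp add: K_def Q_def)
  qed measurable
  also have "\<dots> = (\<integral>s. (\<integral>\<tau>. K (\<tau>, s) \<partial>lborel) \<partial>lborel)"
    using lborel_pair.Fubini_integral[of "\<lambda>\<tau> s. K (\<tau>, s)"] int1 by simp
  also have "\<dots> = (\<integral>s. (\<integral>t. K (t - s, s) \<partial>lborel) \<partial>lborel)"
  proof (rule Bochner_Integration.integral_cong[OF refl])
    fix s :: real
    show "(\<integral>\<tau>. K (\<tau>, s) \<partial>lborel) = (\<integral>t. K (t - s, s) \<partial>lborel)"
      using lborel_integral_real_affine[of 1 "\<lambda>\<tau>. K (\<tau>, s)" "- s"] by simp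
  qed
  also have "\<dots> = (\<integral>t. (\<integral>s. K (t - s, s) \<partial>lborel) \<partial>lborel)"
    using lborel_pair.Fubini_integral[of "\<lambda>s t. K (t - s, s)"] int2 by simp
  also have "\<dots> = claplace (\<lambda>t. of_real t * integral {0..1} (\<lambda>r. H ((1 - r) * t) (r * t))) z"
    unfolding claplace_def
  proof (rule lebesgue_on_integral_eq_lborel[symmetric])
    fix t :: real
    show "(\<integral>s. K (t - s, s) \<partial>lborel) = indicator {0..} t *\<^sub>R
        (exp (- z * of_real t) * (of_real t * integral {0..1} (\<lambda>r. H ((1 - r) * t) (r * t))))"
    proof (cases t "0 :: real" rule: linorder_cases)
      case less
      then have "K (t - s, s) = 0" for s by (auto simp: K_def Q_def indicator_def)
      then show ?thesis using less by simp
    next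
      case equal
      then have "K (t - s, s) = indicator {0} s *\<^sub>R K (0, 0)" for s
        by (auto simp: K_def Q_def indicator_def)
      then show ?thesis using equal by simp
    next
      case greater
      have K: "K (t - t * r, t * r) = exp (- z * of_real t) * (indicator {0..1} r *\<^sub>R H ((1 - r) * t) (r * t))" for r
        using greater by (auto simp: K_def Q_def indicator_def algebra_simps zero_le_mult_iff)
      have "continuous_on {0..1} (\<lambda>r. (\<lambda>p. H (fst p) (snd p)) ((1 - r) * t, r * t))"
        by (rule continuous_on_compose2[OF cont]) (use greater in \<open>auto intro!: continuous_intros\<close>)
      then have "set_integrable lborel {0..1} (\<lambda>r. H ((1 - r) * t) (r * t))"
        by (intro borel_integrable_atLeastAtMost') simp
      then have eq: "(\<integral>r. indicator {0..1} r *\<^sub>R H ((1 - r) * t) (r * t) \<partial>lborel)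
          = integral {0..1} (\<lambda>r. H ((1 - r) * t) (r * t))"
        using set_borel_integral_eq_integral(2) by (simp add: set_lebesgue_integral_def)
      have "(\<integral>s. K (t - s, s) \<partial>lborel) = \<bar>t\<bar> *\<^sub>R (\<integral>r. K (t - t * r, t * r) \<partial>lborel)"
        using lborel_integral_real_affine[of t "\<lambda>s. K (t - s, s)" 0] greater by simp
      also have "\<dots> = t *\<^sub>R (exp (- z * of_real t) * integral {0..1} (\<lambda>r. H ((1 - r) * t) (r * t)))"
        unfolding K integral_mult_right_zero eq using greater by simp
      finally show ?thesis using greater by (simp add: scaleR_conv_of_real)
    qed
  qed measurable
  finally show ?thesis by simp
qed

lemma has_field_derivative_laplace_parameter:
  fixes f :: "complex \<Rightarrow> real \<Rightarrow> complex"
  assumes hol: "\<And>t. 0 \<le> t \<Longrightarrow> (\<lambda>x. f x t) holomorphic_on S"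
    and cont: "\<And>x. x \<in> S \<Longrightarrow> continuous_on {0..} (f x)"
    and r: "0 < r" "cball x0 r \<subseteq> S"
    and bd: "\<And>x t. x \<in> cball x0 r \<Longrightarrow> 0 \<le> t \<Longrightarrow> norm (f x t) \<le> C * exp (\<nu> * t)"
    and \<nu>: "\<nu> < Re z"
  shows "((\<lambda>x. claplace (f x) z) has_field_derivative claplace (\<lambda>t. deriv (\<lambda>x. f x t) x0) z) (at x0)"
proof -
  have "((\<lambda>x. claplace (f x) z) has_field_derivative
      (\<integral>t. deriv (\<lambda>x. exp (- z * of_real t) * f x t) x0 \<partial>lebesgue_on {0..})) (at x0)"
    unfolding claplace_def
  proof (rule has_field_derivative_lebesgue_integral[OF _ _ r])
    show "integrable (lebesgue_on {0..}) (\<lambda>t. C * exp (- (Re z - \<nu>) * t))"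
      using \<nu> by (intro integrable_mult_right integrable_exp_minus) auto
  next
    fix x assume "x \<in> S"
    then show "(\<lambda>t. exp (- z * of_real t) * f x t) \<in> borel_measurable (lebesgue_on {0..})"
      by (intro measurable_exp_times continuous_imp_measurable_on_sets_lebesgue cont) auto
  next
    fix x t assume x: "x \<in> cball x0 r" and "t \<in> space (lebesgue_on {0::real..})"
    then have "exp (- Re z * t) * norm (f x t) \<le> exp (- Re z * t) * (C * exp (\<nu> * t))"
      using bd[of x t] by (intro mult_left_mono) auto
    also have "\<dots> = C * exp (- (Re z - \<nu>) * t)"
      by (simp add: mult_exp_exp mult.left_commute algebra_simps)
    finally show "norm (exp (- z * of_real t) * f x t) \<le> C * exp (- (Re z - \<nu>) * t)"
      by (simp add: norm_mult norm_exp_eq_Re)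
  qed (auto intro!: holomorphic_intros hol)
  also have "(\<integral>t. deriv (\<lambda>x. exp (- z * of_real t) * f x t) x0 \<partial>lebesgue_on {0..})
      = claplace (\<lambda>t. deriv (\<lambda>x. f x t) x0) z"
    unfolding claplace_def
  proof (intro Bochner_Integration.integral_cong refl)
    fix t assume "t \<in> space (lebesgue_on {0::real..})"
    then have "(\<lambda>x. f x t) holomorphic_on ball x0 r"
      by (intro holomorphic_on_subset[OF hol order_trans[OF ball_subset_cball r(2)]]) auto
    then have "(\<lambda>x. f x t) field_differentiable at x0"
      using r(1) by (intro holomorphic_on_imp_differentiable_at[of _ "ball x0 r"]) auto
    then show "deriv (\<lambda>x. exp (- z * of_real t) * f x t) x0 = exp (- z * of_real t) * deriv (\<lambda>x. f x t) x0"
      by simp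
  qed
  finally show ?thesis .
qed

section \<open>Functions of exponential type in a strip\<close>

text \<open>
  Borel transforms: holomorphic for \<open>\<bar>Im t\<bar> < \<eta>\<close> and there at most of the growth \<open>exp (\<nu> * norm t)\<close>.
  The class is closed under differentiation, at the price of halving \<open>\<eta>\<close>.
\<close>

definition exp_type :: "real \<Rightarrow> real \<Rightarrow> (complex \<Rightarrow> complex) \<Rightarrow> bool" where
  "exp_type \<eta> \<nu> Y \<longleftrightarrow> Y holomorphic_on {t. \<bar>Im t\<bar> < \<eta>} \<and>
     (\<exists>C\<ge>0. \<forall>t. \<bar>Im t\<bar> < \<eta> \<longrightarrow> norm (Y t) \<le> C * exp (\<nu> * norm t))"

lemma exp_type_deriv:
  assumes Y: "exp_type \<eta> \<nu> Y" and pos: "0 < \<eta>" "0 \<le> \<nu>"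
  shows "exp_type (\<eta>/2) \<nu> (deriv Y)"
proof -
  have op: "open {t. \<bar>Im t\<bar> < \<eta>}" by (intro open_Collect_less continuous_intros)
  obtain C where C: "0 \<le> C" "\<And>t. \<bar>Im t\<bar> < \<eta> \<Longrightarrow> norm (Y t) \<le> C * exp (\<nu> * norm t)"
    using Y unfolding exp_type_def by blast
  have hol: "Y holomorphic_on {t. \<bar>Im t\<bar> < \<eta>}" using Y by (simp add: exp_type_def)
  have "norm (deriv Y t) \<le> (C * exp (\<nu> * (\<eta>/4)) / (\<eta>/4)) * exp (\<nu> * norm t)" if t: "\<bar>Im t\<bar> < \<eta>/2" for t
  proof -
    have sub: "cball t (\<eta>/4) \<subseteq> {t. \<bar>Im t\<bar> < \<eta>}"
    proof
      fix w assume "w \<in> cball t (\<eta>/4)"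
      then have "\<bar>Im (w - t)\<bar> \<le> \<eta>/4"
        using abs_Im_le_cmod[of "w - t"] by (simp add: dist_norm norm_minus_commute)
      then have "\<bar>Im w\<bar> < \<eta>" using t pos(1) unfolding minus_complex.sel by linarith
      then show "w \<in> {t. \<bar>Im t\<bar> < \<eta>}" by simp
    qed
    have "norm (deriv Y t) \<le> C * exp (\<nu> * (norm t + \<eta>/4)) / (\<eta>/4)"
    proof (rule norm_deriv_le_of_bound[OF hol sub])
      fix w assume w: "w \<in> cball t (\<eta>/4)"
      have "norm w \<le> norm t + \<eta>/4"
        using w norm_triangle_sub[of w t] by (auto simp: dist_norm norm_minus_commute)
      then have "C * exp (\<nu> * norm w) \<le> C * exp (\<nu> * (norm t + \<eta>/4))"
        using C(1) pos by (intro mult_left_mono) (auto intro!: mult_left_mono)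
      then show "norm (Y w) \<le> C * exp (\<nu> * (norm t + \<eta>/4))"
        using C(2)[of w] sub w by auto
    qed (use pos in auto)
    also have "\<dots> = (C * exp (\<nu> * (\<eta>/4)) / (\<eta>/4)) * exp (\<nu> * norm t)"
      by (simp add: distrib_left exp_add)
    finally show ?thesis .
  qed
  moreover have "deriv Y holomorphic_on {t. \<bar>Im t\<bar> < \<eta>/2}"
    by (rule holomorphic_on_subset[OF holomorphic_deriv[OF hol op]]) (use pos in auto)
  ultimately show ?thesis
    unfolding exp_type_def using C(1) pos by (intro conjI exI[of _ "C * exp (\<nu> * (\<eta>/4)) / (\<eta>/4)"]) auto
qed

lemma exp_type_real:
  assumes Y: "exp_type \<eta> \<nu> Y" and "0 < \<eta>"
  shows "continuous_on A (\<lambda>t. Y (of_real t))"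
    and "\<exists>C\<ge>0. \<forall>t\<ge>0. norm (Y (of_real t)) \<le> C * exp (\<nu> * t)"
proof -
  have "continuous_on {t. \<bar>Im t\<bar> < \<eta>} Y"
    using Y by (auto simp: exp_type_def intro: holomorphic_on_imp_continuous_on)
  then show "continuous_on A (\<lambda>t. Y (of_real t))"
    by (rule continuous_on_compose2) (use assms(2) in \<open>auto intro!: continuous_intros\<close>)
  obtain C where "0 \<le> C" "\<And>t. \<bar>Im t\<bar> < \<eta> \<Longrightarrow> norm (Y t) \<le> C * exp (\<nu> * norm t)"
    using Y unfolding exp_type_def by blast
  then show "\<exists>C\<ge>0. \<forall>t\<ge>0. norm (Y (of_real t)) \<le> C * exp (\<nu> * t)"
    using assms(2) by (metis Im_complex_of_real abs_zero norm_of_real abs_of_nonneg)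
qed

lemma exp_type_claplace_bound:
  assumes Y: "exp_type \<eta> \<nu> Y" and "0 < \<eta>"
  obtains C where "0 \<le> C" "\<And>z. \<nu> < Re z \<Longrightarrow> norm (claplace (\<lambda>t. Y (of_real t)) z) \<le> C / (Re z - \<nu>)"
  using exp_type_real[OF assms] exp_bound_norm_claplace_le by meson

lemma exp_type_L1_weighted:
  assumes Y: "exp_type \<eta> \<nu> Y" and "0 < \<eta>" "\<nu> < \<mu>"
  shows "L1_weighted \<mu> (\<lambda>t. Y (of_real t))"
  using exp_type_real[OF assms(1,2)] exp_bound_L1_weighted assms(3) by meson

text \<open>
  Integration by parts, obtained from the convolution theorem with the constant function \<open>1\<close>.
\<close>

lemma claplace_exp_type_deriv:
  assumes Y: "exp_type \<eta> \<nu> Y" and pos: "0 < \<eta>" "0 \<le> \<nu>" and z: "\<nu> < Re z"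
  shows "claplace (\<lambda>t. Y (of_real t)) z = Y 0 / z + claplace (\<lambda>t. deriv Y (of_real t)) z / z"
proof -
  have op: "open {t. \<bar>Im t\<bar> < \<eta>}" by (intro open_Collect_less continuous_intros)
  have hol: "Y holomorphic_on {t. \<bar>Im t\<bar> < \<eta>}" using Y by (simp add: exp_type_def)
  have Y': "exp_type (\<eta>/2) \<nu> (deriv Y)" by (rule exp_type_deriv[OF Y pos])
  note Y'r = exp_type_real[OF Y', OF half_gt_zero[OF pos(1)]]
  obtain C where C: "0 \<le> C" "\<And>t. 0 \<le> t \<Longrightarrow> norm (deriv Y (of_real t)) \<le> C * exp (\<nu> * t)"
    using Y'r(2) by blast
  have ftc: "of_real t * integral {0..1} (\<lambda>r. deriv Y (of_real (r * t))) = Y (of_real t) - Y 0" for t :: real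
  proof -
    have "((\<lambda>r. of_real t * deriv Y (of_real (r * t))) has_integral (Y (of_real (1 * t)) - Y (of_real (0 * t)))) {0..1}"
    proof (rule fundamental_theorem_of_calculus)
      fix r :: real
      have "(Y has_field_derivative deriv Y (of_real (r * t))) (at (of_real (r * t)))"
        by (rule holomorphic_derivI[OF hol op]) (use pos in auto)
      then have "((\<lambda>r. Y (of_real (r * t))) has_vector_derivative of_real t * deriv Y (of_real (r * t))) (at r)"
        by (intro field_vector_diff_chain_at[unfolded o_def] derivative_eq_intros)
          (auto intro!: derivative_eq_intros simp: has_vector_derivative_def scaleR_conv_of_real)
      then show "((\<lambda>r. Y (of_real (r * t))) has_vector_derivative of_real t * deriv Y (of_real (r * t))) (at r within {0..1})"
        by (rule has_vector_derivative_at_within)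
    qed simp
    from integral_unique[OF this] show ?thesis by simp
  qed
  have "claplace (\<lambda>t. of_real t * integral {0..1} (\<lambda>r. deriv Y (of_real (r * t)))) z
      = claplace (\<lambda>\<tau>. claplace (\<lambda>s. deriv Y (of_real s)) z) z"
  proof (rule claplace_convolution[where H = "\<lambda>\<tau> s. deriv Y (of_real s)"])
    show "continuous_on ({0..} \<times> {0..}) (\<lambda>p. deriv Y (of_real (snd p)))"
      by (rule continuous_on_compose2[OF Y'r(1)[of UNIV]]) (auto intro: continuous_intros)
    fix \<tau> s :: real assume "0 \<le> \<tau>" "0 \<le> s"
    then show "norm (deriv Y (of_real s)) \<le> C * exp (\<nu> * (\<tau> + s))"
      using C(1) pos(2) by (intro order_trans[OF C(2)] mult_left_mono) (auto intro!: mult_left_mono)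
  qed (rule z)
  also have "\<dots> = claplace (\<lambda>t. deriv Y (of_real t)) z / z"
    using z pos(2) by (intro claplace_const) auto
  also have "claplace (\<lambda>t. of_real t * integral {0..1} (\<lambda>r. deriv Y (of_real (r * t)))) z
      = claplace (\<lambda>t. Y (of_real t) - Y 0) z" by (simp only: ftc)
  also have "\<dots> = claplace (\<lambda>t. Y (of_real t)) z - Y 0 / z"
  proof -
    have "L1_weighted (Re z) (\<lambda>t. Y 0)"
      by (rule exp_bound_L1_weighted[where \<nu> = 0 and C = "norm (Y 0)"]) (use z pos in auto)
    then have "claplace (\<lambda>t. Y (of_real t) - Y 0) z = claplace (\<lambda>t. Y (of_real t)) z - claplace (\<lambda>t. Y 0) z"
      by (intro claplace_diff[OF exp_type_L1_weighted[OF Y pos(1) z]]) auto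
    then show ?thesis using claplace_const[of z "Y 0"] z pos by simp
  qed
  finally show ?thesis by (simp add: algebra_simps)
qed

lemma exp_type_deriv_n:
  assumes "exp_type \<eta> \<nu> Y" "0 < \<eta>" "0 \<le> \<nu>"
  shows "exp_type (\<eta> / 2 ^ n) \<nu> ((deriv ^^ n) Y)"
proof (induction n)
  case (Suc n)
  show ?case using exp_type_deriv[OF Suc] assms by (simp add: field_simps)
qed (use assms in simp)

text \<open>Watson's lemma, by iterating \<open>claplace_exp_type_deriv\<close>.\<close>

lemma claplace_asymptotic_series:
  assumes Y: "exp_type \<eta> \<nu> Y" and pos: "0 < \<eta>" "0 \<le> \<nu>"
    and a: "fps_nth a 0 = 0" "\<And>n. fps_nth a (Suc n) = (deriv ^^ n) Y 0"
    and f: "\<And>lam. lam > lam0 \<Longrightarrow> f lam = laplace (\<lambda>t. Y (of_real t)) lam"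
  shows "has_asymptotic_series f a"
  unfolding has_asymptotic_series_def
proof
  fix N
  have expand: "claplace (\<lambda>t. Y (of_real t)) z - (\<Sum>k\<le>N. fps_nth a k / z ^ k)
      = claplace (\<lambda>t. (deriv ^^ N) Y (of_real t)) z / z ^ N" if z: "\<nu> < Re z" for z
  proof (induction N)
    case (Suc N)
    have z0: "z \<noteq> 0" using z pos by auto
    have "claplace (\<lambda>t. (deriv ^^ N) Y (of_real t)) z
        = (deriv ^^ N) Y 0 / z + claplace (\<lambda>t. (deriv ^^ Suc N) Y (of_real t)) z / z"
      using claplace_exp_type_deriv[OF exp_type_deriv_n[OF Y pos, of N] _ pos(2) z] pos by simp
    then show ?case using Suc a(2)[of N] z0 by (simp add: field_simps)
  qed (simp add: a)
  obtain C where C: "0 \<le> C" "\<And>z. \<nu> < Re z \<Longrightarrow>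
      norm (claplace (\<lambda>t. (deriv ^^ N) Y (of_real t)) z) \<le> C / (Re z - \<nu>)"
    using exp_type_claplace_bound[OF exp_type_deriv_n[OF Y pos, of N]] pos by auto
  show "(\<lambda>lam. f lam - (\<Sum>k\<le>N. fps_nth a k / complex_of_real lam ^ k))
      \<in> O[at_top](\<lambda>lam. 1 / complex_of_real lam ^ Suc N)"
  proof (rule bigoI[of _ "2 * C"], rule eventually_mono[OF eventually_gt_at_top[of "max lam0 (2 * \<nu> + 1)"]])
    fix lam :: real assume lam: "lam > max lam0 (2 * \<nu> + 1)"
    then have l: "lam0 < lam" "\<nu> < lam" "0 < lam" "lam / 2 \<le> lam - \<nu>" using pos by auto
    have "norm (claplace (\<lambda>t. (deriv ^^ N) Y (of_real t)) (of_real lam)) \<le> C / (lam - \<nu>)"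
      using C(2)[of "of_real lam"] l by simp
    also have "\<dots> \<le> C / (lam / 2)" using l C(1) by (intro divide_left_mono) auto
    finally have le: "norm (claplace (\<lambda>t. (deriv ^^ N) Y (of_real t)) (of_real lam)) \<le> C / (lam / 2)" .
    have "norm (f lam - (\<Sum>k\<le>N. fps_nth a k / of_real lam ^ k))
        = norm (claplace (\<lambda>t. (deriv ^^ N) Y (of_real t)) (of_real lam)) / lam ^ N"
      using expand[of "of_real lam"] l by (simp add: f laplace_eq_claplace norm_divide norm_power)
    also have "\<dots> \<le> C / (lam / 2) / lam ^ N"
      using l le by (intro divide_right_mono) auto
    also have "\<dots> = 2 * C * norm (1 / complex_of_real lam ^ Suc N)"
      using l by (simp add: norm_divide norm_power norm_mult)
    finally show "norm (f lam - (\<Sum>k\<le>N. fps_nth a k / of_real lam ^ k))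
        \<le> 2 * C * norm (1 / complex_of_real lam ^ Suc N)" .
  qed
qed

section \<open>The Borel transform as a fixed point\<close>

lemma norm_integral_exp_le:
  fixes g :: "real \<Rightarrow> complex"
  assumes g: "continuous_on {0..1} g" "\<And>r. r \<in> {0..1} \<Longrightarrow> norm (g r) \<le> A * exp (a * (r * \<rho>))"
    and pos: "0 < a" "0 \<le> \<rho>" "0 \<le> A"
  shows "\<rho> * norm (integral {0..1} g) \<le> A * exp (a * \<rho>) / a"
proof (cases "\<rho> = 0")
  case False
  have hi: "((\<lambda>r. A * exp (a * (r * \<rho>))) has_integral
      (A / (a * \<rho>) * exp (a * (1 * \<rho>)) - A / (a * \<rho>) * exp (a * (0 * \<rho>)))) {0..1}"
    by (rule fundamental_theorem_of_calculus)
      (use False pos in \<open>auto intro!: derivative_eq_intros simp: has_real_derivative_iff_has_vector_derivative[symmetric]\<close>)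
  have "norm (integral {0..1} g) \<le> integral {0..1} (\<lambda>r. A * exp (a * (r * \<rho>)))"
    using g by (intro integral_norm_bound_integral integrable_continuous_interval has_integral_integrable[OF hi]) auto
  also have "\<dots> = (A * exp (a * \<rho>) - A) / (a * \<rho>)"
    unfolding integral_unique[OF hi] by (simp add: diff_divide_distrib)
  also have "\<dots> \<le> A * exp (a * \<rho>) / (a * \<rho>)" using pos by (intro divide_right_mono) auto
  finally have "\<rho> * norm (integral {0..1} g) \<le> \<rho> * (A * exp (a * \<rho>) / (a * \<rho>))"
    using pos by (intro mult_left_mono) auto
  then show ?thesis using False by simp
qed (use pos in simp)

lemma one_plus_norm_pos: "0 < 1 + norm (x :: complex)"
  by (simp add: add_pos_nonneg)

lemma divide_one_plus_norm_le:
  assumes "0 \<le> a"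
  shows "a / (1 + norm (x :: complex)) \<le> a"
  using divide_left_mono[of 1 "1 + norm x" a] assms one_plus_norm_pos[of x] by simp

text \<open>
  The hypotheses on the potential, with the decay \<open>1 / (1 + norm x)\<close> in the strip.
  The constant \<open>\<nu>\<close> is the exponential rate of growth of the Borel transform; it is large enough
  for the integral operator below to be a contraction by \<open>1/2\<close>.
\<close>

locale potential =
  fixes V :: "nat \<Rightarrow> complex \<Rightarrow> complex" and B M \<nu> :: real
  assumes B: "0 < B" and M: "0 < M"
    and V_hol: "\<And>k. V k holomorphic_on strip"
    and V_bound: "\<And>k x. x \<in> strip \<Longrightarrow> norm (V k x) \<le> M * B ^ k / (1 + norm x)"
    and V_real: "\<And>k x. x \<in> {-1<..<1} \<Longrightarrow> V k (of_real x) \<in> \<real>"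
    and \<nu>: "2 * B \<le> \<nu>" "2 * M \<le> \<nu>"
begin

lemma \<nu>_pos: "0 < \<nu>" using B \<nu> by simp

lemma V_le: "x \<in> strip \<Longrightarrow> norm (V k x) \<le> M * B ^ k"
  using V_bound[of x k] divide_one_plus_norm_le[of "M * B ^ k" x] M B by (simp add: order_trans)

text \<open>The Borel transform in \<open>lam\<close> of \<open>\<Sum>k\<ge>1. V k x / lam ^ k\<close>.\<close>

definition W :: "complex \<Rightarrow> complex \<Rightarrow> complex" where
  "W y s = (\<Sum>k. V (Suc k) y * (s ^ k / fact k))"

lemma W_term_le:
  assumes "y \<in> strip"
  shows "norm (V (Suc k) y * (s ^ k / fact k)) \<le> M * B / (1 + norm y) * ((B * norm s) ^ k / fact k)"
proof -
  have "norm (V (Suc k) y * (s ^ k / fact k)) = norm (V (Suc k) y) * (norm s ^ k / fact k)"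
    by (simp add: norm_mult norm_divide norm_power)
  also have "\<dots> \<le> M * B ^ Suc k / (1 + norm y) * (norm s ^ k / fact k)"
    by (intro mult_right_mono V_bound assms) auto
  also have "\<dots> = M * B / (1 + norm y) * ((B * norm s) ^ k / fact k)"
    by (simp add: power_mult_distrib)
  finally show ?thesis .
qed

lemma exp_sums_real: "(\<lambda>k. x ^ k / fact k) sums exp (x::real)"
  using exp_converges[of x] by (simp add: divide_inverse mult.commute)

lemma W_bound:
  assumes "y \<in> strip"
  shows "norm (W y s) \<le> M * B / (1 + norm y) * exp (B * norm s)"
proof -
  have *: "(\<lambda>k. M * B / (1 + norm y) * ((B * norm s) ^ k / fact k)) sums (M * B / (1 + norm y) * exp (B * norm s))"
    by (intro sums_mult exp_sums_real)
  show ?thesis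
    unfolding W_def sums_unique[OF *]
    by (rule norm_suminf_le[OF W_term_le[OF assms] sums_summable[OF *]])
qed

lemma tube_holomorphic_V: "tube_holomorphic (\<lambda>x t. V k x)"
  by (rule tube_holomorphic_strip) (use V_hol V_le in blast)+

lemma tube_holomorphic_W: "tube_holomorphic W"
  unfolding W_def[abs_def]
proof (rule tube_holomorphic_suminf)
  fix k
  have "tube_holomorphic (\<lambda>x t. V (Suc k) x * (t ^ k * (1 / fact k)))"
    by (intro tube_holomorphic_mult tube_holomorphic_V tube_holomorphic_power tube_holomorphic_snd
        tube_holomorphic_const)
  then show "tube_holomorphic (\<lambda>x t. V (Suc k) x * (t ^ k / fact k))" by simp
next
  fix R :: real
  have "bounded_on_tube R (M * B * ((B * \<bar>R\<bar>) ^ k / fact k)) (\<lambda>x t. V (Suc k) x * (t ^ k / fact k))" for k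
    unfolding bounded_on_tube_def
  proof (intro allI impI)
    fix x t assume xt: "(x, t) \<in> tube" "norm x \<le> R" "norm t \<le> R"
    have "norm (V (Suc k) x * (t ^ k / fact k)) \<le> M * B / (1 + norm x) * ((B * norm t) ^ k / fact k)"
      by (rule W_term_le[OF tube_strip[OF xt(1)]])
    also have "\<dots> \<le> M * B * ((B * \<bar>R\<bar>) ^ k / fact k)"
    proof (rule mult_mono)
      show "M * B / (1 + norm x) \<le> M * B" using B M by (intro divide_one_plus_norm_le) auto
      show "(B * norm t) ^ k / fact k \<le> (B * \<bar>R\<bar>) ^ k / fact k"
        using xt B by (intro divide_right_mono power_mono mult_left_mono) auto
    qed (use B M in auto)
    finally show "norm (V (Suc k) x * (t ^ k / fact k)) \<le> M * B * ((B * \<bar>R\<bar>) ^ k / fact k)" .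
  qed
  moreover have "summable (\<lambda>k. M * B * ((B * \<bar>R\<bar>) ^ k / fact k))"
    by (intro summable_mult sums_summable[OF exp_sums_real])
  ultimately show "\<exists>h. summable h \<and> (\<forall>k. bounded_on_tube R (h k) (\<lambda>x t. V (Suc k) x * (t ^ k / fact k)))"
    by blast
qed

text \<open>
  The three parts of the integral operator: multiplication by the potential, which becomes a
  convolution in \<open>t\<close>; the inverse of \<open>\<partial>\<^sub>x + 2 \<i> \<partial>\<^sub>t\<close>, integrating along the characteristics
  \<open>x + \<i> t / 2 = const\<close> from \<open>t = 0\<close>; and the primitive in \<open>x\<close> vanishing at \<open>0\<close>. All integrals are
  over \<open>[0, 1]\<close> after a linear change of variable.
\<close>

definition mult_op :: "(complex \<Rightarrow> complex \<Rightarrow> complex) \<Rightarrow> complex \<Rightarrow> complex \<Rightarrow> complex" where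
  "mult_op f y s = V 0 y * f y s +
     s * integral {0..1} (\<lambda>r. W y (of_real (1 - r) * s) * f y (of_real r * s))"

definition char_op :: "(complex \<Rightarrow> complex \<Rightarrow> complex) \<Rightarrow> complex \<Rightarrow> complex \<Rightarrow> complex" where
  "char_op F x t = t / (2 * \<i>) * integral {0..1} (\<lambda>r. F (x + \<i> / 2 * of_real (1 - r) * t) (of_real r * t))"

definition prim_op :: "(complex \<Rightarrow> complex \<Rightarrow> complex) \<Rightarrow> complex \<Rightarrow> complex \<Rightarrow> complex" where
  "prim_op u x t = x * integral {0..1} (\<lambda>r. u (of_real r * x) t)"

text \<open>The factor \<open>\<phi>\<^sub>+\<close> is the Laplace transform of the solution of \<open>chi = 1 + T_op chi\<close>.\<close>

definition T_op :: "(complex \<Rightarrow> complex \<Rightarrow> complex) \<Rightarrow> complex \<Rightarrow> complex \<Rightarrow> complex" where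
  "T_op f = prim_op (char_op (mult_op f))"

lemma tube_family_mult_op:
  assumes "tube_holomorphic f"
  shows "tube_family (\<lambda>r y s. W y (of_real (1 - r) * s) * f y (of_real r * s))"
proof -
  have "tube_family (\<lambda>r y s. W (1 * y + 0 * s) (of_real (1 - r) * s))"
    by (rule tube_family_compose[OF tube_holomorphic_W])
      (auto intro!: continuous_intros dest: tube_convex_comb(2)[of _ _ "1 - _"] simp: norm_of_real simp del: of_real_diff)
  moreover have "tube_family (\<lambda>r y s. f (1 * y + 0 * s) (of_real r * s))"
    by (rule tube_family_compose[OF assms]) (auto intro!: continuous_intros dest: tube_convex_comb(2))
  ultimately have "tube_family (\<lambda>r y s. W (1 * y + 0 * s) (of_real (1 - r) * s) * f (1 * y + 0 * s) (of_real r * s))"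
    by (rule tube_family_mult)
  then show ?thesis by simp
qed

lemma tube_family_char_op:
  assumes "tube_holomorphic F"
  shows "tube_family (\<lambda>r x t. F (x + \<i> / 2 * of_real (1 - r) * t) (of_real r * t))"
proof -
  have "tube_family (\<lambda>r x t. F (1 * x + (\<i> / 2 * of_real (1 - r)) * t) (of_real r * t))"
  proof (rule tube_family_compose[OF assms])
    fix r x t assume "r \<in> {0..1::real}" "(x, t) \<in> tube"
    then show "(1 * x + \<i> / 2 * complex_of_real (1 - r) * t, complex_of_real r * t) \<in> tube"
      using tube_convex_comb(3)[of x t r r] by simp
  qed (auto intro!: continuous_intros simp: norm_mult norm_divide norm_of_real simp del: of_real_diff)
  then show ?thesis by simp
qed

lemma tube_family_prim_op:
  assumes "tube_holomorphic u"
  shows "tube_family (\<lambda>r x t. u (of_real r * x) t)"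
proof -
  have "tube_family (\<lambda>r x t. u (of_real r * x + 0 * t) (1 * t))"
    by (rule tube_family_compose[OF assms]) (auto intro!: continuous_intros dest: tube_convex_comb(1))
  then show ?thesis by simp
qed

lemma tube_holomorphic_mult_op: "tube_holomorphic f \<Longrightarrow> tube_holomorphic (mult_op f)"
  unfolding mult_op_def[abs_def]
  by (intro tube_holomorphic_add tube_holomorphic_mult tube_holomorphic_V tube_holomorphic_snd
      tube_holomorphic_integral tube_family_mult_op)

lemma tube_holomorphic_char_op: "tube_holomorphic F \<Longrightarrow> tube_holomorphic (char_op F)"
proof -
  assume "tube_holomorphic F"
  from this have "tube_holomorphic (\<lambda>x t. t * (1 / (2 * \<i>)) *
      integral {0..1} (\<lambda>r. F (x + \<i> / 2 * of_real (1 - r) * t) (of_real r * t)))"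
    by (intro tube_holomorphic_mult tube_holomorphic_snd tube_holomorphic_const
        tube_holomorphic_integral tube_family_char_op)
  also have "(\<lambda>x t. t * (1 / (2 * \<i>)) *
      integral {0..1} (\<lambda>r. F (x + \<i> / 2 * of_real (1 - r) * t) (of_real r * t))) = char_op F"
    unfolding char_op_def[abs_def] by (simp only: divide_inverse mult_1_left)
  finally show ?thesis .
qed

lemma tube_holomorphic_prim_op: "tube_holomorphic u \<Longrightarrow> tube_holomorphic (prim_op u)"
  unfolding prim_op_def[abs_def]
  by (intro tube_holomorphic_mult tube_holomorphic_fst tube_holomorphic_integral tube_family_prim_op)

lemma tube_holomorphic_T_op: "tube_holomorphic f \<Longrightarrow> tube_holomorphic (T_op f)"
  unfolding T_op_def
  by (intro tube_holomorphic_prim_op tube_holomorphic_char_op tube_holomorphic_mult_op)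

text \<open>
  Two weighted sup norms: the primitive in \<open>x\<close> costs a factor \<open>1 + norm x\<close>, which the decay of the
  potential in the strip compensates.
\<close>

definition exp_bounded :: "real \<Rightarrow> (complex \<Rightarrow> complex \<Rightarrow> complex) \<Rightarrow> bool" where
  "exp_bounded A f \<longleftrightarrow> (\<forall>x t. (x, t) \<in> tube \<longrightarrow> norm (f x t) \<le> A * exp (\<nu> * norm t))"

definition lin_exp_bounded :: "real \<Rightarrow> (complex \<Rightarrow> complex \<Rightarrow> complex) \<Rightarrow> bool" where
  "lin_exp_bounded A f \<longleftrightarrow>
     (\<forall>x t. (x, t) \<in> tube \<longrightarrow> norm (f x t) \<le> A * (1 + norm x) * exp (\<nu> * norm t))"

lemma mult_op_bound:
  assumes f: "tube_holomorphic f" and A: "0 \<le> A" "lin_exp_bounded A f"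
  shows "exp_bounded (2 * M * A) (mult_op f)"
  unfolding exp_bounded_def
proof (intro allI impI)
  fix y s assume ys: "(y, s) \<in> tube"
  have y: "y \<in> strip" using ys by (rule tube_strip)
  have ny: "0 < 1 + norm y" using norm_ge_zero[of y] by linarith
  have fb: "norm (f y (of_real r * s)) \<le> A * (1 + norm y) * exp (\<nu> * (r * norm s))" if r: "r \<in> {0..1}" for r
  proof -
    have "norm (f y (of_real r * s)) \<le> A * (1 + norm y) * exp (\<nu> * norm (of_real r * s))"
      using A(2) tube_convex_comb(2)[OF ys r r] unfolding lin_exp_bounded_def by blast
    then show ?thesis using r by (simp add: norm_mult)
  qed
  have "norm (V 0 y * f y s) \<le> M / (1 + norm y) * (A * (1 + norm y) * exp (\<nu> * norm s))"
    unfolding norm_mult using V_bound[OF y, of 0] fb[of 1] M ny by (intro mult_mono) auto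
  also have "\<dots> = M * A * exp (\<nu> * norm s)" using ny by simp
  finally have 1: "norm (V 0 y * f y s) \<le> M * A * exp (\<nu> * norm s)" .
  have "norm (W y (of_real (1 - r) * s) * f y (of_real r * s))
      \<le> M * B * A * exp (B * norm s) * exp ((\<nu> - B) * (r * norm s))" if r: "r \<in> {0..1}" for r
  proof -
    have "norm (W y (of_real (1 - r) * s)) \<le> M * B / (1 + norm y) * exp (B * ((1 - r) * norm s))"
      using W_bound[OF y, of "of_real (1 - r) * s"] r unfolding norm_mult norm_of_real by simp
    then have "norm (W y (of_real (1 - r) * s) * f y (of_real r * s))
        \<le> (M * B / (1 + norm y) * exp (B * ((1 - r) * norm s))) * (A * (1 + norm y) * exp (\<nu> * (r * norm s)))"
      unfolding norm_mult using fb[OF r] M B ny by (intro mult_mono) auto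
    also have "\<dots> = M * B * A * (exp (B * ((1 - r) * norm s)) * exp (\<nu> * (r * norm s)))"
      using ny by simp
    also have "exp (B * ((1 - r) * norm s)) * exp (\<nu> * (r * norm s))
        = exp (B * norm s) * exp ((\<nu> - B) * (r * norm s))"
      unfolding mult_exp_exp by (simp add: algebra_simps)
    finally show ?thesis by (simp add: mult.assoc)
  qed
  moreover have "continuous_on {0..1} (\<lambda>r. W y (of_real (1 - r) * s) * f y (of_real r * s))"
    using tube_family_mult_op[OF f] ys by (simp add: tube_family_def)
  ultimately have "norm s * norm (integral {0..1} (\<lambda>r. W y (of_real (1 - r) * s) * f y (of_real r * s)))
      \<le> M * B * A * exp (B * norm s) * exp ((\<nu> - B) * norm s) / (\<nu> - B)"
    using B M A \<nu> by (intro norm_integral_exp_le) auto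
  also have "\<dots> = M * A * exp (\<nu> * norm s) * (B / (\<nu> - B))"
    by (simp add: mult_exp_exp mult.assoc algebra_simps)
  also have "\<dots> \<le> M * A * exp (\<nu> * norm s) * 1"
    using B M A \<nu> by (intro mult_left_mono) (auto simp: divide_le_eq)
  finally have 2: "norm (s * integral {0..1} (\<lambda>r. W y (of_real (1 - r) * s) * f y (of_real r * s)))
      \<le> M * A * exp (\<nu> * norm s)" by (simp add: norm_mult)
  show "norm (mult_op f y s) \<le> 2 * M * A * exp (\<nu> * norm s)"
    unfolding mult_op_def using norm_triangle_mono[OF 1 2] by (simp add: mult_ac)
qed

lemma char_op_bound:
  assumes F: "tube_holomorphic F" and A: "0 \<le> A" "exp_bounded A F"
  shows "exp_bounded (A / (2 * \<nu>)) (char_op F)"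
  unfolding exp_bounded_def
proof (intro allI impI)
  fix x t assume xt: "(x, t) \<in> tube"
  have "norm t * norm (integral {0..1} (\<lambda>r. F (x + \<i> / 2 * of_real (1 - r) * t) (of_real r * t)))
      \<le> A * exp (\<nu> * norm t) / \<nu>"
  proof (rule norm_integral_exp_le)
    show "continuous_on {0..1} (\<lambda>r. F (x + \<i> / 2 * of_real (1 - r) * t) (of_real r * t))"
      using tube_family_char_op[OF F] xt by (simp add: tube_family_def)
    fix r :: real assume r: "r \<in> {0..1}"
    have "norm (F (x + \<i> / 2 * of_real (1 - r) * t) (of_real r * t)) \<le> A * exp (\<nu> * norm (of_real r * t))"
      using A(2) tube_convex_comb(3)[OF xt r r] unfolding exp_bounded_def by blast
    then show "norm (F (x + \<i> / 2 * of_real (1 - r) * t) (of_real r * t)) \<le> A * exp (\<nu> * (r * norm t))"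
      using r by (simp add: norm_mult)
  qed (use \<nu>_pos A in auto)
  then show "norm (char_op F x t) \<le> A / (2 * \<nu>) * exp (\<nu> * norm t)"
    unfolding char_op_def norm_mult norm_divide by simp
qed

lemma prim_op_bound:
  assumes u: "tube_holomorphic u" and A: "0 \<le> A" "exp_bounded A u"
  shows "lin_exp_bounded A (prim_op u)"
  unfolding lin_exp_bounded_def
proof (intro allI impI)
  fix x t assume xt: "(x, t) \<in> tube"
  have "norm (integral {0..1} (\<lambda>r. u (of_real r * x) t)) \<le> A * exp (\<nu> * norm t) * (1 - 0)"
  proof (rule integral_bound)
    show "continuous_on {0..1} (\<lambda>r. u (of_real r * x) t)"
      using tube_family_prim_op[OF u] xt by (simp add: tube_family_def)
    fix r :: real assume r: "r \<in> {0..1}"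
    show "norm (u (of_real r * x) t) \<le> A * exp (\<nu> * norm t)"
      using A(2) tube_convex_comb(1)[OF xt r r] unfolding exp_bounded_def by blast
  qed auto
  then have "norm (prim_op u x t) \<le> norm x * (A * exp (\<nu> * norm t))"
    unfolding prim_op_def norm_mult by (intro mult_left_mono) auto
  also have "\<dots> \<le> (1 + norm x) * (A * exp (\<nu> * norm t))"
    using A by (intro mult_right_mono) auto
  finally show "norm (prim_op u x t) \<le> A * (1 + norm x) * exp (\<nu> * norm t)" by (simp add: mult_ac)
qed

lemma T_op_bound:
  assumes f: "tube_holomorphic f" and A: "0 \<le> A" "lin_exp_bounded A f"
  shows "lin_exp_bounded (A / 2) (T_op f)"
proof -
  have 1: "exp_bounded (2 * M * A / (2 * \<nu>)) (char_op (mult_op f))"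
    using A M by (intro char_op_bound mult_op_bound tube_holomorphic_mult_op f) auto
  have le: "2 * M * A / (2 * \<nu>) \<le> A / 2"
    using mult_right_mono[OF \<nu>(2) A(1)] \<nu>_pos by (simp add: field_simps)
  have "exp_bounded (A / 2) (char_op (mult_op f))"
    using 1 mult_right_mono[OF le exp_ge_zero] unfolding exp_bounded_def by (meson order_trans)
  then show ?thesis
    unfolding T_op_def using A
    by (intro prim_op_bound tube_holomorphic_char_op tube_holomorphic_mult_op f) auto
qed

lemma mult_op_add:
  assumes "tube_holomorphic f" "tube_holomorphic g" "(y, s) \<in> tube"
  shows "mult_op (\<lambda>x t. f x t + g x t) y s = mult_op f y s + mult_op g y s"
proof -
  have "(\<lambda>r. W y (of_real (1 - r) * s) * h y (of_real r * s)) integrable_on {0..1}"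
    if "tube_holomorphic h" for h
    using tube_family_mult_op[OF that] assms(3)
    by (intro integrable_continuous_interval) (simp add: tube_family_def)
  from integral_add[OF this[OF assms(1)] this[OF assms(2)]]
  show ?thesis unfolding mult_op_def by (simp add: algebra_simps)
qed

text \<open>
  The values in the tube depend on the values in the tube only; \<open>mult_op_add\<close> provides the
  hypothesis on \<open>h\<close> in the tube and not beyond.
\<close>

lemma char_op_add:
  assumes "tube_holomorphic f" "tube_holomorphic g" "(x, t) \<in> tube"
    and eq: "\<And>x t. (x, t) \<in> tube \<Longrightarrow> h x t = f x t + g x t"
  shows "char_op h x t = char_op f x t + char_op g x t"
proof -
  have int: "(\<lambda>r. h (x + \<i> / 2 * of_real (1 - r) * t) (of_real r * t)) integrable_on {0..1}"
    if "tube_holomorphic h" for h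
    using tube_family_char_op[OF that] assms(3)
    by (intro integrable_continuous_interval) (simp add: tube_family_def)
  have "integral {0..1} (\<lambda>r. h (x + \<i> / 2 * of_real (1 - r) * t) (of_real r * t))
    = integral {0..1} (\<lambda>r. f (x + \<i> / 2 * of_real (1 - r) * t) (of_real r * t)
        + g (x + \<i> / 2 * of_real (1 - r) * t) (of_real r * t))"
    by (intro integral_cong eq tube_convex_comb(3)[OF assms(3)])
  also note integral_add[OF int[OF assms(1)] int[OF assms(2)]]
  finally show ?thesis unfolding char_op_def by (simp add: distrib_left)
qed

lemma prim_op_add:
  assumes "tube_holomorphic f" "tube_holomorphic g" "(x, t) \<in> tube"
    and eq: "\<And>x t. (x, t) \<in> tube \<Longrightarrow> h x t = f x t + g x t"
  shows "prim_op h x t = prim_op f x t + prim_op g x t"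
proof -
  have int: "(\<lambda>r. h (of_real r * x) t) integrable_on {0..1}" if "tube_holomorphic h" for h
    using tube_family_prim_op[OF that] assms(3)
    by (intro integrable_continuous_interval) (simp add: tube_family_def)
  have "integral {0..1} (\<lambda>r. h (of_real r * x) t)
    = integral {0..1} (\<lambda>r. f (of_real r * x) t + g (of_real r * x) t)"
    by (intro integral_cong eq tube_convex_comb(1)[OF assms(3)])
  also note integral_add[OF int[OF assms(1)] int[OF assms(2)]]
  finally show ?thesis unfolding prim_op_def by (simp add: distrib_left)
qed

lemma T_op_add:
  assumes f: "tube_holomorphic f" and g: "tube_holomorphic g" and xt: "(x, t) \<in> tube"
  shows "T_op (\<lambda>x t. f x t + g x t) x t = T_op f x t + T_op g x t"
  unfolding T_op_def
  by (rule prim_op_add[OF _ _ xt char_op_add[OF _ _ _ mult_op_add[OF f g]]])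
    (intro tube_holomorphic_char_op tube_holomorphic_mult_op f g | assumption)+

text \<open>The terms of the Neumann series.\<close>

primrec iterate :: "nat \<Rightarrow> complex \<Rightarrow> complex \<Rightarrow> complex" where
  "iterate 0 = (\<lambda>x t. 1)"
| "iterate (Suc n) = T_op (iterate n)"

lemma iterate_holomorphic: "tube_holomorphic (iterate n)"
  by (induction n) (auto intro: tube_holomorphic_const tube_holomorphic_T_op)

lemma iterate_bound: "lin_exp_bounded (1 / 2 ^ n) (iterate n)"
proof (induction n)
  case 0
  have "1 \<le> (1 + norm x) * exp (\<nu> * norm t)" for x t :: complex
  proof -
    have "1 * 1 \<le> (1 + norm x) * exp (\<nu> * norm t)"
      using \<nu>_pos by (intro mult_mono) auto
    then show ?thesis by simp
  qed
  then show ?case by (simp add: lin_exp_bounded_def)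
next
  case (Suc n)
  show ?case using T_op_bound[OF iterate_holomorphic _ Suc] by (simp add: field_simps)
qed

text \<open>The Borel transform of the factor \<open>\<phi>\<^sub>+\<close>.\<close>

definition chi :: "complex \<Rightarrow> complex \<Rightarrow> complex" where
  "chi x t = (\<Sum>n. iterate n x t)"

lemma iterate_summable:
  assumes "(x, t) \<in> tube"
  shows "summable (\<lambda>n. iterate n x t)"
    and "norm (\<Sum>n. iterate (n + N) x t) \<le> 2 / 2 ^ N * (1 + norm x) * exp (\<nu> * norm t)"
proof -
  define h where "h n = (1/2) ^ n * ((1 / 2 ^ N) * (1 + norm x) * exp (\<nu> * norm t))" for n
  have h: "h sums (2 * ((1 / 2 ^ N) * (1 + norm x) * exp (\<nu> * norm t)))"
    unfolding h_def using geometric_sums[of "1/2 :: real"] by (intro sums_mult2) simp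
  have le: "norm (iterate (n + N) x t) \<le> h n" for n
  proof -
    have "norm (iterate (n + N) x t) \<le> 1 / 2 ^ (n + N) * (1 + norm x) * exp (\<nu> * norm t)"
      using iterate_bound[of "n + N"] assms unfolding lin_exp_bounded_def by blast
    also have "\<dots> = h n" by (simp add: h_def power_add power_one_over)
    finally show ?thesis .
  qed
  have "summable (\<lambda>n. iterate (n + N) x t)"
    using le by (intro summable_comparison_test[of "\<lambda>n. iterate (n + N) x t" h] sums_summable[OF h]) auto
  then show "summable (\<lambda>n. iterate n x t)"
    by (rule summable_iff_shift[THEN iffD1])
  show "norm (\<Sum>n. iterate (n + N) x t) \<le> 2 / 2 ^ N * (1 + norm x) * exp (\<nu> * norm t)"
    using norm_suminf_le[OF le sums_summable[OF h], unfolded sums_unique[OF h, symmetric]]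
    by (simp add: mult.assoc distrib_left distrib_right)
qed

lemma chi_holomorphic: "tube_holomorphic chi"
  unfolding chi_def[abs_def]
proof (rule tube_holomorphic_suminf)
  fix R :: real
  have "bounded_on_tube R ((1/2) ^ n * ((1 + \<bar>R\<bar>) * exp (\<nu> * \<bar>R\<bar>))) (iterate n)" for n
    unfolding bounded_on_tube_def
  proof (intro allI impI)
    fix x t assume xt: "(x, t) \<in> tube" "norm x \<le> R" "norm t \<le> R"
    have "norm (iterate n x t) \<le> 1 / 2 ^ n * (1 + norm x) * exp (\<nu> * norm t)"
      using iterate_bound[of n] xt unfolding lin_exp_bounded_def by blast
    also have "\<dots> \<le> 1 / 2 ^ n * (1 + \<bar>R\<bar>) * exp (\<nu> * \<bar>R\<bar>)"
      using xt \<nu>_pos by (intro mult_mono) auto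
    finally show "norm (iterate n x t) \<le> (1/2) ^ n * ((1 + \<bar>R\<bar>) * exp (\<nu> * \<bar>R\<bar>))"
      by (simp add: power_one_over)
  qed
  moreover have "summable (\<lambda>n. (1/2) ^ n * ((1 + \<bar>R\<bar>) * exp (\<nu> * \<bar>R\<bar>)))"
    by (intro summable_mult2 summable_geometric) simp
  ultimately show "\<exists>h. summable h \<and> (\<forall>n. bounded_on_tube R (h n) (iterate n))" by blast
qed (rule iterate_holomorphic)

lemma chi_bound: "lin_exp_bounded 2 chi"
  unfolding lin_exp_bounded_def chi_def using iterate_summable(2)[where N = 0] by simp

lemma chi_fixed_point:
  assumes xt: "(x, t) \<in> tube"
  shows "chi x t = 1 + T_op chi x t"
proof -
  define S where "S N x t = (\<Sum>n<N. iterate n x t)" for N x t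
  define R where "R N x t = (\<Sum>n. iterate (n + N) x t)" for N x t
  have chi_eq: "chi x t = S N x t + R N x t" if "(x, t) \<in> tube" for N x t
    unfolding chi_def S_def R_def using suminf_split_initial_segment[OF iterate_summable(1)[OF that], of N]
    by simp
  have S: "tube_holomorphic (S N)" for N
    unfolding S_def[abs_def] by (intro tube_holomorphic_sum iterate_holomorphic)
  have "tube_holomorphic (\<lambda>x t. chi x t - S N x t)" for N
    by (intro tube_holomorphic_diff chi_holomorphic S)
  moreover define R' where "R' N x t = chi x t - S N x t" for N x t
  ultimately have R': "tube_holomorphic (R' N)" for N by (simp add: R'_def[abs_def])
  have R'_bound: "lin_exp_bounded (2 / 2 ^ N) (R' N)" for N
    unfolding lin_exp_bounded_def R'_def
    using iterate_summable(2) chi_eq[of _ _ N] by (simp add: R_def)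
  have T_S: "T_op (S N) x t = S (Suc N) x t - 1" for N
  proof (induction N)
    case 0
    show ?case by (simp add: T_op_def prim_op_def char_op_def mult_op_def S_def)
  next
    case (Suc N)
    have S_Suc: "S (Suc N) = (\<lambda>x t. S N x t + iterate N x t)" for N
      by (simp add: S_def fun_eq_iff)
    have "T_op (S (Suc N)) x t = T_op (\<lambda>x t. S N x t + iterate N x t) x t"
      by (simp only: S_Suc)
    also have "\<dots> = T_op (S N) x t + iterate (Suc N) x t"
      using T_op_add[OF S iterate_holomorphic xt] by simp
    finally show ?case using Suc S_Suc[of "Suc N"] by simp
  qed
  \<comment> \<open>both terms on the right are of the order of the tail of a geometric series\<close>
  have T_chi: "1 + T_op chi x t - chi x t = T_op (R' N) x t - R' (Suc N) x t" for N
  proof -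
    have "T_op chi x t = T_op (\<lambda>x t. S N x t + R' N x t) x t" by (simp add: R'_def)
    also have "\<dots> = T_op (S N) x t + T_op (R' N) x t" by (rule T_op_add[OF S R' xt])
    finally show ?thesis by (simp add: T_S R'_def)
  qed
  define c where "c = (1 + norm x) * exp (\<nu> * norm t)"
  have le: "norm (1 + T_op chi x t - chi x t) \<le> 2 * c * (1/2) ^ N" for N
  proof -
    have "norm (T_op (R' N) x t) \<le> 2 / 2 ^ N / 2 * (1 + norm x) * exp (\<nu> * norm t)"
      using T_op_bound[OF R' _ R'_bound, of N] xt unfolding lin_exp_bounded_def by auto
    moreover have "norm (R' (Suc N) x t) \<le> 2 / 2 ^ Suc N * (1 + norm x) * exp (\<nu> * norm t)"
      using R'_bound[of "Suc N"] xt unfolding lin_exp_bounded_def by blast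
    ultimately have "norm (T_op (R' N) x t - R' (Suc N) x t)
        \<le> 2 / 2 ^ N / 2 * (1 + norm x) * exp (\<nu> * norm t) + 2 / 2 ^ Suc N * (1 + norm x) * exp (\<nu> * norm t)"
      by (intro order_trans[OF norm_triangle_ineq4] add_mono)
    also have "\<dots> = 2 * c * (1/2) ^ N"
      unfolding c_def by (simp add: power_one_over field_simps)
    finally show ?thesis unfolding T_chi[of N] .
  qed
  have "(\<lambda>N. 2 * c * (1/2) ^ N) \<longlonglongrightarrow> 2 * c * 0"
    by (intro tendsto_intros LIMSEQ_power_zero) simp
  then have "norm (1 + T_op chi x t - chi x t) \<le> 2 * c * 0"
    by (rule LIMSEQ_le_const) (use le in auto)
  then show ?thesis by simp
qed

end

section \<open>The differential equation for the Laplace transform\<close>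

lemma claplace_power:
  assumes "0 < Re z"
  shows "claplace (\<lambda>t. of_real t ^ k / fact k) z = 1 / z ^ Suc k"
    and "L1_weighted (Re z) (\<lambda>t. of_real t ^ k / fact k)"
proof -
  define a where "a = Re z / 2"
  have a: "0 < a" "a < Re z" using assms by (auto simp: a_def)
  have et: "exp_type 1 a (\<lambda>t. t ^ k / fact k)" for k
  proof -
    have "norm (t ^ k / fact k) \<le> 1 / a ^ k * exp (a * norm t)" for t :: complex
    proof -
      have "(a * norm t) ^ k / fact k \<le> exp (a * norm t)"
        using exp_converges[of "a * norm t"] a
          sum_le_suminf[of "\<lambda>n. (a * norm t) ^ n /\<^sub>R fact n" "{k}"]
        by (simp add: sums_iff divide_inverse mult.commute)
      then have "(a * norm t) ^ k / fact k / a ^ k \<le> exp (a * norm t) / a ^ k"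
        using a by (intro divide_right_mono) auto
      then show ?thesis using a by (simp add: norm_divide norm_power power_mult_distrib)
    qed
    then show ?thesis unfolding exp_type_def
      using a by (auto intro!: holomorphic_intros exI[of _ "1 / a ^ k"])
  qed
  show "L1_weighted (Re z) (\<lambda>t. of_real t ^ k / fact k)"
    using exp_type_L1_weighted[OF et _ a(2)] by simp
  show "claplace (\<lambda>t. of_real t ^ k / fact k) z = 1 / z ^ Suc k"
  proof (induction k)
    case 0
    show ?case using claplace_const[OF assms, of 1] by simp
  next
    case (Suc k)
    have d: "deriv (\<lambda>t. t ^ Suc k / fact (Suc k)) t = t ^ k / fact k" for t :: complex
    proof (rule DERIV_imp_deriv)
      have "((\<lambda>t. t ^ Suc k / fact (Suc k)) has_field_derivative (of_nat (Suc k) * t ^ k / fact (Suc k))) (at t)"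
        using DERIV_cdivide[OF DERIV_power[OF DERIV_ident, of "Suc k" t UNIV], of "fact (Suc k)"]
        by (simp del: fact_Suc of_nat_Suc)
      then show "((\<lambda>t. t ^ Suc k / fact (Suc k)) has_field_derivative t ^ k / fact k) (at t)"
        by (simp del: of_nat_Suc)
    qed
    have "claplace (\<lambda>t. of_real t ^ Suc k / fact (Suc k)) z
        = claplace (\<lambda>t. of_real t ^ k / fact k) z / z"
      using claplace_exp_type_deriv[OF et[of "Suc k"] _ _ a(2)] a unfolding d by simp
    then show ?case using Suc by (simp add: field_simps)
  qed
qed

context potential
begin

text \<open>\<open>u\<close> is the derivative of \<open>chi\<close> in \<open>x\<close>, and \<open>F = u\<^sub>x + 2 \<i> u\<^sub>t\<close> is the transformed product of the
  potential and \<open>\<phi>\<^sub>+\<close>.\<close>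

definition F where "F = mult_op chi"

definition u where "u = char_op F"

text \<open>
  On the Laplace side: \<open>v\<close> is the value of the series \<open>\<Sum>k. V k x / lam ^ k\<close>, \<open>\<Phi>\<close> is \<open>\<phi>\<^sub>+\<close> for complex \<open>x\<close>,
  \<open>w\<close> is its derivative in \<open>x\<close>, and \<open>G\<close> will turn out to be \<open>v \<Phi>\<close>.
\<close>

definition v :: "complex \<Rightarrow> real \<Rightarrow> complex" where
  "v x lam = V 0 x + claplace (\<lambda>t. W x (of_real t)) (of_real lam)"

definition \<Phi> :: "complex \<Rightarrow> real \<Rightarrow> complex" where
  "\<Phi> x lam = claplace (\<lambda>t. chi x (of_real t)) (of_real lam)"

definition w :: "complex \<Rightarrow> real \<Rightarrow> complex" where
  "w x lam = claplace (\<lambda>t. u x (of_real t)) (of_real lam)"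

definition G :: "real \<Rightarrow> complex \<Rightarrow> complex" where
  "G lam x = claplace (\<lambda>t. F x (of_real t)) (of_real lam)"

lemma F_holomorphic: "tube_holomorphic F"
  unfolding F_def by (intro tube_holomorphic_mult_op chi_holomorphic)

lemma u_holomorphic: "tube_holomorphic u"
  unfolding u_def by (intro tube_holomorphic_char_op F_holomorphic)

lemma F_bound: "exp_bounded (4 * M) F"
  unfolding F_def using mult_op_bound[OF chi_holomorphic _ chi_bound] by simp

lemma u_bound: "exp_bounded 1 u"
proof -
  have 1: "exp_bounded (4 * M / (2 * \<nu>)) u"
    unfolding u_def using M by (intro char_op_bound F_holomorphic F_bound) auto
  have "4 * M / (2 * \<nu>) \<le> 1" using \<nu> \<nu>_pos by (simp add: field_simps)
  from 1 mult_right_mono[OF this exp_ge_zero] show ?thesis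
    unfolding exp_bounded_def by (meson order_trans)
qed

lemma chi_eq: "(x, t) \<in> tube \<Longrightarrow> chi x t = 1 + prim_op u x t"
  using chi_fixed_point unfolding T_op_def u_def F_def .

lemma chi_at_0:
  shows "chi 0 (of_real t) = 1" and "x \<in> strip \<Longrightarrow> chi x 0 = 1"
proof -
  have "(0, of_real t) \<in> tube" by (simp add: strip_def)
  from chi_eq[OF this] show "chi 0 (of_real t) = 1" by (simp add: prim_op_def)
  assume "x \<in> strip"
  then have "(x, 0) \<in> tube" using tube_real_iff[of x 0] by simp
  moreover have "u y 0 = 0" for y by (simp add: u_def char_op_def)
  ultimately show "chi x 0 = 1" using chi_eq[of x 0] by (simp add: prim_op_def)
qed

lemma tube_holomorphic_continuous_real:
  assumes "tube_holomorphic f" "x \<in> strip"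
  shows "continuous_on A (\<lambda>t. f x (of_real t))"
  by (rule tube_holomorphic_continuous_on_compose[OF assms(1)]) (use assms(2) in \<open>auto intro!: continuous_intros\<close>)

lemma chi_has_field_derivative:
  assumes x: "x \<in> strip"
  shows "((\<lambda>x. chi x (of_real t)) has_field_derivative u x (of_real t)) (at x)"
proof -
  have hol: "(\<lambda>x. u x (of_real t)) holomorphic_on strip"
    by (rule tube_holomorphicD(2)[OF u_holomorphic])
  obtain P where P: "\<And>x. x \<in> strip \<Longrightarrow> (P has_field_derivative u x (of_real t)) (at x)"
    using holomorphic_convex_primitive'[OF convex_strip open_strip hol] open_strip
    by (metis at_within_open)
  have ftc: "prim_op u y (of_real t) = P y - P 0" if y: "y \<in> strip" for y
  proof -
    have "((\<lambda>r. y * u (of_real r * y) (of_real t)) has_integral (P (of_real 1 * y) - P (of_real 0 * y))) {0..1}"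
    proof (rule fundamental_theorem_of_calculus)
      fix r :: real assume r: "r \<in> {0..1}"
      have "of_real r * y \<in> strip"
        using tube_convex_comb(1)[of y 0 r r] y r tube_real_iff[of y 0] tube_strip by force
      from P[OF this] have "((\<lambda>r. P (of_real r * y)) has_vector_derivative y * u (of_real r * y) (of_real t)) (at r)"
        by (intro field_vector_diff_chain_at[unfolded o_def])
          (auto intro!: derivative_eq_intros simp: has_vector_derivative_def scaleR_conv_of_real)
      then show "((\<lambda>r. P (of_real r * y)) has_vector_derivative y * u (of_real r * y) (of_real t)) (at r within {0..1})"
        by (rule has_vector_derivative_at_within)
    qed simp
    from integral_unique[OF this] show ?thesis by (simp add: prim_op_def)
  qed
  have "((\<lambda>x. 1 + (P x - P 0)) has_field_derivative u x (of_real t)) (at x)"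
    by (auto intro!: derivative_eq_intros P x)
  then show ?thesis
    by (rule has_field_derivative_transform_within_open[OF _ open_strip x])
      (use ftc chi_eq in simp)
qed

text \<open>Laplace transforms of functions in the tube are holomorphic in the strip.\<close>

lemma laplace_has_field_derivative:
  assumes f: "tube_holomorphic f" and A: "0 \<le> A" "lin_exp_bounded A f" and x: "x \<in> strip" and lam: "\<nu> < lam"
  shows "((\<lambda>x. claplace (\<lambda>t. f x (of_real t)) (of_real lam)) has_field_derivative
          claplace (\<lambda>t. deriv (\<lambda>x. f x (of_real t)) x) (of_real lam)) (at x)"
proof -
  obtain r where r: "0 < r" "cball x r \<subseteq> strip"
    using open_strip x open_contains_cball by blast
  show ?thesis
  proof (rule has_field_derivative_laplace_parameter[OF _ _ r])
    fix y t assume y: "y \<in> cball x r" and t: "(0::real) \<le> t"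
    have "norm y \<le> norm x + r"
      using y norm_triangle_sub[of y x] by (auto simp: dist_norm norm_minus_commute)
    moreover have "norm (f y (of_real t)) \<le> A * (1 + norm y) * exp (\<nu> * norm (of_real t :: complex))"
      using A(2) y r unfolding lin_exp_bounded_def by (meson subsetD tube_real_iff)
    moreover have "A * (1 + norm y) * exp (\<nu> * norm (of_real t :: complex)) \<le> A * (1 + (norm x + r)) * exp (\<nu> * t)"
      if "norm y \<le> norm x + r"
      using that A t r(1) by (intro mult_mono mult_nonneg_nonneg) auto
    ultimately show "norm (f y (of_real t)) \<le> A * (1 + (norm x + r)) * exp (\<nu> * t)" by linarith
  qed (use lam in \<open>auto intro: tube_holomorphicD(2)[OF f] tube_holomorphic_continuous_real[OF f]\<close>)
qed

lemma exp_bounded_imp_lin: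
  assumes "0 \<le> A" "exp_bounded A f"
  shows "lin_exp_bounded A f"
  unfolding lin_exp_bounded_def
proof (intro allI impI)
  fix x t assume "(x, t) \<in> tube"
  then have "norm (f x t) \<le> A * 1 * exp (\<nu> * norm t)" using assms(2) unfolding exp_bounded_def by simp
  also have "\<dots> \<le> A * (1 + norm x) * exp (\<nu> * norm t)"
    using assms(1) by (intro mult_right_mono mult_left_mono) auto
  finally show "norm (f x t) \<le> A * (1 + norm x) * exp (\<nu> * norm t)" .
qed

lemma exp_bounded_real:
  assumes "exp_bounded A f" "x \<in> strip" "0 \<le> t"
  shows "norm (f x (of_real t)) \<le> A * exp (\<nu> * t)"
proof -
  have "norm (f x (of_real t)) \<le> A * exp (\<nu> * norm (of_real t :: complex))"
    using assms unfolding exp_bounded_def by (meson tube_real_iff)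
  then show ?thesis using assms(3) by simp
qed

lemma chi_bound_real:
  assumes "x \<in> strip" "0 \<le> t"
  shows "norm (chi x (of_real t)) \<le> 2 * (1 + norm x) * exp (\<nu> * t)"
proof -
  have "norm (chi x (of_real t)) \<le> 2 * (1 + norm x) * exp (\<nu> * norm (of_real t :: complex))"
    using chi_bound assms unfolding lin_exp_bounded_def by (meson tube_real_iff)
  then show ?thesis using assms(2) by simp
qed

lemma \<Phi>_has_field_derivative:
  assumes x: "x \<in> strip" and lam: "\<nu> < lam"
  shows "((\<lambda>x. \<Phi> x lam) has_field_derivative w x lam) (at x)"
proof -
  have "deriv (\<lambda>x. chi x (of_real t)) x = u x (of_real t)" for t
    by (rule DERIV_imp_deriv[OF chi_has_field_derivative[OF x]])
  then show ?thesis
    using laplace_has_field_derivative[OF chi_holomorphic _ chi_bound x lam]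
    unfolding \<Phi>_def w_def by simp
qed

lemma G_holomorphic:
  assumes "\<nu> < lam" shows "G lam holomorphic_on strip"
  unfolding holomorphic_on_open[OF open_strip] G_def[abs_def]
  using laplace_has_field_derivative[OF F_holomorphic _ exp_bounded_imp_lin[OF _ F_bound] _ assms] M by auto

lemma G_bound:
  assumes "\<nu> < lam" "x \<in> strip" shows "norm (G lam x) \<le> 4 * M / (lam - \<nu>)"
  unfolding G_def
  using exp_bound_norm_claplace_le[OF tube_holomorphic_continuous_real[OF F_holomorphic assms(2)]
      exp_bounded_real[OF F_bound assms(2)], of "of_real lam"] assms(1) by simp

lemma w_bound:
  assumes "\<nu> < lam" "x \<in> strip" shows "norm (w x lam) \<le> 1 / (lam - \<nu>)"
  unfolding w_def
  using exp_bound_norm_claplace_le[OF tube_holomorphic_continuous_real[OF u_holomorphic assms(2)]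
      exp_bounded_real[OF u_bound assms(2)], of "of_real lam"] assms(1) by simp

lemma W_bound_real:
  assumes "x \<in> strip" "0 \<le> t"
  shows "norm (W x (of_real t)) \<le> M * B * exp (B * t)"
proof -
  have "norm (W x (of_real t)) \<le> M * B / (1 + norm x) * exp (B * t)"
    using W_bound[OF assms(1), of "of_real t"] assms(2) by simp
  also have "\<dots> \<le> M * B * exp (B * t)"
    using M B by (intro mult_right_mono divide_one_plus_norm_le) auto
  finally show ?thesis .
qed

text \<open>
  The series \<open>W\<close> is integrated termwise; its partial sums are dominated by \<open>M * B * exp (B * t)\<close>.
\<close>

lemma v_sums:
  assumes x: "x \<in> strip" and lam: "\<nu> < lam"
  shows "(\<lambda>k. V k x * of_real (1 / lam) ^ k) sums v x lam"
proof -
  have lam0: "0 < lam" "B < lam" using lam \<nu> B by auto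
  define S where "S n t = (\<Sum>k<n. V (Suc k) x * (of_real t ^ k / fact k))" for n and t :: real
  have Ssums: "(\<lambda>n. S n t) \<longlonglongrightarrow> W x (of_real t)" for t
  proof -
    have "summable (\<lambda>k. V (Suc k) x * (complex_of_real t ^ k / fact k))"
      by (rule summable_comparison_test[OF _ summable_mult[OF sums_summable[OF exp_sums_real]]])
        (use W_term_le[OF x] in blast)
    from summable_LIMSEQ[OF this] show ?thesis unfolding S_def W_def .
  qed
  have Sbound: "norm (S n t) \<le> M * B * exp (B * t)" if t: "0 \<le> t" for n t
  proof -
    have "norm (S n t) \<le> (\<Sum>k<n. M * B * ((B * t) ^ k / fact k))"
      unfolding S_def
    proof (rule sum_norm_le)
      fix k
      have "norm (V (Suc k) x * (complex_of_real t ^ k / fact k)) \<le> M * B / (1 + norm x) * ((B * t) ^ k / fact k)"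
        using W_term_le[OF x, of k "of_real t"] t by simp
      also have "\<dots> \<le> M * B * ((B * t) ^ k / fact k)"
        using M B t by (intro mult_right_mono divide_one_plus_norm_le) auto
      finally show "norm (V (Suc k) x * (complex_of_real t ^ k / fact k)) \<le> M * B * ((B * t) ^ k / fact k)" .
    qed
    also have "\<dots> \<le> M * B * exp (B * t)"
    proof -
      have *: "(\<lambda>k. M * B * ((B * t) ^ k / fact k)) sums (M * B * exp (B * t))"
        by (intro sums_mult exp_sums_real)
      show ?thesis unfolding sums_unique[OF *]
        by (rule sum_le_suminf[OF sums_summable[OF *]]) (use M B t in auto)
    qed
    finally show ?thesis .
  qed
  have L: "claplace (S n) (of_real lam) = (\<Sum>k<n. V (Suc k) x * of_real (1 / lam) ^ Suc k)"
    and L1: "L1_weighted lam (S n)" for n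
  proof (induction n)
    case 0
    { case 1 show ?case by (simp add: S_def[abs_def] claplace_def) }
    { case 2 show ?case by (simp add: S_def[abs_def] L1_weighted_iff) }
  next
    case (Suc n)
    have eq: "S (Suc n) = (\<lambda>t. S n t + V (Suc n) x * (of_real t ^ n / fact n))"
      by (simp add: S_def fun_eq_iff)
    have l1: "L1_weighted lam (\<lambda>t. V (Suc n) x * (of_real t ^ n / fact n))"
    proof -
      have "L1_weighted lam (\<lambda>t. of_real t ^ n / fact n)"
        using claplace_power(2)[of "of_real lam" n] lam0 by simp
      from integrable_mult_right[OF this[unfolded L1_weighted_iff], of "V (Suc n) x"]
      show ?thesis unfolding L1_weighted_iff by (simp only: mult_scaleR_right)
    qed
    { case 1 show ?case
        unfolding eq using claplace_add[OF Suc(2) l1, of "of_real lam"] Suc(1) lam0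
          claplace_power(1)[of "of_real lam" n] claplace_cmult[of "V (Suc n) x" "\<lambda>t. of_real t ^ n / fact n"]
        by (simp add: power_one_over) }
    { case 2 show ?case
        using Bochner_Integration.integrable_add[OF Suc(2)[unfolded L1_weighted_iff] l1[unfolded L1_weighted_iff]]
        unfolding eq L1_weighted_iff by (simp add: scaleR_add_right) }
  qed
  have "(\<lambda>n. claplace (S n) (of_real lam)) \<longlonglongrightarrow> claplace (\<lambda>t. W x (of_real t)) (of_real lam)"
    unfolding claplace_def
  proof (rule integral_dominated_convergence)
    show "integrable (lebesgue_on {0..}) (\<lambda>t. M * B * exp (- (lam - B) * t))"
      using lam0 by (intro integrable_mult_right integrable_exp_minus) auto
    show "(\<lambda>t. exp (- of_real lam * of_real t) * W x (of_real t)) \<in> borel_measurable (lebesgue_on {0..})"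
      by (intro measurable_exp_times continuous_imp_measurable_on_sets_lebesgue
          tube_holomorphic_continuous_real[OF tube_holomorphic_W x]) auto
    fix n
    show "(\<lambda>t. exp (- of_real lam * of_real t) * S n t) \<in> borel_measurable (lebesgue_on {0..})"
      using L1 by (intro measurable_exp_times L1_weighted_measurable)
    show "AE t in lebesgue_on {0..}. norm (exp (- of_real lam * of_real t) * S n t) \<le> M * B * exp (- (lam - B) * t)"
    proof (rule AE_I2)
      fix t assume "t \<in> space (lebesgue_on {0::real..})"
      then have "exp (- lam * t) * norm (S n t) \<le> exp (- lam * t) * (M * B * exp (B * t))"
        using Sbound[of t n] by (intro mult_left_mono) auto
      also have "\<dots> = M * B * exp (- (lam - B) * t)"
        by (simp add: mult_exp_exp mult.left_commute algebra_simps)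
      finally show "norm (exp (- of_real lam * of_real t) * S n t) \<le> M * B * exp (- (lam - B) * t)"
        by (simp add: norm_mult norm_exp_eq_Re)
    qed
  qed (auto intro!: AE_I2 tendsto_intros Ssums)
  then have "(\<lambda>k. V (Suc k) x * of_real (1 / lam) ^ Suc k) sums claplace (\<lambda>t. W x (of_real t)) (of_real lam)"
    unfolding L sums_def .
  then show ?thesis unfolding v_def by (subst (asm) sums_Suc_iff) (simp add: add.commute)
qed

lemma chi_L1_weighted:
  assumes "x \<in> strip" "\<nu> < lam"
  shows "L1_weighted lam (\<lambda>t. chi x (of_real t))"
  by (rule exp_bound_L1_weighted[OF tube_holomorphic_continuous_real[OF chi_holomorphic assms(1)]
      chi_bound_real[OF assms(1)] assms(2)])

lemma strip_shift: "x \<in> strip \<Longrightarrow> x + \<i> / 2 * of_real \<tau> \<in> strip"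
  by (simp add: strip_def)

lemma G_eq:
  assumes x: "x \<in> strip" and lam: "\<nu> < lam"
  shows "G lam x = v x lam * \<Phi> x lam"
proof -
  define D where "D s = of_real s * integral {0..1} (\<lambda>r. W x (of_real ((1 - r) * s)) * chi x (of_real (r * s)))" for s :: real
  have F_eq: "F x (of_real s) = V 0 x * chi x (of_real s) + D s" for s
    unfolding F_def mult_op_def D_def by simp
  have cW: "continuous_on A (\<lambda>t. W x (of_real t))" and cchi: "continuous_on A (\<lambda>t. chi x (of_real t))" for A
    using tube_holomorphic_continuous_real[OF _ x] tube_holomorphic_W chi_holomorphic by blast+
  have L1F: "L1_weighted lam (\<lambda>t. F x (of_real t))"
    by (rule exp_bound_L1_weighted[OF tube_holomorphic_continuous_real[OF F_holomorphic x]
        exp_bounded_real[OF F_bound x] lam])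
  have L1chi: "L1_weighted lam (\<lambda>t. V 0 x * chi x (of_real t))"
  proof (rule exp_bound_L1_weighted[OF _ _ lam])
    show "continuous_on {0..} (\<lambda>t. V 0 x * chi x (of_real t))" by (intro continuous_intros cchi)
    fix t :: real assume t: "0 \<le> t"
    show "norm (V 0 x * chi x (of_real t)) \<le> (norm (V 0 x) * (2 * (1 + norm x))) * exp (\<nu> * t)"
      using mult_left_mono[OF chi_bound_real[OF x t] norm_ge_zero[of "V 0 x"]]
      by (simp add: norm_mult mult.assoc)
  qed
  have "claplace D (of_real lam)
      = claplace (\<lambda>\<tau>. claplace (\<lambda>s. W x (of_real \<tau>) * chi x (of_real s)) (of_real lam)) (of_real lam)"
    unfolding D_def[abs_def]
  proof (rule claplace_convolution[where H = "\<lambda>\<tau> s. W x (of_real \<tau>) * chi x (of_real s)"])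
    show "continuous_on ({0..} \<times> {0..}) (\<lambda>p. W x (of_real (fst p)) * chi x (of_real (snd p)))"
      by (intro continuous_intros continuous_on_compose2[OF cW[of UNIV]] continuous_on_compose2[OF cchi[of UNIV]]) auto
    fix \<tau> s :: real assume \<tau>s: "0 \<le> \<tau>" "0 \<le> s"
    have "norm (W x (of_real \<tau>)) \<le> M * B * exp (\<nu> * \<tau>)"
      by (rule order_trans[OF W_bound_real[OF x \<tau>s(1)]])
        (use M B \<nu> \<tau>s in \<open>auto intro!: mult_left_mono mult_right_mono\<close>)
    then have "norm (W x (of_real \<tau>) * chi x (of_real s))
        \<le> M * B * exp (\<nu> * \<tau>) * (2 * (1 + norm x) * exp (\<nu> * s))"
      unfolding norm_mult using chi_bound_real[OF x \<tau>s(2)] M B by (intro mult_mono) auto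
    also have "\<dots> = M * B * (2 * (1 + norm x)) * (exp (\<nu> * \<tau>) * exp (\<nu> * s))"
      by (simp only: mult_ac)
    also have "exp (\<nu> * \<tau>) * exp (\<nu> * s) = exp (\<nu> * (\<tau> + s))"
      by (simp add: mult_exp_exp distrib_left)
    finally show "norm (W x (of_real \<tau>) * chi x (of_real s)) \<le> M * B * (2 * (1 + norm x)) * exp (\<nu> * (\<tau> + s))" .
  qed (use lam in simp)
  also have "\<dots> = claplace (\<lambda>\<tau>. \<Phi> x lam * W x (of_real \<tau>)) (of_real lam)"
  proof -
    have "claplace (\<lambda>s. W x (of_real \<tau>) * chi x (of_real s)) (of_real lam) = \<Phi> x lam * W x (of_real \<tau>)" for \<tau>
      unfolding claplace_cmult \<Phi>_def by (rule mult.commute)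
    then show ?thesis by simp
  qed
  also have "\<dots> = \<Phi> x lam * claplace (\<lambda>t. W x (of_real t)) (of_real lam)" by (rule claplace_cmult)
  finally have LD: "claplace D (of_real lam) = \<Phi> x lam * claplace (\<lambda>t. W x (of_real t)) (of_real lam)" .
  have D_eq: "D = (\<lambda>s. F x (of_real s) - V 0 x * chi x (of_real s))" using F_eq by auto
  have "claplace D (of_real lam) = G lam x - V 0 x * \<Phi> x lam"
    using claplace_diff[OF L1F L1chi, of "of_real lam"] claplace_cmult[of "V 0 x"]
    unfolding D_eq G_def \<Phi>_def by simp
  then show ?thesis using LD by (simp add: v_def algebra_simps)
qed

lemma w_eq:
  assumes x: "x \<in> strip" and lam: "\<nu> < lam"
  shows "w x lam = claplace (\<lambda>\<tau>. G lam (x + \<i> / 2 * of_real \<tau>)) (of_real lam) / (2 * \<i>)"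
proof -
  define H where "H \<tau> s = F (x + \<i> / 2 * of_real \<tau>) (of_real s)" for \<tau> s :: real
  have u_eq: "u x (of_real t) = 1 / (2 * \<i>) * (of_real t * integral {0..1} (\<lambda>r. H ((1 - r) * t) (r * t)))" for t :: real
    unfolding u_def char_op_def H_def by (simp add: mult.assoc)
  have "claplace (\<lambda>t. of_real t * integral {0..1} (\<lambda>r. H ((1 - r) * t) (r * t))) (of_real lam)
      = claplace (\<lambda>\<tau>. claplace (H \<tau>) (of_real lam)) (of_real lam)"
  proof (rule claplace_convolution)
    show "continuous_on ({0..} \<times> {0..}) (\<lambda>p. H (fst p) (snd p))"
      unfolding H_def using strip_shift[OF x]
      by (intro tube_holomorphic_continuous_on_compose[OF F_holomorphic] continuous_intros) auto
    fix \<tau> s :: real assume "0 \<le> \<tau>" "0 \<le> s"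
    then show "norm (H \<tau> s) \<le> 4 * M * exp (\<nu> * (\<tau> + s))"
      unfolding H_def using M \<nu>_pos
      by (intro order_trans[OF exp_bounded_real[OF F_bound strip_shift[OF x]]] mult_left_mono)
        (auto intro!: mult_left_mono)
  qed (use lam in simp)
  then show ?thesis unfolding w_def u_eq claplace_cmult by (simp add: H_def[abs_def] G_def)
qed

text \<open>
  The equation is \<open>w' + 2 \<i> lam w = v \<Phi>\<close>. Differentiating the previous formula in \<open>x\<close> amounts
  to differentiating the integrand in \<open>\<tau>\<close>, up to the factor \<open>\<i>/2\<close>, and an integration by parts
  gives the claim.
\<close>

lemma w_has_field_derivative:
  assumes x: "x \<in> strip" and lam: "\<nu> < lam"
  shows "((\<lambda>x. w x lam) has_field_derivative v x lam * \<Phi> x lam - 2 * \<i> * of_real lam * w x lam) (at x)"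
proof -
  have lam0: "0 < lam" using lam \<nu>_pos by simp
  have dG: "(G lam has_field_derivative deriv (G lam) y) (at y)" if "y \<in> strip" for y
    using holomorphic_derivI[OF G_holomorphic[OF lam] open_strip that] .
  define Y where "Y \<tau> = G lam (x + \<i> / 2 * \<tau>)" for \<tau> :: complex
  define \<eta> where "\<eta> = 2 * (1 - \<bar>Re x\<bar>)"
  have \<eta>: "0 < \<eta>" using x by (auto simp: \<eta>_def strip_def)
  have shift: "x + \<i> / 2 * \<tau> \<in> strip" if "\<bar>Im \<tau>\<bar> < \<eta>" for \<tau>
    using that by (auto simp: \<eta>_def strip_def)
  have Y: "exp_type \<eta> 0 Y"
    unfolding exp_type_def
  proof (intro conjI exI[of _ "4 * M / (lam - \<nu>)"] allI impI)
    show "Y holomorphic_on {t. \<bar>Im t\<bar> < \<eta>}"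
      unfolding Y_def using shift
      by (intro holomorphic_on_compose_gen[OF _ G_holomorphic[OF lam], unfolded o_def] holomorphic_intros) auto
    fix t assume "\<bar>Im t\<bar> < \<eta>"
    then show "norm (Y t) \<le> 4 * M / (lam - \<nu>) * exp (0 * norm t)"
      using G_bound[OF lam shift] by (simp add: Y_def)
  qed (use M lam in auto)
  have dY: "deriv Y (of_real \<tau>) = \<i> / 2 * deriv (G lam) (x + \<i> / 2 * of_real \<tau>)" for \<tau> :: real
  proof (rule DERIV_imp_deriv)
    have "((\<lambda>t. x + \<i> / 2 * t) has_field_derivative \<i> / 2) (at (complex_of_real \<tau>))"
      by (auto intro!: derivative_eq_intros)
    from DERIV_chain2[where f = "G lam" and g = "\<lambda>t. x + \<i> / 2 * t", OF dG[OF strip_shift[OF x]] this]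
    show "(Y has_field_derivative \<i> / 2 * deriv (G lam) (x + \<i> / 2 * of_real \<tau>)) (at (of_real \<tau>))"
      unfolding Y_def by (simp add: mult.commute)
  qed
  obtain r where r: "0 < r" "cball x r \<subseteq> strip"
    using open_strip x open_contains_cball by blast
  have "((\<lambda>x. claplace (\<lambda>\<tau>. G lam (x + \<i> / 2 * of_real \<tau>)) (of_real lam)) has_field_derivative
      claplace (\<lambda>\<tau>. deriv (\<lambda>x. G lam (x + \<i> / 2 * of_real \<tau>)) x) (of_real lam)) (at x)"
  proof (rule has_field_derivative_laplace_parameter[OF _ _ r, where \<nu> = 0])
    fix \<tau> :: real
    show "(\<lambda>x. G lam (x + \<i> / 2 * of_real \<tau>)) holomorphic_on strip"
      using strip_shift
      by (intro holomorphic_on_compose_gen[OF _ G_holomorphic[OF lam], unfolded o_def] holomorphic_intros) auto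
    fix y assume "y \<in> cball x r"
    then have "y \<in> strip" using r by auto
    then show "norm (G lam (y + \<i> / 2 * of_real \<tau>)) \<le> 4 * M / (lam - \<nu>) * exp (0 * \<tau>)"
      using G_bound[OF lam strip_shift] by simp
  next
    fix y assume "y \<in> strip"
    then show "continuous_on {0..} (\<lambda>\<tau>. G lam (y + \<i> / 2 * of_real \<tau>))"
      using strip_shift
      by (intro continuous_on_compose2[OF holomorphic_on_imp_continuous_on[OF G_holomorphic[OF lam]]] continuous_intros) auto
  qed (use lam0 in simp)
  moreover have "deriv (\<lambda>x. G lam (x + \<i> / 2 * of_real \<tau>)) x = - 2 * \<i> * deriv Y (of_real \<tau>)" for \<tau> :: real
  proof -
    have "((\<lambda>x. G lam (x + \<i> / 2 * of_real \<tau>)) has_field_derivative deriv (G lam) (x + \<i> / 2 * of_real \<tau>) * 1) (at x)"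
      by (rule DERIV_chain2[where f = "G lam" and g = "\<lambda>x. x + \<i> / 2 * of_real \<tau>", OF dG[OF strip_shift[OF x]]])
        (auto intro!: derivative_eq_intros)
    from DERIV_imp_deriv[OF this] show ?thesis by (simp add: dY)
  qed
  moreover have "claplace (\<lambda>\<tau>. deriv Y (of_real \<tau>)) (of_real lam)
      = of_real lam * (2 * \<i> * w x lam) - G lam x"
    using claplace_exp_type_deriv[OF Y \<eta>, of "of_real lam"] lam0 w_eq[OF x lam]
    by (simp add: Y_def field_simps)
  ultimately have "((\<lambda>x. claplace (\<lambda>\<tau>. G lam (x + \<i> / 2 * of_real \<tau>)) (of_real lam)) has_field_derivative
      - 2 * \<i> * (of_real lam * (2 * \<i> * w x lam) - G lam x)) (at x)"
    by (simp only: claplace_cmult)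
  moreover have "- 2 * \<i> * (of_real lam * (2 * \<i> * w x lam) - G lam x) / (2 * \<i>)
      = v x lam * \<Phi> x lam - 2 * \<i> * of_real lam * w x lam"
  proof -
    have "- 2 * \<i> * X / (2 * \<i>) = - X" for X :: complex by simp
    then show ?thesis by (simp only: G_eq[OF x lam]) (simp add: algebra_simps)
  qed
  ultimately
  have "((\<lambda>x. claplace (\<lambda>\<tau>. G lam (x + \<i> / 2 * of_real \<tau>)) (of_real lam) / (2 * \<i>)) has_field_derivative
      v x lam * \<Phi> x lam - 2 * \<i> * of_real lam * w x lam) (at x)"
    using DERIV_cdivide[of _ _ x UNIV "2 * \<i>"] by metis
  then show ?thesis
    by (rule has_field_derivative_transform_within_open[OF _ open_strip x]) (simp add: w_eq lam)
qed

end

section \<open>Borel summability\<close>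

text \<open>The formal series in \<open>1/lam\<close> whose Borel transform is the Taylor series of \<open>Y\<close> at \<open>0\<close>.\<close>

definition borel_series :: "(complex \<Rightarrow> complex) \<Rightarrow> complex fps" where
  "borel_series Y = Abs_fps (\<lambda>n. case n of 0 \<Rightarrow> 0 | Suc k \<Rightarrow> (deriv ^^ k) Y 0)"

lemma exp_type_is_borel_sum:
  assumes Y: "exp_type \<eta> \<nu> Y" and pos: "0 < \<eta>" "0 \<le> \<nu>" "\<nu> \<le> lam0"
    and f: "\<And>lam. lam > lam0 \<Longrightarrow> f lam = laplace (\<lambda>t. Y (of_real t)) lam"
  shows "is_borel_sum (fps_to_fls (borel_series Y)) lam0 f"
proof -
  have op: "open {t. \<bar>Im t\<bar> < \<eta>}" by (intro open_Collect_less continuous_intros)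
  have hol: "Y holomorphic_on {t. \<bar>Im t\<bar> < \<eta>}" using Y by (simp add: exp_type_def)
  have bt: "borel_transform (fps_to_fls (borel_series Y)) = fps_expansion Y 0"
    by (rule fps_ext) (simp add: borel_transform_def borel_series_def fps_expansion_def nat_add_distrib)
  have "Y has_fps_expansion fps_expansion Y 0"
    by (rule has_fps_expansion_fps_expansion[OF op _ hol]) (use pos in simp)
  then have fps: "fps_conv_radius (fps_expansion Y 0) > 0" "\<forall>\<^sub>F t in nhds 0. Y t = eval_fps (fps_expansion Y 0) t"
    unfolding has_fps_expansion_def by (auto elim: eventually_mono)
  have "Y analytic_on {t. \<bar>Im t\<bar> < \<eta>}" using hol op by (simp add: analytic_on_open)
  then have an: "Y analytic_on (complex_of_real ` {0..})"
    by (rule analytic_on_subset) (use pos in auto)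
  have "exp_growth (\<lambda>t. Y (of_real t))"
    unfolding exp_growth_def using exp_type_real(2)[OF Y pos(1)] by blast
  with fps an have "borel_summable_via (fps_to_fls (borel_series Y)) Y"
    unfolding borel_summable_via_def bt by blast
  moreover have "(\<Sum>k = fls_subdegree (fps_to_fls (borel_series Y))..0.
      fls_nth (fps_to_fls (borel_series Y)) k * complex_of_real lam powi (- k)) = 0" for lam
    by (rule sum.neutral) (auto simp: borel_series_def)
  ultimately show ?thesis
    unfolding is_borel_sum_def
    using exp_type_L1_weighted[OF Y pos(1)] pos(3) f by (intro exI[of _ Y]) auto
qed

lemma exp_type_has_asymptotic_series:
  assumes Y: "exp_type \<eta> \<nu> Y" and pos: "0 < \<eta>" "0 \<le> \<nu>"
    and f: "\<And>lam. lam > lam0 \<Longrightarrow> f lam = laplace (\<lambda>t. Y (of_real t)) lam"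
  shows "has_asymptotic_series f (borel_series Y)"
  by (rule claplace_asymptotic_series[OF Y pos _ _ f]) (auto simp: borel_series_def)

lemma exp_type_cnj:
  assumes "exp_type \<eta> \<nu> Y"
  shows "exp_type \<eta> \<nu> (\<lambda>t. cnj (Y (cnj t)))"
proof -
  have "cnj ` {t. \<bar>Im t\<bar> < \<eta>} = {t. \<bar>Im t\<bar> < \<eta>}" by (auto simp: in_image_cnj_iff)
  moreover have "open {t. \<bar>Im t\<bar> < \<eta>}" by (intro open_Collect_less continuous_intros)
  ultimately have "cnj \<circ> Y \<circ> cnj holomorphic_on {t. \<bar>Im t\<bar> < \<eta>}"
    using assms by (intro holomorphic_on_compose_cnj_cnj) (auto simp: exp_type_def)
  moreover obtain C where "0 \<le> C" "\<And>t. \<bar>Im t\<bar> < \<eta> \<Longrightarrow> norm (Y t) \<le> C * exp (\<nu> * norm t)"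
    using assms unfolding exp_type_def by blast
  moreover from this(2)[of "cnj _"] have "\<bar>Im t\<bar> < \<eta> \<Longrightarrow> norm (cnj (Y (cnj t))) \<le> C * exp (\<nu> * norm t)" for t
    by simp
  ultimately show ?thesis unfolding exp_type_def by (auto simp: o_def)
qed

lemma cnj_laplace: "cnj (laplace Y lam) = laplace (\<lambda>t. cnj (Y t)) lam"
  by (simp add: laplace_eq_claplace cnj_claplace)

context potential
begin

lemma chi_exp_type:
  assumes "x \<in> strip"
  shows "exp_type (2 * (1 - \<bar>Re x\<bar>)) \<nu> (chi x)"
  unfolding exp_type_def
proof (intro conjI exI[of _ "2 * (1 + norm x)"] allI impI)
  show "chi x holomorphic_on {t. \<bar>Im t\<bar> < 2 * (1 - \<bar>Re x\<bar>)}"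
    by (rule tube_holomorphicD(1)[OF chi_holomorphic assms])
  fix t assume "\<bar>Im t\<bar> < 2 * (1 - \<bar>Re x\<bar>)"
  then have "(x, t) \<in> tube" by (simp add: tube_def)
  then show "norm (chi x t) \<le> 2 * (1 + norm x) * exp (\<nu> * norm t)"
    using chi_bound unfolding lin_exp_bounded_def by blast
qed auto

lemma strip_width: "x \<in> strip \<Longrightarrow> 0 < 2 * (1 - \<bar>Re x\<bar>)"
  by (auto simp: strip_def)

lemma of_real_strip [simp]: "complex_of_real x \<in> strip \<longleftrightarrow> x \<in> {-1<..<1}"
  by (simp add: strip_def)

section \<open>The general solution\<close>

text \<open>\<open>\<psi>\<close> solves the differential equation on \<open>U\<close>, with derivative \<open>\<psi>'\<close>.\<close>

definition sol :: "real \<Rightarrow> real set \<Rightarrow> (real \<Rightarrow> complex) \<Rightarrow> (real \<Rightarrow> complex) \<Rightarrow> bool" where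
  "sol lam U \<psi> \<psi>' \<longleftrightarrow> (\<forall>x\<in>U. (\<psi> has_vector_derivative \<psi>' x) (at x) \<and>
     (\<psi>' has_vector_derivative (v (of_real x) lam - of_real lam ^ 2) * \<psi> x) (at x))"

lemma solves_E_iff_sol:
  assumes lam: "\<nu> < lam" and U: "U \<subseteq> {-1<..<1}"
  shows "solves_E V lam U \<psi> \<longleftrightarrow> (\<exists>\<psi>'. sol lam U \<psi> \<psi>')"
proof
  have vs: "(\<lambda>k. V k (of_real x) * of_real (1 / lam) ^ k) sums v (of_real x) lam" if "x \<in> U" for x
    using that U by (intro v_sums lam) auto
  have pow: "1 / complex_of_real (1 / lam) ^ 2 = of_real lam ^ 2"
    by (simp add: power_one_over)
  show "\<exists>\<psi>'. sol lam U \<psi> \<psi>'" if "solves_E V lam U \<psi>"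
  proof -
    obtain v' \<psi>' \<psi>'' where all: "\<forall>x\<in>U.
        (\<lambda>k. V k (of_real x) * of_real (1 / lam) ^ k) sums v' x \<and>
        (\<psi> has_vector_derivative \<psi>' x) (at x) \<and> (\<psi>' has_vector_derivative \<psi>'' x) (at x) \<and>
        \<psi>'' x + (1 / complex_of_real (1 / lam) ^ 2 - v' x) * \<psi> x = 0"
      using \<open>solves_E V lam U \<psi>\<close> unfolding solves_E_def by (elim exE)
    note * = all[rule_format, THEN conjunct1] all[rule_format, THEN conjunct2, THEN conjunct1]
      all[rule_format, THEN conjunct2, THEN conjunct2, THEN conjunct1]
      all[rule_format, THEN conjunct2, THEN conjunct2, THEN conjunct2]
    have "\<psi>'' x = (v (of_real x) lam - of_real lam ^ 2) * \<psi> x" if x: "x \<in> U" for x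
    proof -
      have "v' x = v (of_real x) lam" using sums_unique2[OF *(1)[OF x] vs[OF x]] .
      then show ?thesis using *(4)[OF x] unfolding pow by (simp add: algebra_simps add_eq_0_iff)
    qed
    then have "sol lam U \<psi> \<psi>'" using *(2,3) by (simp add: sol_def)
    then show ?thesis by blast
  qed
  show "solves_E V lam U \<psi>" if "\<exists>\<psi>'. sol lam U \<psi> \<psi>'"
  proof -
    from that obtain \<psi>' where *: "sol lam U \<psi> \<psi>'" ..
    show ?thesis unfolding solves_E_def
      by (rule exI[of _ "\<lambda>x. v (of_real x) lam"], rule exI[of _ \<psi>'],
          rule exI[of _ "\<lambda>x. (v (of_real x) lam - of_real lam ^ 2) * \<psi> x"], unfold pow)
        (use * vs in \<open>auto simp: sol_def algebra_simps\<close>)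
  qed
qed

lemma v_real:
  assumes "x \<in> {-1<..<1}" "\<nu> < lam"
  shows "cnj (v (of_real x) lam) = v (of_real x) lam"
proof -
  have s: "(\<lambda>k. V k (of_real x) * of_real (1 / lam) ^ k) sums v (of_real x) lam"
    using assms by (intro v_sums) auto
  have "cnj (V k (of_real x)) = V k (of_real x)" for k
    using V_real[OF assms(1)] Reals_cnj_iff by blast
  then have "(\<lambda>k. cnj (V k (of_real x) * of_real (1 / lam) ^ k))
      = (\<lambda>k. V k (of_real x) * of_real (1 / lam) ^ k)" by (simp only: complex_cnj_mult complex_cnj_power complex_cnj_complex_of_real)
  then show ?thesis using s sums_cnj[of "\<lambda>k. V k (of_real x) * of_real (1 / lam) ^ k"] sums_unique2 by metis
qed

lemma sol_cnj:
  assumes "sol lam U \<psi> \<psi>'" "\<nu> < lam" "U \<subseteq> {-1<..<1}"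
  shows "sol lam U (\<lambda>x. cnj (\<psi> x)) (\<lambda>x. cnj (\<psi>' x))"
  unfolding sol_def
proof (intro ballI conjI)
  fix x assume x: "x \<in> U"
  show "((\<lambda>x. cnj (\<psi> x)) has_vector_derivative cnj (\<psi>' x)) (at x)"
    using assms(1) x by (intro has_vector_derivative_cnj) (auto simp: sol_def)
  have "((\<lambda>x. cnj (\<psi>' x)) has_vector_derivative cnj ((v (of_real x) lam - of_real lam ^ 2) * \<psi> x)) (at x)"
    using assms(1) x by (intro has_vector_derivative_cnj) (auto simp: sol_def)
  moreover have "cnj (v (of_real x) lam) = v (of_real x) lam"
    using assms x by (intro v_real) auto
  ultimately show "((\<lambda>x. cnj (\<psi>' x)) has_vector_derivative (v (of_real x) lam - of_real lam ^ 2) * cnj (\<psi> x)) (at x)"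
    by simp
qed

lemma sol_lincomb:
  assumes "sol lam U f f'" "sol lam U g g'"
  shows "sol lam U (\<lambda>x. a * f x + b * g x) (\<lambda>x. a * f' x + b * g' x)"
  unfolding sol_def
proof (intro ballI conjI)
  fix x assume x: "x \<in> U"
  show "((\<lambda>x. a * f x + b * g x) has_vector_derivative a * f' x + b * g' x) (at x)"
    using assms x unfolding sol_def by (auto intro!: derivative_eq_intros)
  show "((\<lambda>x. a * f' x + b * g' x) has_vector_derivative
      (v (of_real x) lam - of_real lam ^ 2) * (a * f x + b * g x)) (at x)"
    using assms x unfolding sol_def by (auto intro!: derivative_eq_intros simp: algebra_simps)
qed

lemma sol_cong:
  assumes "sol lam U f f'" "open U" "\<And>x. x \<in> U \<Longrightarrow> f x = g x"
  shows "sol lam U g f'"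
  unfolding sol_def
proof (intro ballI conjI)
  fix x assume x: "x \<in> U"
  show "(g has_vector_derivative f' x) (at x)"
    by (rule has_vector_derivative_transform_within_open[OF _ assms(2) x assms(3)])
      (use assms(1) x in \<open>auto simp: sol_def\<close>)
  show "(f' has_vector_derivative (v (of_real x) lam - of_real lam ^ 2) * g x) (at x)"
    using assms(1) x assms(3)[OF x] by (auto simp: sol_def)
qed

lemma wronskian_constant:
  assumes f: "sol lam U f f'" and g: "sol lam U g g'" and U: "connected U" "0 \<in> U" and x: "x \<in> U"
  shows "f x * g' x - f' x * g x = f 0 * g' 0 - f' 0 * g 0"
proof -
  have "convex U" using U(1) by (simp add: is_interval_connected_1 is_interval_convex)
  moreover have "((\<lambda>x. f x * g' x - f' x * g x) has_vector_derivative 0) (at y within U)" if "y \<in> U" for y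
  proof -
    have "((\<lambda>x. f x * g' x - f' x * g x) has_vector_derivative
      (f y * ((v (of_real y) lam - of_real lam ^ 2) * g y) + f' y * g' y) -
      (f' y * g' y + ((v (of_real y) lam - of_real lam ^ 2) * f y) * g y)) (at y)"
      using f g that unfolding sol_def
      by (intro has_vector_derivative_diff has_vector_derivative_mult) auto
    also have "(f y * ((v (of_real y) lam - of_real lam ^ 2) * g y) + f' y * g' y) -
      (f' y * g' y + ((v (of_real y) lam - of_real lam ^ 2) * f y) * g y) = 0"
      by (simp add: algebra_simps)
    finally show ?thesis by (rule has_vector_derivative_at_within)
  qed
  ultimately show ?thesis
  proof (rule has_vector_derivative_zero_constant)
    fix c assume c: "\<And>x. x \<in> U \<Longrightarrow> f x * g' x - f' x * g x = c"
    show ?thesis unfolding c[OF x] c[OF U(2)] ..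
  qed
qed

text \<open>The solution \<open>\<psi>\<^sub>+ = exp (\<i> lam x) \<phi>\<^sub>+\<close> and its derivative.\<close>

definition \<psi>p :: "real \<Rightarrow> real \<Rightarrow> complex" where
  "\<psi>p lam x = exp (\<i> * of_real lam * of_real x) * \<Phi> (of_real x) lam"

definition \<psi>p' :: "real \<Rightarrow> real \<Rightarrow> complex" where
  "\<psi>p' lam x = exp (\<i> * of_real lam * of_real x) * (\<i> * of_real lam * \<Phi> (of_real x) lam + w (of_real x) lam)"

lemma \<psi>p_sol:
  assumes lam: "\<nu> < lam"
  shows "sol lam {-1<..<1} (\<psi>p lam) (\<psi>p' lam)"
  unfolding sol_def
proof (intro ballI conjI)
  fix x :: real assume "x \<in> {-1<..<1}"
  then have x: "of_real x \<in> strip" by simp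
  note [derivative_intros] = \<Phi>_has_field_derivative[OF x lam] w_has_field_derivative[OF x lam]
  have "((\<lambda>z. exp (\<i> * of_real lam * z) * \<Phi> z lam) has_field_derivative \<psi>p' lam x) (at (of_real x))"
    unfolding \<psi>p'_def by (rule derivative_eq_intros refl)+ (simp add: algebra_simps)
  from has_vector_derivative_real_field[OF this]
  show "(\<psi>p lam has_vector_derivative \<psi>p' lam x) (at x)" by (simp add: \<psi>p_def[abs_def])
  have "((\<lambda>z. exp (\<i> * of_real lam * z) * (\<i> * of_real lam * \<Phi> z lam + w z lam)) has_field_derivative
     (v (of_real x) lam - of_real lam ^ 2) * \<psi>p lam x) (at (of_real x))"
    unfolding \<psi>p_def by (rule derivative_eq_intros refl)+ (simp add: algebra_simps power2_eq_square)
  from has_vector_derivative_real_field[OF this]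
  show "(\<psi>p' lam has_vector_derivative (v (of_real x) lam - of_real lam ^ 2) * \<psi>p lam x) (at x)"
    by (simp add: \<psi>p'_def[abs_def])
qed

lemma sol_subset: "sol lam U f f' \<Longrightarrow> U' \<subseteq> U \<Longrightarrow> sol lam U' f f'"
  unfolding sol_def by blast

lemma \<Phi>_at_0: "0 < lam \<Longrightarrow> \<Phi> 0 lam = of_real (1 / lam)"
  unfolding \<Phi>_def using claplace_const[of "of_real lam" 1] by (simp add: chi_at_0)

text \<open>
  The potential is real on the real axis, so \<open>\<psi>\<^sub>+\<close> and its complex conjugate are both solutions.
  Their Wronskian at \<open>0\<close> is \<open>-2 \<i> (1 + Im (w 0 lam)) / lam\<close>, which is not zero for
  \<open>lam > \<nu> + 1\<close>.
\<close>

lemma general_solution: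
  assumes lam: "\<nu> + 1 < lam" and U: "connected U" "0 \<in> U" "U \<subseteq> {-1<..<1}" and \<psi>: "sol lam U \<psi> \<psi>'"
  shows "\<exists>C1 C2. \<forall>x\<in>U. \<psi> x = C1 * \<psi>p lam x + C2 * cnj (\<psi>p lam x)"
proof -
  have lam': "\<nu> < lam" "0 < lam" using lam \<nu>_pos by auto
  have p: "sol lam U (\<psi>p lam) (\<psi>p' lam)" by (rule sol_subset[OF \<psi>p_sol[OF lam'(1)] U(3)])
  have m: "sol lam U (\<lambda>x. cnj (\<psi>p lam x)) (\<lambda>x. cnj (\<psi>p' lam x))" by (rule sol_cnj[OF p lam'(1) U(3)])
  define c where "c = \<psi>p lam 0 * cnj (\<psi>p' lam 0) - \<psi>p' lam 0 * cnj (\<psi>p lam 0)"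
  define a where "a = \<psi> 0 * cnj (\<psi>p' lam 0) - \<psi>' 0 * cnj (\<psi>p lam 0)"
  define b where "b = \<psi> 0 * \<psi>p' lam 0 - \<psi>' 0 * \<psi>p lam 0"
  have "c \<noteq> 0"
  proof
    assume "c = 0"
    have "norm (w 0 lam) \<le> 1 / (lam - \<nu>)" using w_bound[OF lam'(1), of 0] by (simp add: strip_def)
    also have "\<dots> < 1" using lam by simp
    finally have "norm (w 0 lam) < 1" .
    then have "\<bar>Im (w 0 lam)\<bar> < 1" using abs_Im_le_cmod order_le_less_trans by blast
    moreover have "Im c = - 2 * (1 + Im (w 0 lam)) / lam"
      using lam'(2) by (simp add: c_def \<psi>p_def \<psi>p'_def \<Phi>_at_0 field_simps)
    ultimately show False using \<open>c = 0\<close> lam'(2) by simp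
  qed
  moreover have "\<psi> x * c = a * \<psi>p lam x - b * cnj (\<psi>p lam x)" if x: "x \<in> U" for x
  proof -
    have 1: "\<psi>p lam x * cnj (\<psi>p' lam x) - \<psi>p' lam x * cnj (\<psi>p lam x) = c"
      unfolding c_def by (rule wronskian_constant[OF p m U(1,2) x])
    have 2: "\<psi> x * cnj (\<psi>p' lam x) - \<psi>' x * cnj (\<psi>p lam x) = a"
      unfolding a_def by (rule wronskian_constant[OF \<psi> m U(1,2) x])
    have 3: "\<psi> x * \<psi>p' lam x - \<psi>' x * \<psi>p lam x = b"
      unfolding b_def by (rule wronskian_constant[OF \<psi> p U(1,2) x])
    show ?thesis unfolding 1[symmetric] 2[symmetric] 3[symmetric] by (simp add: algebra_simps)
  qed
  ultimately have "\<forall>x\<in>U. \<psi> x = a / c * \<psi>p lam x + (- b / c) * cnj (\<psi>p lam x)"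
    by (simp add: field_simps)
  then show ?thesis by blast
qed

section \<open>Uniqueness\<close>

text \<open>
  The inequality behind the exponential decay below, with \<open>d\<close>, \<open>d'\<close> the sizes of \<open>D b\<close>, \<open>D a\<close>
  and \<open>p\<close>, \<open>q\<close> those of \<open>lam \<cdot> P a\<close>, \<open>lam \<cdot> P b\<close>. If the exponential in the lower bound of \<open>p\<close> is not
  yet large then \<open>k\<close> is bounded, and the trivial bound \<open>d \<le> N\<close> suffices.
\<close>

lemma decay_of_ratio:
  fixes k \<alpha> \<beta> d d' N p q :: real
  assumes "k \<ge> 0" "\<alpha> > max \<beta> 0" and d: "0 \<le> d" "d \<le> N" "0 \<le> d'" "d' \<le> N"
    and p: "exp (2 * k * \<alpha>) / 2 - 3 / 2 \<le> p" and q: "q \<le> 3 / 2 * (exp (2 * k * \<beta>) + 1)"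
    and eq: "d * p = d' * q"
  shows "d \<le> 12 * N * exp (- (2 * (\<alpha> - max \<beta> 0)) * k)"
proof (cases "exp (2 * k * \<alpha>) \<ge> 6")
  case True
  define e where "e = exp (2 * k * max \<beta> 0)"
  have e: "exp (2 * k * \<beta>) \<le> e" "1 \<le> e" unfolding e_def using assms(1) by (auto intro!: mult_left_mono)
  have "3 / 2 * (exp (2 * k * \<beta>) + 1) \<le> 3 / 2 * (e + e)"
    using e by (intro mult_left_mono add_mono) auto
  then have "q \<le> 3 * e" using q by simp
  then have "d' * q \<le> d' * (3 * e)" using d by (intro mult_left_mono) auto
  also have "\<dots> \<le> N * (3 * e)" using d e(2) by (intro mult_right_mono) auto
  finally have "d * p \<le> N * (3 * e)" using eq by simp
  moreover have "d * (exp (2 * k * \<alpha>) / 4) \<le> d * p"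
    using True p d by (intro mult_left_mono) auto
  ultimately have "d * exp (2 * k * \<alpha>) \<le> 12 * N * e" by simp
  then have "d \<le> 12 * N * e * exp (- (2 * k * \<alpha>))" by (simp only: mult_exp_le_iff)
  also have "\<dots> = 12 * N * exp (- (2 * (\<alpha> - max \<beta> 0)) * k)"
    unfolding e_def mult.assoc mult_exp_exp by (simp add: algebra_simps)
  finally show ?thesis .
next
  case False
  have "exp (2 * (\<alpha> - max \<beta> 0) * k) \<le> exp (2 * k * \<alpha>)"
    using assms(1) mult_left_mono[of 0 "max \<beta> 0" k] by (simp add: algebra_simps)
  then have "exp (2 * (\<alpha> - max \<beta> 0) * k) \<le> 12" using False by linarith
  then have "d * exp (2 * (\<alpha> - max \<beta> 0) * k) \<le> N * 12"
    using d by (intro mult_mono) auto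
  then have "d \<le> N * 12 * exp (- (2 * (\<alpha> - max \<beta> 0) * k))" by (simp only: mult_exp_le_iff)
  then show ?thesis by (simp only: mult.commute[of N] minus_mult_left)
qed

text \<open>
  On a half-plane, and not only in sectors, \<open>lam \<phi>\<^sub>+\<close> is close to \<open>chi x 0 = 1\<close>.
\<close>

lemma claplace_chi_near_inverse:
  assumes x: "x \<in> strip"
  obtains m where "m > \<nu>" "\<And>z. Re z \<ge> m \<Longrightarrow> norm (z * claplace (\<lambda>t. chi x (of_real t)) z - 1) \<le> 1 / 2"
proof -
  note et = chi_exp_type[OF x] and pos = strip_width[OF x]
  obtain C where C: "0 \<le> C" "\<And>z. \<nu> < Re z \<Longrightarrow> norm (claplace (\<lambda>t. deriv (chi x) (of_real t)) z) \<le> C / (Re z - \<nu>)"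
    using exp_type_claplace_bound[OF exp_type_deriv[OF et pos]] \<nu>_pos pos by (metis half_gt_zero less_imp_le)
  show ?thesis
  proof (rule that[of "\<nu> + 2 * C + 1"])
    fix z assume z: "Re z \<ge> \<nu> + 2 * C + 1"
    have z': "\<nu> < Re z" "z \<noteq> 0" using z C(1) \<nu>_pos by auto
    have "z * claplace (\<lambda>t. chi x (of_real t)) z = 1 + claplace (\<lambda>t. deriv (chi x) (of_real t)) z"
      using claplace_exp_type_deriv[OF et pos _ z'(1)] \<nu>_pos chi_at_0(2)[OF x] z'(2)
      by (simp add: field_simps)
    moreover have "C / (Re z - \<nu>) \<le> 1 / 2" using z C(1) by (simp add: field_simps)
    ultimately show "norm (z * claplace (\<lambda>t. chi x (of_real t)) z - 1) \<le> 1 / 2"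
      using order_trans[OF C(2)[OF z'(1)], of "1 / 2"] by simp
  qed (use C(1) in auto)
qed

text \<open>
  Any other candidate differs from \<open>\<phi>\<^sub>+\<close> by \<open>D x\<close>, which is a multiple, independent of \<open>x\<close>, of
  \<open>P x = exp (-2 \<i> lam x) \<phi>\<^sub>- - \<phi>\<^sub>+\<close>. Hence \<open>D b \<cdot> P a = D a \<cdot> P b\<close> for all complex \<open>lam\<close> of large real
  part. Since \<open>P a\<close> is exponentially large as the imaginary part of \<open>lam\<close> tends to plus or minus
  infinity, according to the sign of \<open>a\<close>, while \<open>D a\<close> stays bounded, \<open>D b\<close> is exponentially small
  in both directions and vanishes by the theorem of Carlson type.
\<close>

lemma unique_plus:
  assumes L1: "\<And>x. x \<in> {-1<..<1} \<Longrightarrow> L1_weighted \<mu> (X x)"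
    and \<phi>: "\<And>x lam. x \<in> {-1<..<1} \<Longrightarrow> lam > \<mu> \<Longrightarrow> \<phi> x lam = laplace (X x) lam"
    and U: "open U" "connected U" "0 \<in> U" "U \<subseteq> {-1<..<1}"
    and sols: "\<forall>\<^sub>F lam in at_top. solves_E V lam U (wave 1 \<phi> lam) \<and> initial_cond lam (wave 1 \<phi> lam)"
    and b: "b \<in> U" and lam: "lam > max (\<nu> + 1) \<mu>"
  shows "\<phi> b lam = \<Phi> (of_real b) lam"
proof -
  define s where "s = max (\<nu> + 1) \<mu>"
  have s: "\<nu> < s" "\<mu> \<le> s" "\<nu> + 1 \<le> s" by (auto simp: s_def)
  have Us: "of_real x \<in> strip" if "x \<in> U" for x using that U by auto
  define L where "L x z = claplace (\<lambda>t. chi (of_real x) (of_real t)) z" for x z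
  define Lm where "Lm x z = claplace (\<lambda>t. cnj (chi (of_real x) (of_real t))) z" for x z
  define D where "D x z = claplace (X x) z - L x z" for x z
  define P where "P x z = exp (- 2 * \<i> * z * of_real x) * Lm x z - L x z" for x z
  have L1s: "L1_weighted s (X x)" "L1_weighted s (\<lambda>t. chi (of_real x) (of_real t))" if "x \<in> U" for x
    using that U L1_weighted_mono[OF L1 s(2)] chi_L1_weighted[OF Us s(1)] by auto
  have Lm_eq: "Lm x z = cnj (L x (cnj z))" for x z by (simp add: Lm_def L_def cnj_claplace)
  have D_hol: "D x holomorphic_on {z. s < Re z}" if "x \<in> U" for x
    unfolding D_def[abs_def] L_def by (intro holomorphic_intros claplace_holomorphic L1s that)
  have P_hol: "P x holomorphic_on {z. s < Re z}" if "x \<in> U" for x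
    unfolding P_def[abs_def] L_def Lm_def
    by (intro holomorphic_intros claplace_holomorphic L1s L1_weighted_cnj that)
  have "\<exists>N. \<forall>z. Re z > s \<longrightarrow> norm (D x z) \<le> N" if x: "x \<in> U" for x
  proof -
    have "norm (D x z) \<le> (\<integral>t. norm (exp (- s * t) *\<^sub>R X x t) \<partial>lebesgue_on {0..}) +
        (\<integral>t. norm (exp (- s * t) *\<^sub>R chi (of_real x) (of_real t)) \<partial>lebesgue_on {0..})" if "Re z > s" for z
      unfolding D_def L_def using that
      by (intro order_trans[OF norm_triangle_ineq4] add_mono norm_claplace_le L1s x) auto
    then show ?thesis by blast
  qed
  then obtain N where N: "\<And>x z. x \<in> U \<Longrightarrow> s < Re z \<Longrightarrow> norm (D x z) \<le> N x" by metis
  have "\<exists>m. \<forall>z. Re z > m \<longrightarrow> norm (z * L x z - 1) \<le> 1 / 2" if "x \<in> U" for x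
    using claplace_chi_near_inverse[OF Us[OF that]] unfolding L_def by (metis less_imp_le)
  then obtain m where m: "\<And>x z. x \<in> U \<Longrightarrow> m x < Re z \<Longrightarrow> norm (z * L x z - 1) \<le> 1 / 2" by metis
  have "\<forall>\<^sub>F lam in at_top. \<forall>x\<in>U. \<forall>y\<in>U. D x (of_real lam) * P y (of_real lam) = D y (of_real lam) * P x (of_real lam)"
    using sols eventually_gt_at_top[of s]
  proof eventually_elim
    case (elim lam)
    have lam: "\<nu> < lam" "\<nu> + 1 < lam" "\<mu> < lam" "0 < lam" using elim s \<nu>_pos by linarith+
    obtain \<psi>' where "sol lam U (wave 1 \<phi> lam) \<psi>'" using elim solves_E_iff_sol[OF lam(1) U(4)] by blast
    from general_solution[OF lam(2) U(2,3,4) this] obtain C1 C2 where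
      C: "\<And>x. x \<in> U \<Longrightarrow> wave 1 \<phi> lam x = C1 * \<psi>p lam x + C2 * cnj (\<psi>p lam x)" by blast
    have "complex_of_real (1 / lam) = (C1 + C2) * of_real (1 / lam)"
      using C[OF U(3)] elim lam(4)
      by (simp add: initial_cond_def \<psi>p_def \<Phi>_at_0 distrib_right del: of_real_divide)
    moreover have "complex_of_real (1 / lam) \<noteq> 0" using lam(4) by simp
    ultimately have "C1 + C2 = 1" unfolding mult_cancel_right1 by blast
    then have C1: "C1 = 1 - C2" by (simp add: algebra_simps)
    have "D x (of_real lam) = C2 * P x (of_real lam)" if x: "x \<in> U" for x
    proof -
      define E where "E = exp (\<i> * of_real lam * of_real x)"
      have E: "E \<noteq> 0" "cnj E = inverse E" "exp (- 2 * \<i> * of_real lam * of_real x) = inverse E * inverse E"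
        by (simp_all add: E_def exp_cnj exp_minus[symmetric] mult_exp_exp mult.assoc)
      have \<Phi>: "\<Phi> (of_real x) lam = L x (of_real lam)" by (simp add: \<Phi>_def L_def)
      have "\<phi> x lam = claplace (X x) (of_real lam)"
        using \<phi>[of x lam] x U lam by (auto simp: laplace_eq_claplace)
      then have "E * claplace (X x) (of_real lam)
          = (1 - C2) * (E * L x (of_real lam)) + C2 * (inverse E * Lm x (of_real lam))"
        using C[OF x] unfolding C1 E(2)[symmetric]
        by (simp add: wave_def \<psi>p_def E_def \<Phi> Lm_eq mult.assoc)
      then show ?thesis unfolding D_def P_def E(3) using E(1) by (simp add: field_simps)
    qed
    then show ?case by simp
  qed
  then obtain l where l: "\<And>lam x y. lam > l \<Longrightarrow> x \<in> U \<Longrightarrow> y \<in> U \<Longrightarrow>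
      D x (of_real lam) * P y (of_real lam) = D y (of_real lam) * P x (of_real lam)"
    unfolding eventually_at_top_dense by blast
  have DP: "D x z * P y z = D y z * P x z" if "x \<in> U" "y \<in> U" "s < Re z" for x y z
    by (rule half_plane_identity[where a = s and b = l]) (intro holomorphic_intros D_hol P_hol that l | assumption)+
  \<comment> \<open>points of \<open>U\<close> beyond both \<open>0\<close> and \<open>b\<close> on either side, for the two imaginary directions\<close>
  obtain a where a: "a \<in> U" "a > max b 0"
  proof -
    have "max b 0 \<in> U" using b U by (auto simp: max_def)
    then obtain e where e: "e > 0" "ball (max b 0) e \<subseteq> U" using U(1) open_contains_ball by blast
    moreover have "max b 0 + e / 2 \<in> ball (max b 0) e" using e by (simp add: dist_norm)
    ultimately show ?thesis using that[of "max b 0 + e / 2"] by auto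
  qed
  obtain a' where a': "a' \<in> U" "- a' > max (- b) 0"
  proof -
    have "min b 0 \<in> U" using b U by (auto simp: min_def)
    then obtain e where e: "e > 0" "ball (min b 0) e \<subseteq> U" using U(1) open_contains_ball by blast
    moreover have "min b 0 - e / 2 \<in> ball (min b 0) e" using e by (simp add: dist_norm)
    moreover have "- (min b 0 - e / 2) > max (- b) 0" using e by (auto simp: max_def min_def)
    ultimately show ?thesis using that[of "min b 0 - e / 2"] by blast
  qed
  define R where "R = Max {s, m b, m a, m a'}"
  define N' where "N' = Max {N b, N a, N a'}"
  have R: "s \<le> R" "m b \<le> R" "m a \<le> R" "m a' \<le> R" by (auto simp: R_def)
  have N': "N b \<le> N'" "N a \<le> N'" "N a' \<le> N'" by (auto simp: N'_def)
  have L_bounds: "1 / 2 \<le> norm (z * L x z)" "norm (z * L x z) \<le> 3 / 2"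
      "1 / 2 \<le> norm (z * Lm x z)" "norm (z * Lm x z) \<le> 3 / 2"
    if "x \<in> U" "m x < Re z" for x z
  proof -
    have near: "1 / 2 \<le> norm u \<and> norm u \<le> 3 / 2" if "norm (u - 1) \<le> 1 / 2" for u :: complex
      using that norm_triangle_ineq3[of u 1] by (auto simp: abs_le_iff)
    have "norm (z * Lm x z) = norm (cnj z * L x (cnj z))" by (simp add: Lm_eq norm_mult)
    then show "1 / 2 \<le> norm (z * L x z)" "norm (z * L x z) \<le> 3 / 2"
      "1 / 2 \<le> norm (z * Lm x z)" "norm (z * Lm x z) \<le> 3 / 2"
      using near[OF m[OF that]] near[OF m[of x "cnj z"]] that by auto
  qed
  have zP: "z * P x z = exp (- 2 * \<i> * z * of_real x) * (z * Lm x z) - z * L x z" for x z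
    by (simp add: P_def algebra_simps)
  have nexp: "norm (exp (- 2 * \<i> * z * of_real x)) = exp (2 * Im z * x)" for x z
    by (simp add: norm_exp_eq_Re)
  have P_lower: "exp (2 * Im z * x) / 2 - 3 / 2 \<le> norm (z * P x z)" if "x \<in> U" "m x < Re z" for x z
  proof -
    have "exp (2 * Im z * x) * (1 / 2) \<le> norm (exp (- 2 * \<i> * z * of_real x) * (z * Lm x z))"
      unfolding norm_mult[of "exp _"] nexp using L_bounds(3)[OF that] by (intro mult_left_mono) auto
    then show ?thesis unfolding zP
      using norm_triangle_ineq2[of "exp (- 2 * \<i> * z * of_real x) * (z * Lm x z)" "z * L x z"] L_bounds(2)[OF that]
      by linarith
  qed
  have P_upper: "norm (z * P x z) \<le> 3 / 2 * (exp (2 * Im z * x) + 1)" if "x \<in> U" "m x < Re z" for x z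
  proof -
    have "norm (exp (- 2 * \<i> * z * of_real x) * (z * Lm x z)) \<le> exp (2 * Im z * x) * (3 / 2)"
      unfolding norm_mult[of "exp _"] nexp using L_bounds(4)[OF that] by (intro mult_left_mono) auto
    moreover have "3 / 2 * (exp (2 * Im z * x) + 1) = exp (2 * Im z * x) * (3 / 2) + 3 / 2" by simp
    ultimately show ?thesis unfolding zP
      using norm_triangle_ineq4[of "exp (- 2 * \<i> * z * of_real x) * (z * Lm x z)" "z * L x z"] L_bounds(2)[OF that]
      by linarith
  qed
  define c where "c = min (2 * (a - max b 0)) (2 * (- a' - max (- b) 0))"
  have "D b z = 0" if z: "R < Re z" for z
  proof (rule carlson_half_plane[where F = "D b" and a = R and c = c and M = "12 * N'"])
    show "D b holomorphic_on {z. R < Re z}"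
      by (rule holomorphic_on_subset[OF D_hol[OF b]]) (use R in auto)
    show "0 < c" using a a' by (auto simp: c_def)
    fix z assume z: "R < Re z"
    have N0: "0 \<le> N'" using N[OF b, of z] N' z R norm_ge_zero[of "D b z"] by linarith
    have eq: "norm (D b z) * norm (z * P y z) = norm (D y z) * norm (z * P b z)" if "y \<in> U" for y
      using arg_cong[OF DP[OF b that, of z], of norm] z R by (simp add: norm_mult)
    have "\<exists>c'\<ge>c. norm (D b z) \<le> 12 * N' * exp (- c' * \<bar>Im z\<bar>)"
    proof (cases "0 \<le> Im z")
      case True
      have "norm (D b z) \<le> 12 * N' * exp (- (2 * (a - max b 0)) * Im z)"
        by (rule decay_of_ratio[OF True a(2) _ _ _ _ P_lower P_upper eq])
          (use N[OF b, of z] N[OF a(1), of z] N' R z a b in auto)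
      then show ?thesis using True by (intro exI[of _ "2 * (a - max b 0)"]) (auto simp: c_def)
    next
      case False
      have "norm (D b z) \<le> 12 * N' * exp (- (2 * (- a' - max (- b) 0)) * (- Im z))"
        by (rule decay_of_ratio[OF _ a'(2), of "- Im z" "norm (D b z)" N' "norm (D a' z)" "norm (z * P a' z)" "norm (z * P b z)"])
          (use False P_lower[of a' z] P_upper[of b z] eq[OF a'(1)] N[OF b, of z] N[OF a'(1), of z] N' R z a' b in auto)
      then show ?thesis using False by (intro exI[of _ "2 * (- a' - max (- b) 0)"]) (auto simp: c_def)
    qed
    then obtain c' where c': "c' \<ge> c" "norm (D b z) \<le> 12 * N' * exp (- c' * \<bar>Im z\<bar>)" by blast
    have "12 * N' * exp (- c' * \<bar>Im z\<bar>) \<le> 12 * N' * exp (- c * \<bar>Im z\<bar>)"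
      using N0 c'(1) by (intro mult_left_mono) (auto intro!: mult_right_mono)
    then show "norm (D b z) \<le> 12 * N' * exp (- c * \<bar>Im z\<bar>)" using c'(2) by linarith
  qed (rule z)
  then have "D b (of_real l) = 0" if "l > R" for l using that by simp
  then have "D b (of_real lam) = 0"
    by (rule half_plane_identity[where F = "D b" and G = "\<lambda>z. 0", OF D_hol[OF b] holomorphic_on_const])
      (use lam in \<open>auto simp: s_def\<close>)
  then show ?thesis
    using \<phi>[of b lam] b U lam by (auto simp: D_def L_def \<Phi>_def laplace_eq_claplace)
qed

lemma cnj_wave: "cnj (wave (-1) \<phi> lam x) = wave 1 (\<lambda>x lam. cnj (\<phi> x lam)) lam x"
  by (simp add: wave_def exp_cnj)

lemma unique_minus:
  assumes L1: "\<And>x. x \<in> {-1<..<1} \<Longrightarrow> L1_weighted \<mu> (X x)"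
    and \<phi>: "\<And>x lam. x \<in> {-1<..<1} \<Longrightarrow> lam > \<mu> \<Longrightarrow> \<phi> x lam = laplace (X x) lam"
    and U: "open U" "connected U" "0 \<in> U" "U \<subseteq> {-1<..<1}"
    and sols: "\<forall>\<^sub>F lam in at_top. solves_E V lam U (wave (-1) \<phi> lam) \<and> initial_cond lam (wave (-1) \<phi> lam)"
    and b: "b \<in> U" and lam: "lam > max (\<nu> + 1) \<mu>"
  shows "\<phi> b lam = cnj (\<Phi> (of_real b) lam)"
proof -
  have "cnj (\<phi> b lam) = \<Phi> (of_real b) lam"
  proof (rule unique_plus[where X = "\<lambda>x t. cnj (X x t)" and \<mu> = \<mu> and \<phi> = "\<lambda>x lam. cnj (\<phi> x lam)" and U = U])
    show "\<forall>\<^sub>F lam in at_top. solves_E V lam U (wave 1 (\<lambda>x lam. cnj (\<phi> x lam)) lam) \<and>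
        initial_cond lam (wave 1 (\<lambda>x lam. cnj (\<phi> x lam)) lam)"
      using sols eventually_gt_at_top[of \<nu>]
    proof eventually_elim
      case (elim lam)
      have eq: "wave 1 (\<lambda>x lam. cnj (\<phi> x lam)) lam = (\<lambda>x. cnj (wave (-1) \<phi> lam x))"
        by (simp add: cnj_wave fun_eq_iff)
      obtain \<psi>' where "sol lam U (wave (-1) \<phi> lam) \<psi>'"
        using elim solves_E_iff_sol[OF elim(2) U(4)] by blast
      from sol_cnj[OF this elim(2) U(4)] have "solves_E V lam U (\<lambda>x. cnj (wave (-1) \<phi> lam x))"
        using solves_E_iff_sol[OF elim(2) U(4)] by blast
      moreover have "initial_cond lam (\<lambda>x. cnj (wave (-1) \<phi> lam x))"
        using elim by (simp add: initial_cond_def)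
      ultimately show ?case unfolding eq ..
    qed
  qed (use L1 \<phi> U b lam in \<open>auto simp: L1_weighted_cnj cnj_laplace\<close>)
  then show ?thesis by (metis complex_cnj_cnj)
qed

end

theorem theorem2:
  fixes V :: "nat \<Rightarrow> complex \<Rightarrow> complex" and B K \<delta> :: real
  assumes "B > 0" "K > 0" "\<delta> > 0"
    and "\<And>k. V k holomorphic_on strip"
    and "\<And>k x. x \<in> {-1<..<1} \<Longrightarrow> V k (complex_of_real x) \<in> \<real>"
    and "bdd_above ((\<lambda>(k, x). (1 + norm x powr (1 + \<delta>)) * B powi (- int k) * norm (V k x)) ` (UNIV \<times> strip))"
    and "(SUP (k, x) \<in> UNIV \<times> strip. (1 + norm x powr (1 + \<delta>)) * B powi (- int k) * norm (V k x)) = K"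
  shows "\<exists>lam0>0. \<exists>\<phi>p \<phi>m :: real \<Rightarrow> real \<Rightarrow> complex. \<exists>ap am :: real \<Rightarrow> complex fps.
     (\<forall>lam>lam0. \<forall>\<psi>. solves_E V lam {-1<..<1} \<psi> \<longleftrightarrow>
        (\<exists>C1 C2. \<forall>x\<in>{-1<..<1}.
           \<psi> x = C1 * exp (\<i> * lam * x) * \<phi>p x lam + C2 * exp (- \<i> * lam * x) * \<phi>m x lam)) \<and>
     (\<forall>lam>lam0. \<forall>x\<in>{-1<..<1}. \<phi>m x lam = cnj (\<phi>p x lam)) \<and>
     (\<forall>x\<in>{-1<..<1}.
        has_asymptotic_series (\<phi>p x) (ap x) \<and> is_borel_sum (fps_to_fls (ap x)) lam0 (\<phi>p x) \<and>
        has_asymptotic_series (\<phi>m x) (am x) \<and> is_borel_sum (fps_to_fls (am x)) lam0 (\<phi>m x)) \<and>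
     (\<forall>lam>lam0. initial_cond lam (wave 1 \<phi>p lam) \<and> initial_cond lam (wave (-1) \<phi>m lam)) \<and>
     uniquely_determined V 1 lam0 \<phi>p \<and>
     uniquely_determined V (-1) lam0 \<phi>m"
proof -
  define \<nu> where "\<nu> = max (2 * B) (4 * K)"
  \<comment> \<open>the constant of the potential becomes \<open>2 * K\<close>, because of \<open>1 + norm x \<le> 2 * (1 + norm x powr (1 + \<delta>))\<close>\<close>
  have V_bound: "norm (V k x) \<le> 2 * K * B ^ k / (1 + norm x)" if x: "x \<in> strip" for k x
  proof -
    define p where "p = 1 + norm x powr (1 + \<delta>)"
    have "(\<lambda>(k, x). (1 + norm x powr (1 + \<delta>)) * B powi (- int k) * norm (V k x)) (k, x) \<le> K"
      unfolding assms(7)[symmetric] by (rule cSUP_upper[OF _ assms(6)]) (use x in auto)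
    then have "p * norm (V k x) \<le> K * B ^ k"
      using assms(1) by (simp add: p_def power_int_minus field_simps)
    moreover have "1 + norm x \<le> 2 * p"
    proof (cases "norm x \<le> 1")
      case True
      then show ?thesis using powr_ge_zero[of "norm x" "1 + \<delta>"] unfolding p_def distrib_left by linarith
    next
      case False
      then have "norm x powr 1 \<le> norm x powr (1 + \<delta>)"
        using assms(3) by (intro powr_mono) auto
      then show ?thesis using False by (simp add: p_def)
    qed
    then have "(1 + norm x) * norm (V k x) \<le> 2 * p * norm (V k x)"
      by (intro mult_right_mono) auto
    ultimately have "(1 + norm x) * norm (V k x) \<le> 2 * (K * B ^ k)" by linarith
    then show ?thesis using one_plus_norm_pos[of x] by (simp add: field_simps)
  qed
  interpret potential V B "2 * K" \<nu>
    by unfold_locales (use assms V_bound in \<open>auto simp: \<nu>_def\<close>)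
  define lam0 where "lam0 = \<nu> + 1"
  define \<phi>p where "\<phi>p x lam = \<Phi> (of_real x) lam" for x lam
  define \<phi>m where "\<phi>m x lam = cnj (\<Phi> (of_real x) lam)" for x lam
  define ap where "ap x = borel_series (chi (of_real x))" for x
  define am where "am x = borel_series (\<lambda>t. cnj (chi (of_real x) (cnj t)))" for x
  have lam: "\<nu> < lam" "\<nu> + 1 < lam" "0 < lam" if "lam > lam0" for lam
    using that \<nu>_pos by (auto simp: lam0_def)
  have term_eq: "C1 * exp (\<i> * of_real lam * of_real x) * \<phi>p x lam + C2 * exp (- \<i> * of_real lam * of_real x) * \<phi>m x lam
      = C1 * \<psi>p lam x + C2 * cnj (\<psi>p lam x)" for C1 C2 lam x
    by (simp add: \<phi>p_def \<phi>m_def \<psi>p_def exp_cnj)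
  have general: "solves_E V lam {-1<..<1} \<psi> \<longleftrightarrow> (\<exists>C1 C2. \<forall>x\<in>{-1<..<1}. \<psi> x = C1 * \<psi>p lam x + C2 * cnj (\<psi>p lam x))"
    if l: "lam > lam0" for lam \<psi>
  proof
    assume "solves_E V lam {-1<..<1} \<psi>"
    then obtain \<psi>' where "sol lam {-1<..<1} \<psi> \<psi>'"
      using solves_E_iff_sol[OF lam(1)[OF l] order_refl] by blast
    then show "\<exists>C1 C2. \<forall>x\<in>{-1<..<1}. \<psi> x = C1 * \<psi>p lam x + C2 * cnj (\<psi>p lam x)"
      by (intro general_solution lam[OF l]) auto
  next
    assume "\<exists>C1 C2. \<forall>x\<in>{-1<..<1}. \<psi> x = C1 * \<psi>p lam x + C2 * cnj (\<psi>p lam x)"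
    then obtain C1 C2 where C: "\<And>x. x \<in> {-1<..<1} \<Longrightarrow> \<psi> x = C1 * \<psi>p lam x + C2 * cnj (\<psi>p lam x)" by blast
    note p = \<psi>p_sol[OF lam(1)[OF l]]
    have "sol lam {-1<..<1} \<psi> (\<lambda>x. C1 * \<psi>p' lam x + C2 * cnj (\<psi>p' lam x))"
      by (rule sol_cong[OF sol_lincomb[OF p sol_cnj[OF p lam(1)[OF l] order_refl]]]) (use C in auto)
    then show "solves_E V lam {-1<..<1} \<psi>"
      using solves_E_iff_sol[OF lam(1)[OF l] order_refl] by blast
  qed
  have borel: "has_asymptotic_series (\<phi>p x) (ap x) \<and> is_borel_sum (fps_to_fls (ap x)) lam0 (\<phi>p x) \<and>
      has_asymptotic_series (\<phi>m x) (am x) \<and> is_borel_sum (fps_to_fls (am x)) lam0 (\<phi>m x)"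
    if x: "x \<in> {-1<..<1}" for x
  proof -
    have xs: "complex_of_real x \<in> strip" using x by simp
    note et = chi_exp_type[OF xs] and pos = strip_width[OF xs] less_imp_le[OF \<nu>_pos]
    have p: "\<phi>p x lam = laplace (\<lambda>t. chi (of_real x) (of_real t)) lam" for lam
      by (simp add: \<phi>p_def \<Phi>_def laplace_eq_claplace)
    have m: "\<phi>m x lam = laplace (\<lambda>t. cnj (chi (of_real x) (cnj (of_real t)))) lam" for lam
      using cnj_laplace[of "\<lambda>t. chi (of_real x) (of_real t)" lam]
      by (simp add: \<phi>m_def \<Phi>_def laplace_eq_claplace)
    have "\<nu> \<le> lam0" by (simp add: lam0_def)
    then show ?thesis unfolding ap_def am_def
      by (intro conjI exp_type_has_asymptotic_series[OF et pos p] exp_type_is_borel_sum[OF et pos _ p]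
          exp_type_has_asymptotic_series[OF exp_type_cnj[OF et] pos m]
          exp_type_is_borel_sum[OF exp_type_cnj[OF et] pos _ m])
  qed
  have unique_p: "uniquely_determined V 1 lam0 \<phi>p"
    unfolding uniquely_determined_def lam0_def \<phi>p_def
  proof (intro allI impI ballI, elim conjE)
    fix W U and \<mu> :: real and X \<phi> x lam
    assume *: "\<forall>x\<in>{-1<..<1}. L1_weighted \<mu> (X x)"
        "\<forall>x\<in>{-1<..<1}. \<forall>lam>\<mu>. \<phi> x lam = laplace (X x) lam"
        "open U" "connected U" "0 \<in> U" "U \<subseteq> {-1<..<1}"
        "\<forall>\<^sub>F lam in at_top. solves_E V lam U (wave 1 \<phi> lam) \<and> initial_cond lam (wave 1 \<phi> lam)"
        "x \<in> U" "lam > max (\<nu> + 1) \<mu>"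
    show "\<phi> x lam = \<Phi> (of_real x) lam"
      by (rule unique_plus[where X = X and \<mu> = \<mu>, OF _ _ *(3-9)]) (use *(1,2) in blast)+
  qed
  have unique_m: "uniquely_determined V (-1) lam0 \<phi>m"
    unfolding uniquely_determined_def lam0_def \<phi>m_def
  proof (intro allI impI ballI, elim conjE)
    fix W U and \<mu> :: real and X \<phi> x lam
    assume *: "\<forall>x\<in>{-1<..<1}. L1_weighted \<mu> (X x)"
        "\<forall>x\<in>{-1<..<1}. \<forall>lam>\<mu>. \<phi> x lam = laplace (X x) lam"
        "open U" "connected U" "0 \<in> U" "U \<subseteq> {-1<..<1}"
        "\<forall>\<^sub>F lam in at_top. solves_E V lam U (wave (-1) \<phi> lam) \<and> initial_cond lam (wave (-1) \<phi> lam)"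
        "x \<in> U" "lam > max (\<nu> + 1) \<mu>"
    show "\<phi> x lam = cnj (\<Phi> (of_real x) lam)"
      by (rule unique_minus[where X = X and \<mu> = \<mu>, OF _ _ *(3-9)]) (use *(1,2) in blast)+
  qed
  have initial: "initial_cond lam (wave 1 \<phi>p lam) \<and> initial_cond lam (wave (-1) \<phi>m lam)" if "lam > lam0" for lam
    using \<Phi>_at_0[of lam] lam[OF that] by (simp add: initial_cond_def wave_def \<phi>p_def \<phi>m_def)
  show ?thesis
    by (rule exI[of _ lam0], intro conjI, use \<nu>_pos in \<open>simp add: lam0_def\<close>,
        rule exI[of _ \<phi>p], rule exI[of _ \<phi>m], rule exI[of _ ap], rule exI[of _ am])
      (use general borel initial unique_p unique_m in \<open>simp only: term_eq\<close>, simp add: \<phi>p_def \<phi>m_def)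
qed

end
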